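(* Let $Q$ be a commutative ring and let $A$ be an $A_\infty$-algebra over $Q$ with $(A,\mu^A_1)$ a bounded below complex of projective $Q$-modules. Let $M$ be an $A_\infty$-module over $A$ and let $\epsilon_1\colon G\to M$ be a quasi-isomorphism of complexes (where $M$ has differential $\mu^M_1$) with $(G,\mu^G_1)$ a bounded below complex of projective $Q$-modules. Then there exist an $A_\infty$-module structure over $A$ on $G$ (extending the differential $\mu^G_1$) and a quasi-isomorphism of $A_\infty$-modules $\epsilon=(\epsilon_k)_{k\ge1}\colon G\to M$ extending $\epsilon_1$. If $\epsilon_1$ is degreewise surjective, then the morphism of $A_\infty$-modules $\epsilon$ can be chosen to be strict. If $A$ is split unital and $M$ is strictly unital, then the $A_\infty$-module structure on $G$ can be chosen to be strictly unital, and $\epsilon$ to be a morphism of strictly unital $A_\infty$-modules.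
   Context: All modules, complexes, maps and tensor products are over $Q$. Graded means $\mathbb Z$-graded with lower indices; differentials have degree $-1$. Tensor products of maps follow the Koszul sign rule $(f\otimes g)(m\otimes n)=(-1)^{|g||m|}f(m)\otimes g(n)$. An $A_\infty$-algebra is a graded module $A$ with maps $\mu^A_k\colon A^{\otimes k}\to A$ of degree $k-2$, $k\ge1$, such that $\sum_{u+v+w=k,\ u,w\ge0,\ v\ge1}(-1)^{u+vw}\mu^A_{u+1+w}(\mathrm{id}^{\otimes u}\otimes\mu^A_v\otimes\mathrm{id}^{\otimes w})=0$ for all $k\ge1$. It is strictly unital if there is a degree $0$ map $\eta^A\colon Q\to A$ with $\mu^A_2(\mathrm{id}\otimes\eta^A)=\mathrm{id}_A=\mu^A_2(\eta^A\otimes\mathrm{id})$ and $\mu^A_k(\mathrm{id}^{\otimes u}\otimes\eta^A\otimes\mathrm{id}^{\otimes w})=0$ for $k\ne2$, $u+w=k-1$; it is split unital if moreover $\eta^A$ splits as a map of graded modules. An $A_\infty$-module over $A$ is a graded module $M$ with maps $\mu^M_k\colon A^{\otimes(k-1)}\otimes M\to M$ of degree $k-2$, $k\ge1$, such that for all $k\ge1$ $$\sum_{u+v+w=k,\ u\ge0,\ v,w\ge1}(-1)^{u+vw}\mu^M_{u+1+w}(\mathrm{id}_A^{\otimes u}\otimes\mu^A_v\otimes\mathrm{id}_A^{\otimes(w-1)}\otimes\mathrm{id}_M)+\sum_{u+v=k,\ u\ge0,\ v\ge1}(-1)^u\mu^M_{u+1}(\mathrm{id}_A^{\otimes u}\otimes\mu^M_v)=0.$$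 In particular $(M,\mu^M_1)$ is a complex. If $A$ is strictly unital, $M$ is strictly unital if $\mu^M_2(\eta^A\otimes\mathrm{id}_M)=\mathrm{id}_M$ and $\mu^M_k(\mathrm{id}_A^{\otimes u}\otimes\eta^A\otimes\mathrm{id}_A^{\otimes w}\otimes\mathrm{id}_M)=0$ for $k\ge3$, $u+w=k-2$. A morphism of $A_\infty$-modules $\rho\colon M\to N$ over $A$ consists of maps $\rho_k\colon A^{\otimes(k-1)}\otimes M\to N$ of degree $k-1$, $k\ge1$, with $$\sum_{u+v+w=k,\ u,w\ge0,\ v\ge1}(-1)^{u+vw}\rho_{u+1+w}(\mathrm{id}^{\otimes u}\otimes\mu_v\otimes\mathrm{id}^{\otimes w})=\sum_{u+v=k,\ u\ge0,\ v\ge1}\mu^N_{u+1}(\mathrm{id}_A^{\otimes u}\otimes\rho_v),$$ where on the left $\mu_v=\mu^A_v$ if $w\ge1$ (the last tensor factor of $\mathrm{id}^{\otimes w}$ being $\mathrm{id}_M$) and $\mu_v=\mu^M_v$ if $w=0$. It is a quasi-isomorphism if $\rho_1$ is a quasi-isomorphism of complexes, and strict if $\rho_k=0$ for $k\ge2$. A morphism of strictly unital $A_\infty$-modules must also satisfy $\rho_k(\mathrm{id}_A^{\otimes u}\otimes\eta^A\otimes\mathrm{id}_A^{\otimes w}\otimes\mathrm{id}_M)=0$ for $k\ge2$, $u+w=k-2$. *)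

theory Defs
  imports Main "HOL-Library.Function_Algebras"
begin

section \<open>Modules over a commutative ring\<close>

text \<open>
  The ring \<open>Q\<close> is a type of sort \<open>{comm_ring, comm_monoid_mult}\<close>: a commutative ring with unit.
  The library class \<open>comm_ring_1\<close>, over which the library locale \<open>module\<close> is built, also demands
  \<open>0 \<noteq> 1\<close> and so excludes the zero ring; the locale below has the same axioms as \<open>module\<close>.
\<close>

locale qmodule =
  fixes scale :: "'q::{comm_ring,comm_monoid_mult} \<Rightarrow> 'm::ab_group_add \<Rightarrow> 'm"
  assumes scale_right_distrib: "scale q (x + y) = scale q x + scale q y"
    and scale_left_distrib: "scale (p + q) x = scale p x + scale q x"
    and scale_scale: "scale p (scale q x) = scale (p * q) x"
    and scale_one: "scale 1 x = x"

definition submodule ::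
  "('q::{comm_ring,comm_monoid_mult} \<Rightarrow> 'm::ab_group_add \<Rightarrow> 'm) \<Rightarrow> 'm set \<Rightarrow> bool" where
  "submodule s X \<longleftrightarrow>
     0 \<in> X \<and> (\<forall>x\<in>X. \<forall>y\<in>X. x + y \<in> X) \<and> (\<forall>q. \<forall>x\<in>X. s q x \<in> X)"

definition linear_on ::
  "('q::{comm_ring,comm_monoid_mult} \<Rightarrow> 'm::ab_group_add \<Rightarrow> 'm) \<Rightarrow> 'm set \<Rightarrow>
   ('q \<Rightarrow> 'n::ab_group_add \<Rightarrow> 'n) \<Rightarrow> 'n set \<Rightarrow> ('m \<Rightarrow> 'n) \<Rightarrow> bool" where
  "linear_on sX X sY Y f \<longleftrightarrow>
     (\<forall>x\<in>X. f x \<in> Y) \<and>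
     (\<forall>x\<in>X. \<forall>y\<in>X. f (x + y) = f x + f y) \<and>
     (\<forall>q. \<forall>x\<in>X. f (sX q x) = sY q (f x))"

text \<open>
  The free module with basis \<open>I\<close>, as finitely supported coefficient functions.
\<close>

definition free_module :: "'i set \<Rightarrow> ('i \<Rightarrow> 'q::{comm_ring,comm_monoid_mult}) set" where
  "free_module I = {c. finite {i. c i \<noteq> 0} \<and> {i. c i \<noteq> 0} \<subseteq> I}"

definition free_scale ::
  "'q::{comm_ring,comm_monoid_mult} \<Rightarrow> ('i \<Rightarrow> 'q) \<Rightarrow> 'i \<Rightarrow> 'q" where
  "free_scale q c = (\<lambda>i. q * c i)"

text \<open>
  A module is projective if it is a direct summand (a retract) of a free module. Index sets
  in the type of the module suffice, because a module is generated by its own elements.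
\<close>

definition projective ::
  "('q::{comm_ring,comm_monoid_mult} \<Rightarrow> 'm::ab_group_add \<Rightarrow> 'm) \<Rightarrow> 'm set \<Rightarrow> bool" where
  "projective s P \<longleftrightarrow>
     (\<exists>(I :: 'm set) \<sigma> \<pi>.
        linear_on s P free_scale (free_module I) \<sigma> \<and>
        linear_on free_scale (free_module I) s P \<pi> \<and>
        (\<forall>x\<in>P. \<pi> (\<sigma> x) = x))"


section \<open>Graded modules and complexes\<close>

text \<open>
  A graded module is a family \<open>M i\<close> (\<open>i\<close> an integer) of modules, realised as submodules of one
  ambient module; they need not be independent there. A homogeneous element is therefore
  carried around together with its degree, as a pair \<open>(i, x)\<close> with \<open>x \<in> M i\<close>.
\<close>

definition graded_module ::
  "('q::{comm_ring,comm_monoid_mult} \<Rightarrow> 'm::ab_group_add \<Rightarrow> 'm) \<Rightarrow> (int \<Rightarrow> 'm set) \<Rightarrow> bool" where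
  "graded_module s M \<longleftrightarrow> qmodule s \<and> (\<forall>i. submodule s (M i))"

definition homog :: "(int \<Rightarrow> 'm set) \<Rightarrow> (int \<times> 'm) set" where
  "homog M = (SIGMA i:UNIV. M i)"

definition graded_map ::
  "('q::{comm_ring,comm_monoid_mult} \<Rightarrow> 'm::ab_group_add \<Rightarrow> 'm) \<Rightarrow> (int \<Rightarrow> 'm set) \<Rightarrow>
   ('q \<Rightarrow> 'n::ab_group_add \<Rightarrow> 'n) \<Rightarrow> (int \<Rightarrow> 'n set) \<Rightarrow> int \<Rightarrow> (int \<times> 'm \<Rightarrow> 'n) \<Rightarrow> bool" where
  "graded_map sM M sN N d f \<longleftrightarrow> (\<forall>i. linear_on sM (M i) sN (N (i + d)) (\<lambda>x. f (i, x)))"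

definition chain_complex ::
  "('q::{comm_ring,comm_monoid_mult} \<Rightarrow> 'm::ab_group_add \<Rightarrow> 'm) \<Rightarrow> (int \<Rightarrow> 'm set) \<Rightarrow>
   (int \<times> 'm \<Rightarrow> 'm) \<Rightarrow> bool" where
  "chain_complex s M d \<longleftrightarrow>
     graded_module s M \<and> graded_map s M s M (-1) d \<and>
     (\<forall>i. \<forall>x\<in>M i. d (i - 1, d (i, x)) = 0)"

definition bounded_below :: "(int \<Rightarrow> 'm::ab_group_add set) \<Rightarrow> bool" where
  "bounded_below M \<longleftrightarrow> (\<exists>n. \<forall>i<n. M i = {0})"

definition chain_map ::
  "('q::{comm_ring,comm_monoid_mult} \<Rightarrow> 'm::ab_group_add \<Rightarrow> 'm) \<Rightarrow> (int \<Rightarrow> 'm set) \<Rightarrow>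
   (int \<times> 'm \<Rightarrow> 'm) \<Rightarrow> ('q \<Rightarrow> 'n::ab_group_add \<Rightarrow> 'n) \<Rightarrow> (int \<Rightarrow> 'n set) \<Rightarrow>
   (int \<times> 'n \<Rightarrow> 'n) \<Rightarrow> (int \<times> 'm \<Rightarrow> 'n) \<Rightarrow> bool" where
  "chain_map sM M dM sN N dN f \<longleftrightarrow>
     graded_map sM M sN N 0 f \<and>
     (\<forall>i. \<forall>x\<in>M i. dN (i, f (i, x)) = f (i - 1, dM (i, x)))"

definition cycles :: "(int \<Rightarrow> 'm::ab_group_add set) \<Rightarrow> (int \<times> 'm \<Rightarrow> 'm) \<Rightarrow> int \<Rightarrow> 'm set" where
  "cycles M d i = {x \<in> M i. d (i, x) = 0}"

definition boundaries :: "(int \<Rightarrow> 'm::ab_group_add set) \<Rightarrow> (int \<times> 'm \<Rightarrow> 'm) \<Rightarrow> int \<Rightarrow> 'm set" where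
  "boundaries M d i = (\<lambda>x. d (i + 1, x)) ` M (i + 1)"

definition homology_class ::
  "(int \<Rightarrow> 'm::ab_group_add set) \<Rightarrow> (int \<times> 'm \<Rightarrow> 'm) \<Rightarrow> int \<Rightarrow> 'm \<Rightarrow> 'm set" where
  "homology_class M d i z = (\<lambda>b. z + b) ` boundaries M d i"

definition homology ::
  "(int \<Rightarrow> 'm::ab_group_add set) \<Rightarrow> (int \<times> 'm \<Rightarrow> 'm) \<Rightarrow> int \<Rightarrow> 'm set set" where
  "homology M d i = homology_class M d i ` cycles M d i"

text \<open>
  The map induced on homology sends the class \<open>C\<close> to the class of \<open>f z\<close> for any \<open>z \<in> C\<close>; for a
  chain map these classes agree, so their union is that class. The induced map is linear, so
  it is an isomorphism as soon as it is bijective.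
\<close>

definition homology_map ::
  "(int \<Rightarrow> 'n::ab_group_add set) \<Rightarrow> (int \<times> 'n \<Rightarrow> 'n) \<Rightarrow> (int \<times> 'm \<Rightarrow> 'n) \<Rightarrow> int \<Rightarrow> 'm set \<Rightarrow> 'n set" where
  "homology_map N dN f i C = (\<Union>z\<in>C. homology_class N dN i (f (i, z)))"

definition quasi_isomorphism ::
  "('q::{comm_ring,comm_monoid_mult} \<Rightarrow> 'm::ab_group_add \<Rightarrow> 'm) \<Rightarrow> (int \<Rightarrow> 'm set) \<Rightarrow>
   (int \<times> 'm \<Rightarrow> 'm) \<Rightarrow> ('q \<Rightarrow> 'n::ab_group_add \<Rightarrow> 'n) \<Rightarrow> (int \<Rightarrow> 'n set) \<Rightarrow>
   (int \<times> 'n \<Rightarrow> 'n) \<Rightarrow> (int \<times> 'm \<Rightarrow> 'n) \<Rightarrow> bool" where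
  "quasi_isomorphism sM M dM sN N dN f \<longleftrightarrow>
     chain_map sM M dM sN N dN f \<and>
     (\<forall>i. bij_betw (homology_map N dN f i) (homology M dM i) (homology N dN i))"

definition degreewise_surjective ::
  "(int \<Rightarrow> 'm set) \<Rightarrow> (int \<Rightarrow> 'n set) \<Rightarrow> (int \<times> 'm \<Rightarrow> 'n) \<Rightarrow> bool" where
  "degreewise_surjective M N f \<longleftrightarrow> (\<forall>i. (\<lambda>x. f (i, x)) ` M i = N i)"


section \<open>Maps out of tensor products and Koszul signs\<close>

text \<open>
  A linear map of degree \<open>d\<close> out of a tensor product of graded modules is given by its values on
  tensors of homogeneous elements, that is, by a family of multilinear maps on the
  homogeneous components. So a map from the \<open>k\<close>-th tensor power of \<open>A\<close> is a function on lists
  of length \<open>k\<close> of homogeneous elements, and a map from the tensor product of the \<open>n\<close>-th tensor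
  power of \<open>A\<close> with \<open>M\<close> takes such a list of length \<open>n\<close> and a homogeneous element of \<open>M\<close>. Values
  outside the given components are irrelevant. One function on lists of all lengths encodes a
  whole sequence of maps: \<open>\<mu>\<^sub>k\<close> of an algebra is \<open>\<mu>\<close> on lists of length \<open>k\<close>, while \<open>\<mu>\<^sub>k\<close> of a module
  and \<open>\<rho>\<^sub>k\<close> of a morphism are \<open>\<mu>\<close> and \<open>\<rho>\<close> on lists of length \<open>k - 1\<close>.
\<close>

definition deg :: "(int \<times> 'a) list \<Rightarrow> int" where
  "deg as = sum_list (map fst as)"

definition multilinear ::
  "('q::{comm_ring,comm_monoid_mult} \<Rightarrow> 'a::ab_group_add \<Rightarrow> 'a) \<Rightarrow> (int \<Rightarrow> 'a set) \<Rightarrow>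
   ('q \<Rightarrow> 'n::ab_group_add \<Rightarrow> 'n) \<Rightarrow> (int \<Rightarrow> 'n set) \<Rightarrow> nat \<Rightarrow> int \<Rightarrow>
   ((int \<times> 'a) list \<Rightarrow> 'n) \<Rightarrow> bool" where
  "multilinear sA A sN N k d f \<longleftrightarrow>
     (\<forall>us\<in>lists (homog A). \<forall>ws\<in>lists (homog A). \<forall>i. length us + 1 + length ws = k \<longrightarrow>
        linear_on sA (A i) sN (N (deg us + i + deg ws + d)) (\<lambda>a. f (us @ (i, a) # ws)))"

definition multilinear_module ::
  "('q::{comm_ring,comm_monoid_mult} \<Rightarrow> 'a::ab_group_add \<Rightarrow> 'a) \<Rightarrow> (int \<Rightarrow> 'a set) \<Rightarrow>
   ('q \<Rightarrow> 'm::ab_group_add \<Rightarrow> 'm) \<Rightarrow> (int \<Rightarrow> 'm set) \<Rightarrow>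
   ('q \<Rightarrow> 'n::ab_group_add \<Rightarrow> 'n) \<Rightarrow> (int \<Rightarrow> 'n set) \<Rightarrow> nat \<Rightarrow> int \<Rightarrow>
   ((int \<times> 'a) list \<Rightarrow> int \<times> 'm \<Rightarrow> 'n) \<Rightarrow> bool" where
  "multilinear_module sA A sM M sN N n d f \<longleftrightarrow>
     (\<forall>y\<in>homog M. multilinear sA A sN (\<lambda>i. N (i + fst y)) n d (\<lambda>as. f as y)) \<and>
     (\<forall>as\<in>lists (homog A). length as = n \<longrightarrow> graded_map sM M sN N (deg as + d) (f as))"

text \<open>
  \<open>signed e x\<close> is \<open>(-1)^e x\<close>. By the Koszul rule, the map \<open>id \<otimes> g \<otimes> id\<close> with \<open>g\<close> of degree \<open>d\<close>
  acting after \<open>us\<close> contributes the sign with exponent \<open>d * deg us\<close>.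
\<close>

definition signed :: "int \<Rightarrow> 'm::ab_group_add \<Rightarrow> 'm" where
  "signed e x = (if even e then x else - x)"

definition app :: "int \<Rightarrow> ((int \<times> 'a) list \<Rightarrow> 'n) \<Rightarrow> (int \<times> 'a) list \<Rightarrow> int \<times> 'n" where
  "app d f as = (deg as + d, f as)"

definition app_module ::
  "int \<Rightarrow> ((int \<times> 'a) list \<Rightarrow> int \<times> 'm \<Rightarrow> 'n) \<Rightarrow> (int \<times> 'a) list \<Rightarrow> int \<times> 'm \<Rightarrow> int \<times> 'n" where
  "app_module d f as y = (deg as + fst y + d, f as y)"


section \<open>\<open>A\<^sub>\<infinity>\<close>-algebras\<close>

locale ainf_algebra =
  fixes sA :: "'q::{comm_ring,comm_monoid_mult} \<Rightarrow> 'a::ab_group_add \<Rightarrow> 'a"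
    and A :: "int \<Rightarrow> 'a set"
    and \<mu>A :: "(int \<times> 'a) list \<Rightarrow> 'a"
  assumes graded: "graded_module sA A"
    and multilinear: "k \<ge> 1 \<Longrightarrow> multilinear sA A sA A k (int k - 2) \<mu>A"
    and relation: "k \<ge> 1 \<Longrightarrow> as \<in> lists (homog A) \<Longrightarrow> length as = k \<Longrightarrow>
      (\<Sum>(u, v, w) | u + v + w = k \<and> v \<ge> 1.
         signed (int (u + v * w) + (int v - 2) * deg (take u as))
           (\<mu>A (take u as @ app (int v - 2) \<mu>A (take v (drop u as)) # drop (u + v) as))) = 0"

locale strictly_unital_algebra = ainf_algebra sA A \<mu>A
  for sA :: "'q::{comm_ring,comm_monoid_mult} \<Rightarrow> 'a::ab_group_add \<Rightarrow> 'a"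
    and A :: "int \<Rightarrow> 'a set"
    and \<mu>A :: "(int \<times> 'a) list \<Rightarrow> 'a" +
  fixes \<eta> :: "'q \<Rightarrow> 'a"
  assumes unit_linear: "linear_on (*) UNIV sA (A 0) \<eta>"
    and unit_right: "a \<in> homog A \<Longrightarrow> \<mu>A [a, (0, \<eta> q)] = sA q (snd a)"
    and unit_left: "a \<in> homog A \<Longrightarrow> \<mu>A [(0, \<eta> q), a] = sA q (snd a)"
    and unit_vanish: "us \<in> lists (homog A) \<Longrightarrow> ws \<in> lists (homog A) \<Longrightarrow>
      length us + 1 + length ws \<noteq> 2 \<Longrightarrow> \<mu>A (us @ (0, \<eta> q) # ws) = 0"

text \<open>
  As \<open>Q\<close> is concentrated in degree \<open>0\<close>, a retraction of graded modules onto \<open>Q\<close> is a linear map on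
  \<open>A 0\<close>.
\<close>

locale split_unital_algebra = strictly_unital_algebra sA A \<mu>A \<eta>
  for sA :: "'q::{comm_ring,comm_monoid_mult} \<Rightarrow> 'a::ab_group_add \<Rightarrow> 'a"
    and A :: "int \<Rightarrow> 'a set"
    and \<mu>A :: "(int \<times> 'a) list \<Rightarrow> 'a"
    and \<eta> :: "'q \<Rightarrow> 'a" +
  assumes unit_split: "\<exists>r. linear_on sA (A 0) (*) UNIV r \<and> (\<forall>q. r (\<eta> q) = q)"


section \<open>\<open>A\<^sub>\<infinity>\<close>-modules\<close>

locale ainf_module = algebra: ainf_algebra sA A \<mu>A
  for sA :: "'q::{comm_ring,comm_monoid_mult} \<Rightarrow> 'a::ab_group_add \<Rightarrow> 'a"
    and A :: "int \<Rightarrow> 'a set"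
    and \<mu>A :: "(int \<times> 'a) list \<Rightarrow> 'a" +
  fixes sM :: "'q \<Rightarrow> 'm::ab_group_add \<Rightarrow> 'm"
    and M :: "int \<Rightarrow> 'm set"
    and \<mu>M :: "(int \<times> 'a) list \<Rightarrow> int \<times> 'm \<Rightarrow> 'm"
  assumes graded: "graded_module sM M"
    and multilinear: "k \<ge> 1 \<Longrightarrow> multilinear_module sA A sM M sM M (k - 1) (int k - 2) \<mu>M"
    and relation: "k \<ge> 1 \<Longrightarrow> as \<in> lists (homog A) \<Longrightarrow> length as = k - 1 \<Longrightarrow> y \<in> homog M \<Longrightarrow>
      (\<Sum>(u, v, w) | u + v + w = k \<and> v \<ge> 1 \<and> w \<ge> 1.
         signed (int (u + v * w) + (int v - 2) * deg (take u as))
           (\<mu>M (take u as @ app (int v - 2) \<mu>A (take v (drop u as)) # drop (u + v) as) y)) +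
      (\<Sum>(u, v) | u + v = k \<and> v \<ge> 1.
         signed (int u + (int v - 2) * deg (take u as))
           (\<mu>M (take u as) (app_module (int v - 2) \<mu>M (drop u as) y))) = 0"

locale strictly_unital_module =
  algebra: strictly_unital_algebra sA A \<mu>A \<eta> + ainf_module sA A \<mu>A sM M \<mu>M
  for sA :: "'q::{comm_ring,comm_monoid_mult} \<Rightarrow> 'a::ab_group_add \<Rightarrow> 'a"
    and A :: "int \<Rightarrow> 'a set"
    and \<mu>A :: "(int \<times> 'a) list \<Rightarrow> 'a"
    and \<eta> :: "'q \<Rightarrow> 'a"
    and sM :: "'q \<Rightarrow> 'm::ab_group_add \<Rightarrow> 'm"
    and M :: "int \<Rightarrow> 'm set"
    and \<mu>M :: "(int \<times> 'a) list \<Rightarrow> int \<times> 'm \<Rightarrow> 'm" +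
  assumes unit_act: "y \<in> homog M \<Longrightarrow> \<mu>M [(0, \<eta> q)] y = sM q (snd y)"
    and unit_vanish: "us \<in> lists (homog A) \<Longrightarrow> ws \<in> lists (homog A) \<Longrightarrow> y \<in> homog M \<Longrightarrow>
      length us + length ws \<ge> 1 \<Longrightarrow> \<mu>M (us @ (0, \<eta> q) # ws) y = 0"


section \<open>Morphisms of \<open>A\<^sub>\<infinity>\<close>-modules\<close>

text \<open>
  The first two sums of the relation are the summands with \<open>w \<ge> 1\<close> and with \<open>w = 0\<close>.
\<close>

locale ainf_morphism =
  source: ainf_module sA A \<mu>A sM M \<mu>M + target: ainf_module sA A \<mu>A sN N \<mu>N
  for sA :: "'q::{comm_ring,comm_monoid_mult} \<Rightarrow> 'a::ab_group_add \<Rightarrow> 'a"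
    and A :: "int \<Rightarrow> 'a set"
    and \<mu>A :: "(int \<times> 'a) list \<Rightarrow> 'a"
    and sM :: "'q \<Rightarrow> 'm::ab_group_add \<Rightarrow> 'm"
    and M :: "int \<Rightarrow> 'm set"
    and \<mu>M :: "(int \<times> 'a) list \<Rightarrow> int \<times> 'm \<Rightarrow> 'm"
    and sN :: "'q \<Rightarrow> 'n::ab_group_add \<Rightarrow> 'n"
    and N :: "int \<Rightarrow> 'n set"
    and \<mu>N :: "(int \<times> 'a) list \<Rightarrow> int \<times> 'n \<Rightarrow> 'n" +
  fixes \<rho> :: "(int \<times> 'a) list \<Rightarrow> int \<times> 'm \<Rightarrow> 'n"
  assumes multilinear: "k \<ge> 1 \<Longrightarrow> multilinear_module sA A sM M sN N (k - 1) (int k - 1) \<rho>"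
    and relation: "k \<ge> 1 \<Longrightarrow> as \<in> lists (homog A) \<Longrightarrow> length as = k - 1 \<Longrightarrow> y \<in> homog M \<Longrightarrow>
      (\<Sum>(u, v, w) | u + v + w = k \<and> v \<ge> 1 \<and> w \<ge> 1.
         signed (int (u + v * w) + (int v - 2) * deg (take u as))
           (\<rho> (take u as @ app (int v - 2) \<mu>A (take v (drop u as)) # drop (u + v) as) y)) +
      (\<Sum>(u, v) | u + v = k \<and> v \<ge> 1.
         signed (int u + (int v - 2) * deg (take u as))
           (\<rho> (take u as) (app_module (int v - 2) \<mu>M (drop u as) y))) =
      (\<Sum>(u, v) | u + v = k \<and> v \<ge> 1.
         signed ((int v - 1) * deg (take u as))
           (\<mu>N (take u as) (app_module (int v - 1) \<rho> (drop u as) y)))"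

locale ainf_quasi_isomorphism = ainf_morphism +
  assumes quasi_iso: "quasi_isomorphism sM M (\<mu>M []) sN N (\<mu>N []) (\<rho> [])"

locale strict_ainf_morphism = ainf_morphism +
  assumes strict: "as \<in> lists (homog A) \<Longrightarrow> as \<noteq> [] \<Longrightarrow> y \<in> homog M \<Longrightarrow> \<rho> as y = 0"

locale strictly_unital_morphism =
  source: strictly_unital_module sA A \<mu>A \<eta> sM M \<mu>M +
  target: strictly_unital_module sA A \<mu>A \<eta> sN N \<mu>N +
  ainf_morphism sA A \<mu>A sM M \<mu>M sN N \<mu>N \<rho>
  for sA :: "'q::{comm_ring,comm_monoid_mult} \<Rightarrow> 'a::ab_group_add \<Rightarrow> 'a"
    and A :: "int \<Rightarrow> 'a set"
    and \<mu>A :: "(int \<times> 'a) list \<Rightarrow> 'a"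
    and \<eta> :: "'q \<Rightarrow> 'a"
    and sM :: "'q \<Rightarrow> 'm::ab_group_add \<Rightarrow> 'm"
    and M :: "int \<Rightarrow> 'm set"
    and \<mu>M :: "(int \<times> 'a) list \<Rightarrow> int \<times> 'm \<Rightarrow> 'm"
    and sN :: "'q \<Rightarrow> 'n::ab_group_add \<Rightarrow> 'n"
    and N :: "int \<Rightarrow> 'n set"
    and \<mu>N :: "(int \<times> 'a) list \<Rightarrow> int \<times> 'n \<Rightarrow> 'n"
    and \<rho> :: "(int \<times> 'a) list \<Rightarrow> int \<times> 'm \<Rightarrow> 'n" +
  assumes unit_vanish: "us \<in> lists (homog A) \<Longrightarrow> ws \<in> lists (homog A) \<Longrightarrow> y \<in> homog M \<Longrightarrow>
      \<rho> (us @ (0, \<eta> q) # ws) y = 0"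

end

theory Submission
  imports Defs "HOL-Library.Product_Plus"
begin

text \<open>
  After suspension, an \<open>A\<^sub>\<infinity>\<close>-module structure on \<open>G\<close> together with a morphism to \<open>M\<close> is the same as an
  \<open>A\<^sub>\<infinity>\<close>-module structure on the cone of \<open>\<epsilon>1\<close> that restricts to the given one on \<open>M\<close>. The operations
  on the cone are chosen one at a time, by recursion on the arity and then on the total degree of
  the arguments, which is bounded below in each arity. The relation to be satisfied reads
  \<open>dC (\<nu> w y) = - curvature\<close>, where the right-hand side involves earlier choices only. It is a cycle by
  the Bianchi identity for \<open>curvature = c \<circ> c\<close> (lemma \<open>cobar_square\<close>). As the cone of a quasi-isomorphism is
  acyclic and \<open>A i\<close> and \<open>G j\<close> are projective, a multilinear \<open>\<nu>\<close> exists.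
\<close>

section \<open>Linear maps on submodules\<close>

text \<open>Arity alone does not order the choices: besides \<open>dC\<close> of the unknown value
  at \<open>w\<close> and \<open>y\<close>, the relation there contains values of the same operation
  at arguments one of which has been hit by the differential of \<open>A\<close> or of
  \<open>G\<close>. Such a hit lowers the total degree by one, and below a bound depending on the
  arity every multilinear map vanishes, so the total degree can serve as second recursion parameter.

  Tensor products are never formed. Instead of projectivity of a tensor product, a dual basis is
  used in each slot, one slot after the other.

  The additional claims are built into the place where the operations are sought. Strictness holds
  because values are taken in the part \<open>C'\<close> of the cone, which is still large enough to
  hit all cycles. For the unit, the operation is a prescribed part plus a correction that vanishes
  on units; such a correction exists because the curvature itself vanishes as soon as one letter is
  the unit. The case without unit is run with the unit element replaced by \<open>0\<close>, so that
  one recursion proves all claims for one and the same structure.\<close>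

lemma (in qmodule) scale_zero_right: "scale q 0 = 0"
  using scale_right_distrib[of q 0 0] by simp

lemma (in qmodule) scale_zero_left: "scale 0 x = 0"
  using scale_left_distrib[of 0 0 x] by simp

lemma (in qmodule) scale_minus_left: "scale (- q) x = - scale q x"
  using scale_left_distrib[of q "- q" x] by (simp add: scale_zero_left minus_unique)

lemma (in qmodule) scale_minus_right: "scale q (- x) = - scale q x"
  using scale_right_distrib[of q x "- x"] by (simp add: scale_zero_right minus_unique)

definition qsubmodule ::
  "('q::{comm_ring,comm_monoid_mult} \<Rightarrow> 'm::ab_group_add \<Rightarrow> 'm) \<Rightarrow> 'm set \<Rightarrow> bool" where
  "qsubmodule s X \<longleftrightarrow> qmodule s \<and> submodule s X"

lemma graded_module_qsubmodule: "graded_module s M \<Longrightarrow> qsubmodule s (M i)"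
  by (simp add: graded_module_def qsubmodule_def)

lemma qsubmodule_zero: "qsubmodule s X \<Longrightarrow> 0 \<in> X"
  by (simp add: qsubmodule_def submodule_def)

lemma qsubmodule_add: "qsubmodule s X \<Longrightarrow> x \<in> X \<Longrightarrow> y \<in> X \<Longrightarrow> x + y \<in> X"
  by (simp add: qsubmodule_def submodule_def)

lemma qsubmodule_scale: "qsubmodule s X \<Longrightarrow> x \<in> X \<Longrightarrow> s q x \<in> X"
  by (simp add: qsubmodule_def submodule_def)

lemma qsubmodule_minus:
  assumes "qsubmodule s X" "x \<in> X" shows "- x \<in> X"
proof -
  interpret qmodule s using assms by (simp add: qsubmodule_def)
  have "s (- 1) x \<in> X" using assms by (rule qsubmodule_scale)
  thus ?thesis by (simp add: scale_minus_left scale_one)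
qed

lemma qsubmodule_diff: "qsubmodule s X \<Longrightarrow> x \<in> X \<Longrightarrow> y \<in> X \<Longrightarrow> x - y \<in> X"
  using qsubmodule_add[of s X x "- y"] qsubmodule_minus[of s X y] by simp

lemma qsubmodule_signed: "qsubmodule s X \<Longrightarrow> x \<in> X \<Longrightarrow> signed e x \<in> X"
  by (simp add: signed_def qsubmodule_minus)

lemma qsubmodule_sum:
  assumes "qsubmodule s X" "\<And>i. i \<in> I \<Longrightarrow> f i \<in> X" shows "sum f I \<in> X"
  using assms(2)
  by (induction I rule: infinite_finite_induct)
    (auto intro: qsubmodule_zero[OF assms(1)] qsubmodule_add[OF assms(1)])

lemma linear_on_mem: "linear_on s X t Y f \<Longrightarrow> x \<in> X \<Longrightarrow> f x \<in> Y"
  by (simp add: linear_on_def)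

lemma linear_on_add: "linear_on s X t Y f \<Longrightarrow> x \<in> X \<Longrightarrow> y \<in> X \<Longrightarrow> f (x + y) = f x + f y"
  by (simp add: linear_on_def)

lemma linear_on_scale: "linear_on s X t Y f \<Longrightarrow> x \<in> X \<Longrightarrow> f (s q x) = t q (f x)"
  by (simp add: linear_on_def)

lemma linear_on_0:
  assumes "linear_on s X t Y f" "qsubmodule s X" shows "f 0 = 0"
  using linear_on_add[OF assms(1), of 0 0] qsubmodule_zero[OF assms(2)] by simp

lemma linear_on_minus:
  assumes "linear_on s X t Y f" "qsubmodule s X" "x \<in> X" shows "f (- x) = - f x"
  using linear_on_add[OF assms(1), of x "- x"] linear_on_0[OF assms(1,2)]
    qsubmodule_minus[OF assms(2,3)] assms(3) by (simp add: minus_unique)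

lemma linear_on_diff:
  assumes "linear_on s X t Y f" "qsubmodule s X" "x \<in> X" "y \<in> X" shows "f (x - y) = f x - f y"
  using linear_on_add[OF assms(1), of x "- y"] linear_on_minus[OF assms(1,2,4)]
    qsubmodule_minus[OF assms(2,4)] assms(3) by simp

lemma linear_on_signed:
  assumes "linear_on s X t Y f" "qsubmodule s X" "x \<in> X" shows "f (signed e x) = signed e (f x)"
  by (simp add: signed_def linear_on_minus[OF assms])

lemma linear_on_sum:
  assumes "linear_on s X t Y f" "qsubmodule s X" "\<And>i. i \<in> I \<Longrightarrow> g i \<in> X"
  shows "f (sum g I) = (\<Sum>i\<in>I. f (g i))"
  using assms(3)
proof (induction I rule: infinite_finite_induct)
  case (insert i I)
  have "sum g I \<in> X" by (rule qsubmodule_sum[OF assms(2)]) (use insert in auto)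
  with insert show ?case by (simp add: linear_on_add[OF assms(1)])
qed (simp_all add: linear_on_0[OF assms(1,2)])

lemma linear_on_comp:
  "linear_on s X t Y f \<Longrightarrow> linear_on t Y r Z g \<Longrightarrow> linear_on s X r Z (\<lambda>x. g (f x))"
  by (simp add: linear_on_def)

lemma linear_on_mono: "linear_on s X t Y f \<Longrightarrow> Y \<subseteq> Z \<Longrightarrow> linear_on s X t Z f"
  by (auto simp: linear_on_def)

lemma linear_on_zero_map:
  assumes "qsubmodule t Y" shows "linear_on s X t Y (\<lambda>x. 0)"
proof -
  interpret qmodule t using assms by (simp add: qsubmodule_def)
  show ?thesis using qsubmodule_zero[OF assms] by (simp add: linear_on_def scale_zero_right)
qed

lemma linear_on_plus:
  assumes "qsubmodule t Y" "linear_on s X t Y f" "linear_on s X t Y g"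
  shows "linear_on s X t Y (\<lambda>x. f x + g x)"
proof -
  interpret qmodule t using assms by (simp add: qsubmodule_def)
  show ?thesis using assms
    by (simp add: linear_on_def scale_right_distrib qsubmodule_add algebra_simps)
qed

lemma linear_on_uminus:
  assumes "qsubmodule t Y" "linear_on s X t Y f" shows "linear_on s X t Y (\<lambda>x. - f x)"
proof -
  interpret qmodule t using assms by (simp add: qsubmodule_def)
  show ?thesis using assms
    by (simp add: linear_on_def scale_minus_right qsubmodule_minus)
qed

lemma linear_on_signed_map:
  "qsubmodule t Y \<Longrightarrow> linear_on s X t Y f \<Longrightarrow> linear_on s X t Y (\<lambda>x. signed e (f x))"
  by (cases "even e") (simp_all add: signed_def linear_on_uminus)

lemma linear_on_scale_map:
  assumes "qsubmodule t Y" "linear_on s X t Y f" shows "linear_on s X t Y (\<lambda>x. t q (f x))"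
proof -
  interpret qmodule t using assms by (simp add: qsubmodule_def)
  show ?thesis using assms
    by (simp add: linear_on_def scale_right_distrib scale_scale qsubmodule_scale mult.commute)
qed

lemma linear_on_sum_map:
  assumes "qsubmodule t Y" "\<And>i. i \<in> I \<Longrightarrow> linear_on s X t Y (f i)"
  shows "linear_on s X t Y (\<lambda>x. \<Sum>i\<in>I. f i x)"
  using assms(2)
  by (induction I rule: infinite_finite_induct)
    (auto intro: linear_on_zero_map[OF assms(1)] linear_on_plus[OF assms(1)])

section \<open>Calculus of signs\<close>

lemma signed_0 [simp]: "signed e 0 = 0"
  by (simp add: signed_def)

lemma signed_zero_exp [simp]: "signed 0 x = x"
  by (simp add: signed_def)

lemma signed_double [simp]: "signed (2 * e) x = x"
  by (simp add: signed_def)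

lemma signed_plus [simp]: "signed e (x + y) = signed e x + signed e y"
  by (simp add: signed_def)

lemma signed_minus [simp]: "signed e (- x) = - signed e x"
  by (simp add: signed_def)

lemma signed_signed [simp]: "signed e (signed f x) = signed (e + f) x"
  by (simp add: signed_def)

lemma signed_sum [simp]: "signed e (sum f I) = (\<Sum>i\<in>I. signed e (f i))"
  by (simp add: signed_def sum_negf)

lemma signed_eq_0_iff [simp]: "signed e x = 0 \<longleftrightarrow> x = 0"
  by (simp add: signed_def)

lemma signed_cong: "even (e - f) \<Longrightarrow> signed e x = signed f x"
  by (auto simp: signed_def)

lemma signed_opposite: "odd (e - f) \<Longrightarrow> signed e x = - signed f x"
  by (auto simp: signed_def)

lemma fst_signed [simp]: "fst (signed e x) = signed e (fst x)"
  by (simp add: signed_def)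

lemma snd_signed [simp]: "snd (signed e x) = signed e (snd x)"
  by (simp add: signed_def)

section \<open>Sums over deconcatenations\<close>

text \<open>The sum over all terms of the deconcatenation coproduct, including the two trivial ones.
  Recursion on the word lets coalgebra identities be proved by list induction instead of index
  arithmetic.\<close>

primrec cut_sum :: "'x list \<Rightarrow> ('x list \<Rightarrow> 'x list \<Rightarrow> 'n::ab_group_add) \<Rightarrow> 'n" where
  "cut_sum [] F = F [] []"
| "cut_sum (a # w) F = F [] (a # w) + cut_sum w (\<lambda>x z. F (a # x) z)"

lemma cut_sum_cong:
  "(\<And>x z. w = x @ z \<Longrightarrow> F x z = F' x z) \<Longrightarrow> cut_sum w F = cut_sum w F'"
proof (induction w arbitrary: F F')
  case (Cons a w)
  have "cut_sum w (\<lambda>x z. F (a # x) z) = cut_sum w (\<lambda>x z. F' (a # x) z)"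
    by (rule Cons.IH) (simp add: Cons.prems)
  thus ?case by (simp add: Cons.prems)
qed simp

lemma cut_sum_add: "cut_sum w (\<lambda>x z. F x z + F' x z) = cut_sum w F + cut_sum w F'"
  by (induction w arbitrary: F F') (simp_all add: algebra_simps)

lemma cut_sum_signed: "cut_sum w (\<lambda>x z. signed e (F x z)) = signed e (cut_sum w F)"
  by (induction w arbitrary: F) simp_all

lemma cut_sum_zero: "(\<And>x z. w = x @ z \<Longrightarrow> F x z = 0) \<Longrightarrow> cut_sum w F = 0"
proof (induction w arbitrary: F)
  case (Cons a w)
  have "cut_sum w (\<lambda>x z. F (a # x) z) = 0"
    by (rule Cons.IH) (simp add: Cons.prems)
  thus ?case by (simp add: Cons.prems)
qed simp

lemma cut_sum_mem:
  assumes "qsubmodule s X" "\<And>x z. w = x @ z \<Longrightarrow> F x z \<in> X"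
  shows "cut_sum w F \<in> X"
  using assms(2)
proof (induction w arbitrary: F)
  case (Cons a w)
  have "cut_sum w (\<lambda>x z. F (a # x) z) \<in> X"
    by (rule Cons.IH) (simp add: Cons.prems)
  thus ?case by (simp add: Cons.prems qsubmodule_add[OF assms(1)])
qed simp

lemma cut_sum_linear_image:
  assumes "linear_on s X t Y h" "qsubmodule s X" "\<And>x z. w = x @ z \<Longrightarrow> F x z \<in> X"
  shows "h (cut_sum w F) = cut_sum w (\<lambda>x z. h (F x z))"
  using assms(3)
proof (induction w arbitrary: F)
  case (Cons a w)
  have "cut_sum w (\<lambda>x z. F (a # x) z) \<in> X"
    by (rule cut_sum_mem[OF assms(2)]) (simp add: Cons.prems)
  moreover have "h (cut_sum w (\<lambda>x z. F (a # x) z)) = cut_sum w (\<lambda>x z. h (F (a # x) z))"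
    by (rule Cons.IH) (simp add: Cons.prems)
  ultimately show ?case by (simp add: Cons.prems linear_on_add[OF assms(1)])
qed simp

lemma linear_on_cut_sum:
  assumes "qsubmodule t Y" "\<And>x z. w = x @ z \<Longrightarrow> linear_on s X t Y (\<lambda>p. F p x z)"
  shows "linear_on s X t Y (\<lambda>p. cut_sum w (F p))"
  using assms(2)
proof (induction w arbitrary: F)
  case (Cons a w)
  have "linear_on s X t Y (\<lambda>p. cut_sum w (\<lambda>x z. F p (a # x) z))"
    by (rule Cons.IH) (simp add: Cons.prems)
  thus ?case using Cons.prems[of "[]" "a # w"] by (simp add: linear_on_plus[OF assms(1)])
qed simp

text \<open>A distinguished letter lies either in the right or in the left piece of a cut. This is
  the form needed to examine the dependence on one slot.\<close>

lemma cut_sum_append_Cons: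
  "cut_sum (us @ a # ws) F =
     cut_sum us (\<lambda>x z. F x (z @ a # ws)) + cut_sum ws (\<lambda>x z. F (us @ a # x) z)"
  by (induction us arbitrary: F) (simp_all add: algebra_simps)

text \<open>Coassociativity of deconcatenation: both sides sum over all cuts into three
  pieces.\<close>

lemma cut_sum_assoc:
  "cut_sum w (\<lambda>x z. cut_sum x (\<lambda>x1 x2. F x1 x2 z)) = cut_sum w (\<lambda>x z. cut_sum z (\<lambda>z1 z2. F x z1 z2))"
  by (induction w arbitrary: F) (simp_all add: cut_sum_add algebra_simps)

lemma cut_sum_conv_sum: "cut_sum w F = (\<Sum>i\<le>length w. F (take i w) (drop i w))"
  by (induction w arbitrary: F) (simp_all add: sum.atMost_Suc_shift del: sum.atMost_Suc)

lemma cut_sum_last: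
  assumes "\<And>x z. w = x @ z \<Longrightarrow> z \<noteq> [] \<Longrightarrow> F x z = 0" shows "cut_sum w F = F w []"
  using assms
proof (induction w arbitrary: F)
  case (Cons a w)
  have "cut_sum w (\<lambda>x z. F (a # x) z) = F (a # w) []"
    by (rule Cons.IH) (simp add: Cons.prems)
  thus ?case by (simp add: Cons.prems)
qed simp

lemma cut_sum_first:
  assumes "\<And>x z. w = x @ z \<Longrightarrow> x \<noteq> [] \<Longrightarrow> F x z = 0" shows "cut_sum w F = F [] w"
proof (cases w)
  case (Cons a v)
  have "cut_sum v (\<lambda>x z. F (a # x) z) = 0"
    by (rule cut_sum_zero) (simp add: Cons assms)
  thus ?thesis by (simp add: Cons)
qed simp

section \<open>The bar differential\<close>

text \<open>The degree of a word in the tensor coalgebra of the suspension, where each letter counts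
  one more than in \<open>A\<close>.\<close>

definition shdeg :: "(int \<times> 'a) list \<Rightarrow> int" where
  "shdeg w = deg w + int (length w)"

lemma deg_simps [simp]:
  "deg [] = 0" "deg (a # w) = fst a + deg w" "deg (v @ w) = deg v + deg w"
  by (simp_all add: deg_def)

lemma shdeg_simps [simp]:
  "shdeg [] = 0" "shdeg (a # w) = fst a + 1 + shdeg w" "shdeg (v @ w) = shdeg v + shdeg w"
  by (simp_all add: shdeg_def)

text \<open>
  \<open>bar_exp t [a\<^sub>1, \<dots>, a\<^sub>n]\<close> is the sum of \<open>(n - i + t) * fst a\<^sub>i\<close>: the exponent of the sign that
  turns an operation on \<open>n\<close> elements of \<open>A\<close>, followed by \<open>t\<close> further tensor factors, into one on
  the suspension.
\<close>

primrec bar_exp :: "nat \<Rightarrow> (int \<times> 'a) list \<Rightarrow> int" where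
  "bar_exp t [] = 0"
| "bar_exp t (a # w) = fst a * int (length w + t) + bar_exp t w"

text \<open>The suspended operation. It has degree -1: as a letter the result has degree
  \<open>shdeg w - 2\<close>, hence suspended degree \<open>shdeg w - 1\<close>. The degree is kept
  so that the result can be inserted into a word again.\<close>

definition bar_op :: "((int \<times> 'a) list \<Rightarrow> 'a::ab_group_add) \<Rightarrow> (int \<times> 'a) list \<Rightarrow> int \<times> 'a" where
  "bar_op \<mu> w = (deg w + int (length w) - 2, signed (bar_exp 0 w) (\<mu> w))"

text \<open>\<open>\<psi>\<close> composed with the bar differential, the coderivation induced by
  \<open>bar_op\<close>. For \<open>w = x @ y @ z\<close> with \<open>y\<close> nonempty, the word
  in which \<open>y\<close> is contracted to one letter appears with sign exponent
  \<open>shdeg x\<close>. The recursion asks whether the contracted factor starts at the first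
  letter.\<close>

primrec bar_sum :: "((int \<times> 'a) list \<Rightarrow> 'a::ab_group_add) \<Rightarrow> (int \<times> 'a) list \<Rightarrow>
    ((int \<times> 'a) list \<Rightarrow> 'n::ab_group_add) \<Rightarrow> 'n" where
  "bar_sum \<mu> [] \<psi> = 0"
| "bar_sum \<mu> (a # w) \<psi> = signed (fst a + 1) (bar_sum \<mu> w (\<lambda>v. \<psi> (a # v))) +
     cut_sum w (\<lambda>x z. \<psi> (bar_op \<mu> (a # x) # z))"

lemma fst_bar_op: "fst (bar_op \<mu> w) = shdeg w - 2"
  by (simp add: bar_op_def shdeg_def)

lemma bar_sum_add: "bar_sum \<mu> w (\<lambda>v. \<psi> v + \<psi>' v) = bar_sum \<mu> w \<psi> + bar_sum \<mu> w \<psi>'"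
  by (induction w arbitrary: \<psi> \<psi>') (simp_all add: cut_sum_add algebra_simps)

lemma bar_sum_signed: "bar_sum \<mu> w (\<lambda>v. signed e (\<psi> v)) = signed e (bar_sum \<mu> w \<psi>)"
  by (induction w arbitrary: \<psi>) (simp_all add: cut_sum_signed add.commute)

lemma bar_sum_minus: "bar_sum \<mu> w (\<lambda>v. - \<psi> v) = - bar_sum \<mu> w \<psi>"
  using bar_sum_signed[of \<mu> w 1 \<psi>] by (simp add: signed_def)

text \<open>The three sums belong to contracted factors to the left of the distinguished letter,
  around it, and to the right of it.\<close>

lemma bar_sum_append_Cons:
  "bar_sum \<mu> (us @ a # ws) \<psi> =
     bar_sum \<mu> us (\<lambda>x. \<psi> (x @ a # ws)) +
     cut_sum us (\<lambda>x z. cut_sum ws (\<lambda>p q. signed (shdeg x) (\<psi> (x @ bar_op \<mu> (z @ a # p) # q)))) +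
     signed (shdeg us + fst a + 1) (bar_sum \<mu> ws (\<lambda>z. \<psi> (us @ a # z)))"
  by (induction us arbitrary: \<psi>)
    (simp_all add: cut_sum_append_Cons cut_sum_signed[symmetric] algebra_simps)

text \<open>The coderivation property. A cut never divides the contracted letter, so it comes from a
  cut of \<open>w\<close> with the contracted factor inside one piece; passing the left piece costs
  its Koszul sign.\<close>

lemma bar_sum_cut_sum:
  "bar_sum \<mu> w (\<lambda>v. cut_sum v F) =
     cut_sum w (\<lambda>x z. bar_sum \<mu> x (\<lambda>x'. F x' z) + signed (shdeg x) (bar_sum \<mu> z (F x)))"
proof (induction w arbitrary: F)
  case (Cons a w)
  show ?case
    by (simp add: bar_sum_add Cons.IH cut_sum_add cut_sum_assoc cut_sum_signed[symmetric] algebra_simps)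
qed simp

text \<open>The properties of words produced by one contraction that later arguments rely on. The
  rules for \<open>bar_sum\<close> below check their premises on such words only, which is how
  degrees and lengths enter.\<close>

definition bar_step :: "(int \<Rightarrow> 'a set) \<Rightarrow> (int \<times> 'a) list \<Rightarrow> (int \<times> 'a) list \<Rightarrow> bool" where
  "bar_step A w v \<longleftrightarrow> v \<in> lists (homog A) \<and> v \<noteq> [] \<and> shdeg v = shdeg w - 1 \<and> length v \<le> length w"

definition word_multilinear ::
  "('q::{comm_ring,comm_monoid_mult} \<Rightarrow> 'a::ab_group_add \<Rightarrow> 'a) \<Rightarrow> (int \<Rightarrow> 'a set) \<Rightarrow>
   ('q \<Rightarrow> 'n::ab_group_add \<Rightarrow> 'n) \<Rightarrow> (int \<Rightarrow> 'n set) \<Rightarrow> int \<Rightarrow> ((int \<times> 'a) list \<Rightarrow> 'n) \<Rightarrow> bool" where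
  "word_multilinear sA A sN N d \<psi> \<longleftrightarrow>
     (\<forall>us\<in>lists (homog A). \<forall>ws\<in>lists (homog A). \<forall>i.
        linear_on sA (A i) sN (N (shdeg us + (i + 1) + shdeg ws + d)) (\<lambda>a. \<psi> (us @ (i, a) # ws)))"

lemma word_multilinear_slot:
  "word_multilinear sA A sN N d \<psi> \<Longrightarrow> us \<in> lists (homog A) \<Longrightarrow> ws \<in> lists (homog A) \<Longrightarrow>
   k = shdeg us + (i + 1) + shdeg ws + d \<Longrightarrow>
   linear_on sA (A i) sN (N k) (\<lambda>a. \<psi> (us @ (i, a) # ws))"
  by (simp add: word_multilinear_def)

lemma homogI: "x \<in> M i \<Longrightarrow> (i, x) \<in> homog M"
  by (simp add: homog_def)

lemma homogD: "y \<in> homog M \<Longrightarrow> snd y \<in> M (fst y)"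
  by (auto simp: homog_def)

lemma homog_iff: "(i, x) \<in> homog M \<longleftrightarrow> x \<in> M i"
  by (simp add: homog_def)

lemma word_multilinear_Cons:
  assumes "word_multilinear sA A sN N d \<psi>" "a \<in> homog A"
  shows "word_multilinear sA A sN N (fst a + 1 + d) (\<lambda>v. \<psi> (a # v))"
  unfolding word_multilinear_def
proof (intro ballI allI)
  fix us ws i assume "us \<in> lists (homog A)" "ws \<in> lists (homog A)"
  thus "linear_on sA (A i) sN (N (shdeg us + (i + 1) + shdeg ws + (fst a + 1 + d)))
     (\<lambda>x. \<psi> (a # us @ (i, x) # ws))"
    using word_multilinear_slot[OF assms(1), of "a # us" ws
        "shdeg us + (i + 1) + shdeg ws + (fst a + 1 + d)" i] assms(2)
    by simp
qed

lemma bar_exp_append: "bar_exp t (x @ z) = bar_exp t x + int (length z) * deg x + bar_exp t z"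
  by (induction x) (simp_all add: algebra_simps)

lemma bar_exp_shift: "bar_exp t x = bar_exp 0 x + int t * deg x"
  by (induction x) (simp_all add: algebra_simps)

section \<open>Comparison with the index sums of the defining relations\<close>

lemma finite_triples: "finite {(u, v, w). u + v + w = (n::nat) \<and> P u v w}"
  by (rule finite_subset[of _ "{..n} \<times> {..n} \<times> {..n}"]) auto

text \<open>Separating the summands with \<open>u = 0\<close> mirrors the recursion equation of
  \<open>bar_sum\<close>.\<close>

lemma triple_sum_Suc:
  fixes f :: "nat \<Rightarrow> nat \<Rightarrow> nat \<Rightarrow> 'n::ab_group_add"
  shows "(\<Sum>(u, v, w) | u + v + w = Suc n \<and> v \<ge> 1. f u v w) =
     (\<Sum>v\<le>n. f 0 (Suc v) (n - v)) + (\<Sum>(u, v, w) | u + v + w = n \<and> v \<ge> 1. f (Suc u) v w)"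
proof -
  let ?S = "{(u, v, w). u + v + w = Suc n \<and> v \<ge> 1}"
  let ?X = "(\<lambda>v. (0::nat, Suc v, n - v)) ` {..n}"
  let ?T = "{(u, v, w). u + v + w = n \<and> v \<ge> 1}"
  let ?Y = "(\<lambda>(u, v, w). (Suc u, v, w)) ` ?T"
  have S: "?S = ?X \<union> ?Y"
  proof (intro set_eqI iffI)
    fix p assume "p \<in> ?S"
    then obtain u v w where p: "p = (u, v, w)" "u + v + w = Suc n" "v \<ge> 1" by auto
    show "p \<in> ?X \<union> ?Y"
    proof (cases u)
      case 0
      hence "p = (\<lambda>v. (0, Suc v, n - v)) (v - 1)" "v - 1 \<in> {..n}" using p by auto
      thus ?thesis by blast
    next
      case (Suc u')
      hence "p = (\<lambda>(u, v, w). (Suc u, v, w)) (u', v, w)" "(u', v, w) \<in> ?T" using p by auto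
      thus ?thesis by blast
    qed
  qed auto
  have "(\<Sum>(u, v, w)\<in>?S. f u v w) = (\<Sum>(u, v, w)\<in>?X. f u v w) + (\<Sum>(u, v, w)\<in>?Y. f u v w)"
    unfolding S by (rule sum.union_disjoint) (auto intro: finite_imageI finite_triples)
  also have "(\<Sum>(u, v, w)\<in>?X. f u v w) = (\<Sum>v\<le>n. f 0 (Suc v) (n - v))"
    by (subst sum.reindex) (auto simp: inj_on_def)
  also have "(\<Sum>(u, v, w)\<in>?Y. f u v w) = (\<Sum>(u, v, w)\<in>?T. f (Suc u) v w)"
    by (subst sum.reindex) (auto simp: inj_on_def intro!: sum.cong)
  finally show ?thesis .
qed

lemma bar_sum_conv_sum:
  "bar_sum \<mu> as \<psi> = (\<Sum>(u, v, w) | u + v + w = length as \<and> v \<ge> 1.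
     signed (shdeg (take u as)) (\<psi> (take u as @ bar_op \<mu> (take v (drop u as)) # drop (u + v) as)))"
proof (induction as arbitrary: \<psi>)
  case Nil
  show ?case by (rule sym) (auto intro: sum.neutral)
next
  case (Cons a as)
  show ?case
    unfolding length_Cons triple_sum_Suc
    by (simp add: Cons.IH cut_sum_conv_sum split_def algebra_simps)
qed

lemma pair_sum_conv:
  fixes f :: "nat \<Rightarrow> nat \<Rightarrow> 'n::ab_group_add"
  shows "(\<Sum>(u, v) | u + v = Suc n \<and> v \<ge> 1. f u v) = (\<Sum>u\<le>n. f u (Suc n - u))"
  by (rule sum.reindex_bij_witness[of _ "\<lambda>u. (u, Suc n - u)" fst]) (auto, metis add_diff_cancel_left')

lemma triple_sum_shift:
  fixes f :: "nat \<Rightarrow> nat \<Rightarrow> nat \<Rightarrow> 'n::ab_group_add"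
  shows "(\<Sum>(u, v, w) | u + v + w = Suc n \<and> v \<ge> 1 \<and> w \<ge> 1. f u v w) =
     (\<Sum>(u, v, w) | u + v + w = n \<and> v \<ge> 1. f u v (Suc w))"
  by (rule sum.reindex_bij_witness[of _ "\<lambda>(u, v, w). (u, v, Suc w)" "\<lambda>(u, v, w). (u, v, w - 1)"]) auto

text \<open>Suspension turns the signs of the defining relations into Koszul signs. The number
  \<open>t\<close> counts the tensor factors that follow the word: \<open>0\<close> in the algebra
  relation, \<open>1\<close> in the relations with a module. Assumption \<open>neg\<close> serves to
  pull the sign inside \<open>bar_op\<close> out of \<open>\<psi>\<close>; what remains is a parity
  identity between exponents.\<close>

lemma bar_sum_conv_relation:
  fixes \<psi> :: "(int \<times> 'a::ab_group_add) list \<Rightarrow> 'n::ab_group_add"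
  assumes neg: "\<And>x y z. as = x @ y @ z \<Longrightarrow> y \<noteq> [] \<Longrightarrow>
     \<psi> (x @ (shdeg y - 2, - \<mu> y) # z) = - \<psi> (x @ (shdeg y - 2, \<mu> y) # z)"
  shows "(\<Sum>(u, v, w) | u + v + w = length as \<and> v \<ge> 1.
      signed (int (u + v * (w + t)) + (int v - 2) * deg (take u as))
        (\<psi> (take u as @ app (int v - 2) \<mu> (take v (drop u as)) # drop (u + v) as))) =
    signed (bar_exp t as) (bar_sum \<mu> as (\<lambda>v. signed (bar_exp t v) (\<psi> v)))"
  unfolding bar_sum_conv_sum signed_sum
proof (rule sum.cong[OF refl], clarify)
  fix u v w assume uvw: "u + v + w = length as" "v \<ge> 1"
  define x y z where xyz: "x = take u as" "y = take v (drop u as)" "z = drop (u + v) as"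
  have as: "as = x @ y @ z" unfolding xyz
    by (metis append_take_drop_id drop_drop add.commute)
  have len: "length x = u" "length y = v" "length z = w" using uvw by (auto simp: xyz)
  have y: "y \<noteq> []" using len uvw by auto
  have sg: "\<psi> (x @ bar_op \<mu> y # z) = signed (bar_exp 0 y) (\<psi> (x @ app (int v - 2) \<mu> y # z))"
    using neg[OF as y] by (simp add: bar_op_def app_def signed_def len shdeg_def algebra_simps)
  have ev: "even ((int (u + v * (w + t)) + (int v - 2) * deg x) -
      (bar_exp t as + (shdeg x + (bar_exp t (x @ bar_op \<mu> y # z) + bar_exp 0 y))))"
    unfolding as by (simp add: bar_exp_append bar_exp_shift[of t] bar_op_def shdeg_def len algebra_simps)
  show "signed (int (u + v * (w + t)) + (int v - 2) * deg (take u as))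
        (\<psi> (take u as @ app (int v - 2) \<mu> (take v (drop u as)) # drop (u + v) as)) =
    signed (bar_exp t as) (signed (shdeg (take u as))
       (signed (bar_exp t (take u as @ bar_op \<mu> (take v (drop u as)) # drop (u + v) as))
         (\<psi> (take u as @ bar_op \<mu> (take v (drop u as)) # drop (u + v) as))))"
    unfolding xyz[symmetric] sg signed_signed by (rule signed_cong) (use ev in simp)
qed

section \<open>The bar differential of an A-infinity algebra squares to zero\<close>

context ainf_algebra
begin

lemma qsubmodule_A: "qsubmodule sA (A i)"
  by (rule graded_module_qsubmodule[OF graded])

lemma linear_bar_op:
  assumes "us \<in> lists (homog A)" "ws \<in> lists (homog A)"
    and "k = shdeg us + (i + 1) + shdeg ws - 2"
  shows "linear_on sA (A i) sA (A k) (\<lambda>a. snd (bar_op \<mu>A (us @ (i, a) # ws)))"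
proof -
  have "linear_on sA (A i) sA (A (deg us + i + deg ws + (int (length us + 1 + length ws) - 2)))
      (\<lambda>a. \<mu>A (us @ (i, a) # ws))"
    using multilinear[of "length us + 1 + length ws"] assms unfolding multilinear_def by simp
  moreover have "deg us + i + deg ws + (int (length us + 1 + length ws) - 2) = k"
    using assms by (simp add: shdeg_def)
  moreover have "(\<lambda>a. snd (bar_op \<mu>A (us @ (i, a) # ws))) =
      (\<lambda>a. signed (bar_exp 0 (us @ (i, 0) # ws)) (\<mu>A (us @ (i, a) # ws)))"
    by (simp add: bar_op_def bar_exp_append)
  ultimately show ?thesis
    by (simp only: linear_on_signed_map[OF qsubmodule_A])
qed

lemma bar_op_homog:
  assumes "w \<in> lists (homog A)" "w \<noteq> []" shows "bar_op \<mu>A w \<in> homog A"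
proof -
  obtain a ws where w: "w = a # ws" using assms(2) by (cases w) auto
  have "linear_on sA (A (fst a)) sA (A (fst (bar_op \<mu>A w))) (\<lambda>x. snd (bar_op \<mu>A ([] @ (fst a, x) # ws)))"
    by (rule linear_bar_op) (use assms w in \<open>auto simp: fst_bar_op\<close>)
  from linear_on_mem[OF this, of "snd a"] have "snd (bar_op \<mu>A w) \<in> A (fst (bar_op \<mu>A w))"
    using w assms(1) homogD[of a A] by simp
  thus ?thesis by (cases "bar_op \<mu>A w") (simp add: homog_def)
qed

lemma bar_step_Cons: "bar_step A w v \<Longrightarrow> a \<in> homog A \<Longrightarrow> bar_step A (a # w) (a # v)"
  by (simp add: bar_step_def)

lemma bar_step_bar_op:
  assumes "a # x @ z \<in> lists (homog A)"
  shows "bar_step A (a # x @ z) (bar_op \<mu>A (a # x) # z)"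
  using assms bar_op_homog[of "a # x"] by (simp add: bar_step_def fst_bar_op)

lemma bar_sum_cong:
  assumes "w \<in> lists (homog A)" "\<And>v. bar_step A w v \<Longrightarrow> \<psi> v = \<psi>' v"
  shows "bar_sum \<mu>A w \<psi> = bar_sum \<mu>A w \<psi>'"
  using assms
proof (induction w arbitrary: \<psi> \<psi>' rule: list.induct)
  case (Cons a w)
  have "bar_sum \<mu>A w (\<lambda>v. \<psi> (a # v)) = bar_sum \<mu>A w (\<lambda>v. \<psi>' (a # v))"
    by (rule Cons.IH) (use Cons.prems(1) in \<open>auto intro!: Cons.prems(2) bar_step_Cons\<close>)
  moreover have "cut_sum w (\<lambda>x z. \<psi> (bar_op \<mu>A (a # x) # z)) =
      cut_sum w (\<lambda>x z. \<psi>' (bar_op \<mu>A (a # x) # z))"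
    by (rule cut_sum_cong) (use Cons.prems in \<open>simp_all add: bar_step_bar_op\<close>)
  ultimately show ?case by simp
qed simp

lemma bar_sum_zero:
  assumes "w \<in> lists (homog A)" "\<And>v. bar_step A w v \<Longrightarrow> \<psi> v = 0"
  shows "bar_sum \<mu>A w \<psi> = 0"
  using bar_sum_cong[OF assms(1), of \<psi> "\<lambda>v. 0"] assms(2) bar_sum_add[of \<mu>A w "\<lambda>v. 0" "\<lambda>v. 0"] by simp

lemma bar_sum_mem:
  assumes "qsubmodule s X" "w \<in> lists (homog A)" "\<And>v. bar_step A w v \<Longrightarrow> \<psi> v \<in> X"
  shows "bar_sum \<mu>A w \<psi> \<in> X"
  using assms(2-)
proof (induction w arbitrary: \<psi> rule: list.induct)
  case (Cons a w)
  have "bar_sum \<mu>A w (\<lambda>v. \<psi> (a # v)) \<in> X"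
    by (rule Cons.IH) (use Cons.prems(1) in \<open>auto intro!: Cons.prems(2) bar_step_Cons\<close>)
  moreover have "cut_sum w (\<lambda>x z. \<psi> (bar_op \<mu>A (a # x) # z)) \<in> X"
    by (rule cut_sum_mem[OF assms(1)]) (use Cons.prems in \<open>simp_all add: bar_step_bar_op\<close>)
  ultimately show ?case by (simp add: qsubmodule_add[OF assms(1)] qsubmodule_signed[OF assms(1)])
qed (simp add: qsubmodule_zero[OF assms(1)])

lemma bar_sum_linear_image:
  assumes "linear_on s X t Y h" "qsubmodule s X" "w \<in> lists (homog A)"
    "\<And>v. bar_step A w v \<Longrightarrow> \<psi> v \<in> X"
  shows "h (bar_sum \<mu>A w \<psi>) = bar_sum \<mu>A w (\<lambda>v. h (\<psi> v))"
  using assms(3-)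
proof (induction w arbitrary: \<psi> rule: list.induct)
  case (Cons a w)
  have "h (bar_sum \<mu>A w (\<lambda>v. \<psi> (a # v))) = bar_sum \<mu>A w (\<lambda>v. h (\<psi> (a # v)))"
    by (rule Cons.IH) (use Cons.prems(1) in \<open>auto intro!: Cons.prems(2) bar_step_Cons\<close>)
  moreover have "h (cut_sum w (\<lambda>x z. \<psi> (bar_op \<mu>A (a # x) # z))) =
      cut_sum w (\<lambda>x z. h (\<psi> (bar_op \<mu>A (a # x) # z)))"
    by (rule cut_sum_linear_image[OF assms(1,2)]) (use Cons.prems in \<open>simp_all add: bar_step_bar_op\<close>)
  moreover have "bar_sum \<mu>A w (\<lambda>v. \<psi> (a # v)) \<in> X"
    by (rule bar_sum_mem[OF assms(2)]) (use Cons.prems(1) in \<open>auto intro!: Cons.prems(2) bar_step_Cons\<close>)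
  moreover have "cut_sum w (\<lambda>x z. \<psi> (bar_op \<mu>A (a # x) # z)) \<in> X"
    by (rule cut_sum_mem[OF assms(2)]) (use Cons.prems in \<open>simp_all add: bar_step_bar_op\<close>)
  ultimately show ?case
    by (simp add: linear_on_add[OF assms(1)] linear_on_signed[OF assms(1,2)]
        qsubmodule_signed[OF assms(2)])
qed (simp add: linear_on_0[OF assms(1,2)])

lemma linear_on_bar_sum:
  assumes "qsubmodule t Y" "w \<in> lists (homog A)"
    "\<And>v. bar_step A w v \<Longrightarrow> linear_on s X t Y (\<lambda>p. \<psi> p v)"
  shows "linear_on s X t Y (\<lambda>p. bar_sum \<mu>A w (\<psi> p))"
  using assms(2-)
proof (induction w arbitrary: \<psi> rule: list.induct)
  case (Cons a w)
  have "linear_on s X t Y (\<lambda>p. bar_sum \<mu>A w (\<lambda>v. \<psi> p (a # v)))"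
    by (rule Cons.IH) (use Cons.prems(1) in \<open>auto intro!: Cons.prems(2) bar_step_Cons\<close>)
  moreover have "linear_on s X t Y (\<lambda>p. cut_sum w (\<lambda>x z. \<psi> p (bar_op \<mu>A (a # x) # z)))"
    by (rule linear_on_cut_sum[OF assms(1)]) (use Cons.prems in \<open>simp_all add: bar_step_bar_op\<close>)
  ultimately show ?case
    by (simp add: linear_on_plus[OF assms(1)] linear_on_signed_map[OF assms(1)])
qed (simp add: linear_on_zero_map[OF assms(1)])

lemma word_multilinear_bar_op_slot:
  assumes \<psi>: "word_multilinear sA A sN N d \<psi>"
    and mem: "x \<in> lists (homog A)" "z \<in> lists (homog A)" "p \<in> lists (homog A)" "q \<in> lists (homog A)"
    and k: "k = shdeg x + shdeg z + (i + 1) + shdeg p + shdeg q + d - 1"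
  shows "linear_on sA (A i) sN (N k) (\<lambda>a. \<psi> (x @ bar_op \<mu>A (z @ (i, a) # p) # q))"
proof -
  let ?j = "shdeg z + (i + 1) + shdeg p - 2"
  have "linear_on sA (A ?j) sN (N k) (\<lambda>b. \<psi> (x @ (?j, b) # q))"
    by (rule word_multilinear_slot[OF \<psi>]) (use mem k in auto)
  moreover have "linear_on sA (A i) sA (A ?j) (\<lambda>a. snd (bar_op \<mu>A (z @ (i, a) # p)))"
    by (rule linear_bar_op) (use mem in auto)
  moreover have "bar_op \<mu>A (z @ (i, a) # p) = (?j, snd (bar_op \<mu>A (z @ (i, a) # p)))" for a
    by (rule prod_eqI) (simp_all add: fst_bar_op)
  ultimately show ?thesis using linear_on_comp by fastforce
qed

lemma word_multilinear_bar_sum: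
  assumes \<psi>: "word_multilinear sA A sN N d \<psi>" and N: "graded_module sN N"
  shows "word_multilinear sA A sN N (d - 1) (\<lambda>w. bar_sum \<mu>A w \<psi>)"
  unfolding word_multilinear_def
proof (intro ballI allI)
  fix us ws i assume us: "us \<in> lists (homog A)" and ws: "ws \<in> lists (homog A)"
  define k where "k = shdeg us + (i + 1) + shdeg ws + (d - 1)"
  note qN = graded_module_qsubmodule[OF N]
  have "linear_on sA (A i) sN (N k) (\<lambda>a. bar_sum \<mu>A us (\<lambda>x. \<psi> (x @ (i, a) # ws)))"
    by (rule linear_on_bar_sum[OF qN us], rule word_multilinear_slot[OF \<psi>])
      (use ws in \<open>auto simp: bar_step_def k_def\<close>)
  moreover have "linear_on sA (A i) sN (N k)
     (\<lambda>a. cut_sum us (\<lambda>x z. cut_sum ws (\<lambda>p q. signed (shdeg x) (\<psi> (x @ bar_op \<mu>A (z @ (i, a) # p) # q)))))"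
    by (rule linear_on_cut_sum[OF qN], rule linear_on_cut_sum[OF qN],
        rule linear_on_signed_map[OF qN], rule word_multilinear_bar_op_slot[OF \<psi>])
      (use us ws in \<open>auto simp: k_def\<close>)
  moreover have "linear_on sA (A i) sN (N k) (\<lambda>a. bar_sum \<mu>A ws (\<lambda>z. \<psi> (us @ (i, a) # z)))"
    by (rule linear_on_bar_sum[OF qN ws], rule word_multilinear_slot[OF \<psi>])
      (use us in \<open>auto simp: bar_step_def k_def\<close>)
  ultimately show "linear_on sA (A i) sN (N (shdeg us + (i + 1) + shdeg ws + (d - 1)))
      (\<lambda>a. bar_sum \<mu>A (us @ (i, a) # ws) \<psi>)"
    unfolding bar_sum_append_Cons k_def[symmetric]
    by (simp add: linear_on_plus[OF qN] linear_on_signed_map[OF qN])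
qed

text \<open>The defining relation of the algebra in suspended form, the case \<open>t = 0\<close> of
  the comparison above.\<close>

lemma bar_sum_bar_op:
  assumes as: "as \<in> lists (homog A)" shows "bar_sum \<mu>A as (\<lambda>v. snd (bar_op \<mu>A v)) = 0"
proof (cases as)
  case (Cons a as')
  have "signed (bar_exp 0 as) (bar_sum \<mu>A as (\<lambda>v. signed (bar_exp 0 v) (\<mu>A v))) =
    (\<Sum>(u, v, w) | u + v + w = length as \<and> v \<ge> 1.
         signed (int (u + v * (w + 0)) + (int v - 2) * deg (take u as))
           (\<mu>A (take u as @ app (int v - 2) \<mu>A (take v (drop u as)) # drop (u + v) as)))"
  proof (rule bar_sum_conv_relation[symmetric])
    fix x y z assume xyz: "as = x @ y @ z" "y \<noteq> []"
    have y: "(shdeg y - 2, signed (bar_exp 0 y) (\<mu>A y)) \<in> homog A"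
      using bar_op_homog[of y] as xyz by (simp add: bar_op_def shdeg_def)
    hence y: "\<mu>A y \<in> A (shdeg y - 2)"
      using qsubmodule_signed[OF qsubmodule_A, of "signed (bar_exp 0 y) (\<mu>A y)" _ "- bar_exp 0 y"]
      by (simp add: homog_def)
    have "\<forall>i. linear_on sA (A i) sA
      (A (deg x + i + deg z + (int (length x + 1 + length z) - 2))) (\<lambda>a. \<mu>A (x @ (i, a) # z))"
      using multilinear[of "length x + 1 + length z"] as xyz unfolding multilinear_def by simp
    from linear_on_minus[OF this[rule_format, of "shdeg y - 2"] qsubmodule_A y]
    show "\<mu>A (x @ (shdeg y - 2, - \<mu>A y) # z) = - \<mu>A (x @ (shdeg y - 2, \<mu>A y) # z)" .
  qed
  also have "\<dots> = 0" using relation[of "length as" as] as Cons by simp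
  finally show ?thesis by (simp add: bar_op_def)
qed simp

text \<open>Two successive contractions either both avoid the first letter (induction hypothesis),
  or are disjoint with exactly one of them involving it (cancellation in pairs), or the second one
  involves both the first letter and everything contracted before (the algebra relation on a
  prefix).\<close>

lemma bar_sum_square:
  assumes "word_multilinear sA A sN N d \<psi>" "w \<in> lists (homog A)"
  shows "bar_sum \<mu>A w (\<lambda>v. bar_sum \<mu>A v \<psi>) = 0"
  using assms
proof (induction w arbitrary: \<psi> d rule: list.induct)
  case (Cons a w)
  note \<psi> = Cons.prems(1)
  have a: "a \<in> homog A" and w: "w \<in> lists (homog A)" using Cons.prems(2) by auto
  let ?F = "\<lambda>x z. \<psi> (bar_op \<mu>A (a # x) # z)"
  let ?H = "\<lambda>x p q. \<psi> (bar_op \<mu>A (bar_op \<mu>A (a # x) # p) # q)"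
  have 1: "bar_sum \<mu>A w (\<lambda>v. bar_sum \<mu>A v (\<lambda>v. \<psi> (a # v))) = 0"
    by (rule Cons.IH[OF word_multilinear_Cons[OF \<psi> a] w])
  \<comment> \<open>Disjoint contractions in both orders: contracting the prefix first lowers its
    suspended degree by one, so the two signs are opposite.\<close>
  have 2: "signed (fst a + 1) (signed (shdeg x) (bar_sum \<mu>A z (?F x))) +
      signed (fst (bar_op \<mu>A (a # x)) + 1) (bar_sum \<mu>A z (?F x)) = 0" for x z
    by (simp add: fst_bar_op signed_opposite[of "fst a + 1 + shdeg x" "fst a + shdeg x"])
  \<comment> \<open>All contractions within the prefix \<open>a # x\<close>, followed by contraction
    of the whole prefix, sum to zero; linearity of \<open>\<psi>\<close> in its first letter carries
    this relation over.\<close>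
  have 3: "bar_sum \<mu>A (a # x) (\<lambda>v. \<psi> (bar_op \<mu>A v # z)) = 0" if "w = x @ z" for x z
  proof -
    have ax: "a # x \<in> lists (homog A)" and z: "z \<in> lists (homog A)" using a w that by auto
    define k where "k = shdeg (a # x) - 3"
    have h: "linear_on sA (A k) sN (N (k + 1 + shdeg z + d)) (\<lambda>b. \<psi> ([] @ (k, b) # z))"
      by (rule word_multilinear_slot[OF \<psi>]) (use z in auto)
    have eq: "bar_op \<mu>A v = (k, snd (bar_op \<mu>A v))" if "bar_step A (a # x) v" for v
      using that by (intro prod_eqI) (simp_all add: bar_step_def fst_bar_op k_def)
    have mem: "snd (bar_op \<mu>A v) \<in> A k" if "bar_step A (a # x) v" for v
      using bar_op_homog[of v] eq[OF that] that homogD[of "bar_op \<mu>A v" A]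
      by (metis bar_step_def fst_conv)
    have "bar_sum \<mu>A (a # x) (\<lambda>v. \<psi> (bar_op \<mu>A v # z)) =
        bar_sum \<mu>A (a # x) (\<lambda>v. \<psi> ((k, snd (bar_op \<mu>A v)) # z))"
      by (rule bar_sum_cong[OF ax]) (use eq in metis)
    also have "\<dots> = \<psi> ((k, bar_sum \<mu>A (a # x) (\<lambda>v. snd (bar_op \<mu>A v))) # z)"
      using bar_sum_linear_image[OF h qsubmodule_A ax, of "\<lambda>v. snd (bar_op \<mu>A v)"]
        mem by (simp only: append_Nil)
    also have "\<dots> = 0"
      using linear_on_0[OF h qsubmodule_A] by (simp only: bar_sum_bar_op[OF ax]) simp
    finally show ?thesis .
  qed
  have "bar_sum \<mu>A (a # w) (\<lambda>v. bar_sum \<mu>A v \<psi>) =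
      signed (fst a + 1) (cut_sum w (\<lambda>x z. bar_sum \<mu>A x (\<lambda>x'. ?F x' z) +
         signed (shdeg x) (bar_sum \<mu>A z (?F x)))) +
      cut_sum w (\<lambda>x z. signed (fst (bar_op \<mu>A (a # x)) + 1) (bar_sum \<mu>A z (?F x)) +
         cut_sum z (?H x))"
    using 1 by (simp add: bar_sum_add bar_sum_signed bar_sum_cut_sum)
  also have "\<dots> = cut_sum w (\<lambda>x z. signed (fst a + 1) (signed (shdeg x) (bar_sum \<mu>A z (?F x))) +
      signed (fst (bar_op \<mu>A (a # x)) + 1) (bar_sum \<mu>A z (?F x))) +
      (cut_sum w (\<lambda>x z. signed (fst a + 1) (bar_sum \<mu>A x (\<lambda>x'. ?F x' z))) +
       cut_sum w (\<lambda>x z. cut_sum x (\<lambda>x1 x2. ?H x1 x2 z)))"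
    by (simp add: cut_sum_add cut_sum_assoc cut_sum_signed[symmetric] algebra_simps)
  also have "\<dots> = cut_sum w (\<lambda>x z. bar_sum \<mu>A (a # x) (\<lambda>v. \<psi> (bar_op \<mu>A v # z)))"
    by (simp only: 2 cut_sum_zero add_0_left bar_sum.simps cut_sum_add)
  also have "\<dots> = 0" by (rule cut_sum_zero) (rule 3)
  finally show ?case .
qed simp

end

section \<open>Operations on modules and the Bianchi identity\<close>

text \<open>A family of multilinear maps in all arities at once. Because words are measured by
  \<open>shdeg\<close>, one degree \<open>d\<close> serves all arities.\<close>

definition cochain ::
  "('q::{comm_ring,comm_monoid_mult} \<Rightarrow> 'a::ab_group_add \<Rightarrow> 'a) \<Rightarrow> (int \<Rightarrow> 'a set) \<Rightarrow>
   ('q \<Rightarrow> 'c::ab_group_add \<Rightarrow> 'c) \<Rightarrow> (int \<Rightarrow> 'c set) \<Rightarrow>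
   ('q \<Rightarrow> 'n::ab_group_add \<Rightarrow> 'n) \<Rightarrow> (int \<Rightarrow> 'n set) \<Rightarrow> int \<Rightarrow>
   ((int \<times> 'a) list \<Rightarrow> int \<times> 'c \<Rightarrow> 'n) \<Rightarrow> bool" where
  "cochain sA A sC C sN N d \<phi> \<longleftrightarrow>
     (\<forall>y\<in>homog C. word_multilinear sA A sN (\<lambda>i. N (i + fst y)) d (\<lambda>w. \<phi> w y)) \<and>
     (\<forall>w\<in>lists (homog A). \<forall>j. linear_on sC (C j) sN (N (shdeg w + j + d)) (\<lambda>y. \<phi> w (j, y)))"

definition act :: "((int \<times> 'a) list \<Rightarrow> int \<times> 'c \<Rightarrow> 'c) \<Rightarrow> (int \<times> 'a) list \<Rightarrow> int \<times> 'c \<Rightarrow> int \<times> 'c" where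
  "act c z y = (shdeg z + fst y - 1, c z y)"

text \<open>\<open>\<phi>\<close> composed with the map that the operations \<open>c\<close> and the
  bar differential induce on the cofree comodule over the bar construction cogenerated by
  \<open>C\<close>. In particular \<open>cobar \<mu> c c\<close> is \<open>c\<close> composed with
  \<open>c\<close>, and its vanishing is the module relation.\<close>

definition cobar :: "((int \<times> 'a) list \<Rightarrow> 'a::ab_group_add) \<Rightarrow> ((int \<times> 'a) list \<Rightarrow> int \<times> 'c \<Rightarrow> 'c) \<Rightarrow>
    ((int \<times> 'a) list \<Rightarrow> int \<times> 'c \<Rightarrow> 'n::ab_group_add) \<Rightarrow> (int \<times> 'a) list \<Rightarrow> int \<times> 'c \<Rightarrow> 'n" where
  "cobar \<mu> c \<phi> w y = bar_sum \<mu> w (\<lambda>v. \<phi> v y) +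
     cut_sum w (\<lambda>x z. signed (shdeg x) (\<phi> x (act c z y)))"

lemma cochain_words:
  "cochain sA A sC C sN N d \<phi> \<Longrightarrow> y \<in> homog C \<Longrightarrow>
   word_multilinear sA A sN (\<lambda>i. N (i + fst y)) d (\<lambda>w. \<phi> w y)"
  by (simp add: cochain_def)

lemma cochain_slot:
  assumes "cochain sA A sC C sN N d \<phi>" "y \<in> homog C" "us \<in> lists (homog A)" "ws \<in> lists (homog A)"
    "k = shdeg us + (i + 1) + shdeg ws + fst y + d"
  shows "linear_on sA (A i) sN (N k) (\<lambda>a. \<phi> (us @ (i, a) # ws) y)"
  using word_multilinear_slot[OF cochain_words[OF assms(1,2)] assms(3,4) refl, of i] assms(5)
  by (simp add: algebra_simps)

lemma cochain_linear:
  "cochain sA A sC C sN N d \<phi> \<Longrightarrow> w \<in> lists (homog A) \<Longrightarrow> k = shdeg w + j + d \<Longrightarrow>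
   linear_on sC (C j) sN (N k) (\<lambda>y. \<phi> w (j, y))"
  by (simp add: cochain_def)

lemma cochain_mem:
  assumes "cochain sA A sC C sN N d \<phi>" "w \<in> lists (homog A)" "y \<in> homog C" "k = shdeg w + fst y + d"
  shows "\<phi> w y \<in> N k"
  using linear_on_mem[OF cochain_linear[OF assms(1,2,4)] homogD[OF assms(3)]] by simp

lemma act_homog:
  assumes "cochain sA A sC C sC C (- 1) c" "w \<in> lists (homog A)" "y \<in> homog C"
  shows "act c w y \<in> homog C"
  unfolding act_def by (rule homogI, rule cochain_mem[OF assms]) simp

context ainf_algebra
begin

lemma cochain_cobar:
  assumes c: "cochain sA A sC C sC C (- 1) c" and \<phi>: "cochain sA A sC C sN N d \<phi>"
    and N: "graded_module sN N"
  shows "cochain sA A sC C sN N (d - 1) (cobar \<mu>A c \<phi>)"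
  unfolding cochain_def
proof (intro conjI ballI allI)
  note qN = graded_module_qsubmodule[OF N]
  fix y assume y: "y \<in> homog C"
  have N': "graded_module sN (\<lambda>i. N (i + fst y))" using N by (simp add: graded_module_def)
  show "word_multilinear sA A sN (\<lambda>i. N (i + fst y)) (d - 1) (\<lambda>w. cobar \<mu>A c \<phi> w y)"
    unfolding word_multilinear_def
  proof (intro ballI allI)
    fix us ws i assume us: "us \<in> lists (homog A)" and ws: "ws \<in> lists (homog A)"
    define k where "k = shdeg us + (i + 1) + shdeg ws + (d - 1) + fst y"
    have 1: "linear_on sA (A i) sN (N k) (\<lambda>a. bar_sum \<mu>A (us @ (i, a) # ws) (\<lambda>v. \<phi> v y))"
      by (rule word_multilinear_slot[OF word_multilinear_bar_sum[OF cochain_words[OF \<phi> y] N'] us ws,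
            OF refl, of i, folded k_def])
    have 2: "linear_on sA (A i) sN (N k) (\<lambda>a. \<phi> x (act c (z @ (i, a) # ws) y))"
      if "us = x @ z" for x z
    proof -
      define j where "j = shdeg z + (i + 1) + shdeg ws + fst y - 1"
      have "linear_on sC (C j) sN (N k) (\<lambda>y. \<phi> x (j, y))"
        by (rule cochain_linear[OF \<phi>]) (use us that in \<open>auto simp: k_def j_def\<close>)
      moreover have "linear_on sA (A i) sC (C j) (\<lambda>a. c (z @ (i, a) # ws) y)"
        by (rule cochain_slot[OF c y]) (use us ws that in \<open>auto simp: j_def\<close>)
      ultimately have "linear_on sA (A i) sN (N k) (\<lambda>a. \<phi> x (j, c (z @ (i, a) # ws) y))"
        by (rule linear_on_comp[rotated])
      thus ?thesis by (simp add: act_def j_def algebra_simps)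
    qed
    have 3: "linear_on sA (A i) sN (N k) (\<lambda>a. \<phi> (us @ (i, a) # x) (act c z y))"
      if "ws = x @ z" for x z
    proof (rule cochain_slot[OF \<phi>])
      show "act c z y \<in> homog C" by (rule act_homog[OF c _ y]) (use ws that in auto)
    qed (use us ws that in \<open>auto simp: k_def act_def\<close>)
    have sx: "shdeg (us @ (i, a) # x) = shdeg us + (i + 1) + shdeg x" for a :: 'a and x
      by simp
    show "linear_on sA (A i) sN (N (shdeg us + (i + 1) + shdeg ws + (d - 1) + fst y))
        (\<lambda>a. cobar \<mu>A c \<phi> (us @ (i, a) # ws) y)"
      unfolding k_def[symmetric] cobar_def cut_sum_append_Cons sx
      by (intro linear_on_plus[OF qN] linear_on_cut_sum[OF qN] linear_on_signed_map[OF qN] 1 2 3)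
  qed
next
  note qN = graded_module_qsubmodule[OF N]
  fix w j assume w: "w \<in> lists (homog A)"
  define k where "k = shdeg w + j + (d - 1)"
  have 1: "linear_on sC (C j) sN (N k) (\<lambda>y. \<phi> v (j, y))" if "bar_step A w v" for v
    by (rule cochain_linear[OF \<phi>]) (use that in \<open>auto simp: k_def bar_step_def\<close>)
  have 2: "linear_on sC (C j) sN (N k) (\<lambda>y. \<phi> x (act c z (j, y)))" if "w = x @ z" for x z
  proof -
    define l where "l = shdeg z + j - 1"
    have "linear_on sC (C l) sN (N k) (\<lambda>y. \<phi> x (l, y))"
      by (rule cochain_linear[OF \<phi>]) (use w that in \<open>auto simp: k_def l_def\<close>)
    moreover have "linear_on sC (C j) sC (C l) (\<lambda>y. c z (j, y))"
      by (rule cochain_linear[OF c]) (use w that in \<open>auto simp: l_def\<close>)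
    ultimately have "linear_on sC (C j) sN (N k) (\<lambda>y. \<phi> x (l, c z (j, y)))"
      by (rule linear_on_comp[rotated])
    thus ?thesis by (simp add: act_def l_def)
  qed
  show "linear_on sC (C j) sN (N (shdeg w + j + (d - 1))) (\<lambda>y. cobar \<mu>A c \<phi> w (j, y))"
    unfolding k_def[symmetric] cobar_def
    by (intro linear_on_plus[OF qN] linear_on_cut_sum[OF qN] linear_on_signed_map[OF qN]
        linear_on_bar_sum[OF qN w] 1 2)
qed

text \<open>The induced map on the comodule has odd degree, so its square is again determined by its
  component in \<open>C\<close>, which is \<open>cobar \<mu>A c c\<close>. With
  \<open>\<phi> = c\<close> this is the Bianchi identity. On the level of sums: the bar differential
  squares to zero, contractions to the left of an action cancel, and the other terms assemble to the
  right-hand side.\<close>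

lemma cobar_square:
  fixes \<phi> :: "(int \<times> 'a) list \<Rightarrow> int \<times> 'c::ab_group_add \<Rightarrow> 'n::ab_group_add"
  assumes c: "cochain sA A sC C sC C (- 1) c" and \<phi>: "cochain sA A sC C sN N d \<phi>"
    and C: "graded_module sC C"
    and w: "w \<in> lists (homog A)" and y: "y \<in> homog C"
  shows "cobar \<mu>A c (cobar \<mu>A c \<phi>) w y =
     cut_sum w (\<lambda>x z. \<phi> x (shdeg z + fst y - 2, cobar \<mu>A c c z y))"
proof -
  note qC = graded_module_qsubmodule[OF C]
  let ?e = "\<lambda>x. signed (shdeg x)"
  \<comment> \<open>Linearity of \<open>\<phi> x\<close> in its last argument expands the right-hand
    side into the same kind of sums as the left-hand side.\<close>
  have pull: "\<phi> x (shdeg z + fst y - 2, cobar \<mu>A c c z y) =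
      bar_sum \<mu>A z (\<lambda>v. \<phi> x (act c v y)) +
      cut_sum z (\<lambda>p q. ?e p (\<phi> x (act c p (act c q y))))"
    if xz: "w = x @ z" for x z
  proof -
    have x: "x \<in> lists (homog A)" and z: "z \<in> lists (homog A)" using xz w by auto
    define k where "k = shdeg z + fst y - 2"
    have h: "linear_on sC (C k) sN (N (shdeg x + k + d)) (\<lambda>y. \<phi> x (k, y))"
      by (rule cochain_linear[OF \<phi> x refl])
    have m1: "c v y \<in> C k" if "bar_step A z v" for v
      by (rule cochain_mem[OF c _ y]) (use that in \<open>auto simp: k_def bar_step_def\<close>)
    have m2: "c p (act c q y) \<in> C k" if "z = p @ q" for p q
    proof (rule cochain_mem[OF c])
      show "act c q y \<in> homog C" by (rule act_homog[OF c _ y]) (use z that in auto)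
    qed (use z that in \<open>auto simp: k_def act_def\<close>)
    have "\<phi> x (k, cobar \<mu>A c c z y) = \<phi> x (k, bar_sum \<mu>A z (\<lambda>v. c v y)) +
        \<phi> x (k, cut_sum z (\<lambda>p q. ?e p (c p (act c q y))))"
      unfolding cobar_def
      by (rule linear_on_add[OF h])
        (intro bar_sum_mem[OF qC z] cut_sum_mem[OF qC] qsubmodule_signed[OF qC] m1 m2; assumption)+
    also have "\<phi> x (k, bar_sum \<mu>A z (\<lambda>v. c v y)) = bar_sum \<mu>A z (\<lambda>v. \<phi> x (k, c v y))"
      by (rule bar_sum_linear_image[OF h qC z m1])
    also have "\<dots> = bar_sum \<mu>A z (\<lambda>v. \<phi> x (act c v y))"
      by (rule bar_sum_cong[OF z]) (simp add: act_def bar_step_def k_def)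
    also have "\<phi> x (k, cut_sum z (\<lambda>p q. ?e p (c p (act c q y)))) =
        cut_sum z (\<lambda>p q. \<phi> x (k, ?e p (c p (act c q y))))"
      by (rule cut_sum_linear_image[OF h qC]) (intro qsubmodule_signed[OF qC] m2)
    also have "\<dots> = cut_sum z (\<lambda>p q. ?e p (\<phi> x (act c p (act c q y))))"
    proof (rule cut_sum_cong)
      fix p q assume pq: "z = p @ q"
      have "\<phi> x (k, ?e p (c p (act c q y))) = ?e p (\<phi> x (k, c p (act c q y)))"
        by (rule linear_on_signed[OF h qC m2[OF pq]])
      also have "(k, c p (act c q y)) = act c p (act c q y)"
        by (simp add: act_def pq k_def)
      finally show "\<phi> x (k, ?e p (c p (act c q y))) = ?e p (\<phi> x (act c p (act c q y)))" .
    qed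
    finally show ?thesis by (simp add: k_def)
  qed
  have 1: "bar_sum \<mu>A w (\<lambda>v. bar_sum \<mu>A v (\<lambda>v. \<phi> v y)) = 0"
    by (rule bar_sum_square[OF cochain_words[OF \<phi> y] w])
  \<comment> \<open>A contraction inside \<open>x\<close> changes the parity of
    \<open>shdeg x\<close>; this is the sign by which the two orders of contracting and acting
    cancel.\<close>
  have flip: "bar_sum \<mu>A x (\<lambda>x'. ?e x' (f x')) = - ?e x (bar_sum \<mu>A x f)"
    if "x \<in> lists (homog A)" for x and f :: "(int \<times> 'a) list \<Rightarrow> 'n"
  proof -
    have "bar_sum \<mu>A x (\<lambda>x'. ?e x' (f x')) = bar_sum \<mu>A x (\<lambda>x'. signed (shdeg x - 1) (f x'))"
      by (rule bar_sum_cong[OF that]) (simp add: bar_step_def)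
    thus ?thesis by (simp add: bar_sum_signed bar_sum_minus signed_opposite[of "shdeg x - 1" "shdeg x"])
  qed
  have "cobar \<mu>A c (cobar \<mu>A c \<phi>) w y =
     bar_sum \<mu>A w (\<lambda>v. cut_sum v (\<lambda>x z. ?e x (\<phi> x (act c z y)))) +
     cut_sum w (\<lambda>x z. ?e x (bar_sum \<mu>A x (\<lambda>v. \<phi> v (act c z y))) +
       cut_sum x (\<lambda>x1 x2. ?e x (?e x1 (\<phi> x1 (act c x2 (act c z y))))))"
    unfolding cobar_def
    by (simp add: bar_sum_add 1 cut_sum_signed[symmetric] del: signed_signed)
  also have "\<dots> = cut_sum w (\<lambda>x z. bar_sum \<mu>A x (\<lambda>x'. ?e x' (\<phi> x' (act c z y))) +
       ?e x (bar_sum \<mu>A z (\<lambda>v. ?e x (\<phi> x (act c v y)))) +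
       ?e x (bar_sum \<mu>A x (\<lambda>v. \<phi> v (act c z y)))) +
     cut_sum w (\<lambda>x z. cut_sum x (\<lambda>x1 x2. ?e x (?e x1 (\<phi> x1 (act c x2 (act c z y))))))"
    by (simp add: bar_sum_cut_sum cut_sum_add algebra_simps del: signed_signed)
  \<comment> \<open>For \<open>x = x1 @ x2\<close> the exponents \<open>shdeg x + shdeg x1\<close>
    and \<open>shdeg x2\<close> have the same parity.\<close>
  also have "cut_sum w (\<lambda>x z. cut_sum x (\<lambda>x1 x2. ?e x (?e x1 (\<phi> x1 (act c x2 (act c z y)))))) =
     cut_sum w (\<lambda>x z. cut_sum x (\<lambda>x1 x2. ?e x2 (\<phi> x1 (act c x2 (act c z y)))))"
    by (intro cut_sum_cong) (simp, rule signed_cong, simp)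
  also have "\<dots> = cut_sum w (\<lambda>x z. cut_sum z (\<lambda>p q. ?e p (\<phi> x (act c p (act c q y)))))"
    by (rule cut_sum_assoc)
  also have "cut_sum w (\<lambda>x z. bar_sum \<mu>A x (\<lambda>x'. ?e x' (\<phi> x' (act c z y))) +
       ?e x (bar_sum \<mu>A z (\<lambda>v. ?e x (\<phi> x (act c v y)))) +
       ?e x (bar_sum \<mu>A x (\<lambda>v. \<phi> v (act c z y)))) =
     cut_sum w (\<lambda>x z. bar_sum \<mu>A z (\<lambda>v. \<phi> x (act c v y)))"
    by (rule cut_sum_cong)
      (use w in \<open>auto simp: flip bar_sum_signed signed_cong[of "shdeg _ + shdeg _" 0]\<close>)
  also have "\<dots> + cut_sum w (\<lambda>x z. cut_sum z (\<lambda>p q. ?e p (\<phi> x (act c p (act c q y))))) =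
     cut_sum w (\<lambda>x z. \<phi> x (shdeg z + fst y - 2, cobar \<mu>A c c z y))"
    unfolding cut_sum_add[symmetric] by (rule cut_sum_cong) (simp only: pull)
  finally show ?thesis .
qed

end

section \<open>Lifting multilinear maps on projective modules\<close>

text \<open>The data of the dual basis lemma: linear coordinates, finitely many nonzero at each
  element, and generators from which the element is recovered. The generators may satisfy
  relations.\<close>

definition dual_basis ::
  "('q::{comm_ring,comm_monoid_mult} \<Rightarrow> 'm::ab_group_add \<Rightarrow> 'm) \<Rightarrow> 'm set \<Rightarrow>
   ('m \<Rightarrow> 'i \<Rightarrow> 'q) \<Rightarrow> ('i \<Rightarrow> 'm) \<Rightarrow> bool" where
  "dual_basis s P \<sigma> e \<longleftrightarrow>
     (\<forall>x\<in>P. finite {i. \<sigma> x i \<noteq> 0}) \<and>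
     (\<forall>x\<in>P. \<forall>y\<in>P. \<forall>i. \<sigma> (x + y) i = \<sigma> x i + \<sigma> y i) \<and>
     (\<forall>q. \<forall>x\<in>P. \<forall>i. \<sigma> (s q x) i = q * \<sigma> x i) \<and>
     (\<forall>i. e i \<in> P) \<and>
     (\<forall>x\<in>P. (\<Sum>i | \<sigma> x i \<noteq> 0. s (\<sigma> x i) (e i)) = x)"

lemma qsubmodule_free_module:
  "qsubmodule free_scale (free_module (I :: 'i set) :: ('i \<Rightarrow> 'q::{comm_ring,comm_monoid_mult}) set)"
  unfolding qsubmodule_def
proof
  show "qmodule (free_scale :: 'q \<Rightarrow> ('i \<Rightarrow> 'q) \<Rightarrow> _)"
    by standard (auto simp: free_scale_def fun_eq_iff algebra_simps)
  show "submodule free_scale (free_module I :: ('i \<Rightarrow> 'q) set)"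
    unfolding submodule_def
  proof (intro conjI ballI allI)
    show "(0 :: 'i \<Rightarrow> 'q) \<in> free_module I" by (simp add: free_module_def)
  next
    fix x y :: "'i \<Rightarrow> 'q" assume xy: "x \<in> free_module I" "y \<in> free_module I"
    have "{i. (x + y) i \<noteq> 0} \<subseteq> {i. x i \<noteq> 0} \<union> {i. y i \<noteq> 0}" by auto
    moreover have "finite ({i. x i \<noteq> 0} \<union> {i. y i \<noteq> 0})" "{i. x i \<noteq> 0} \<union> {i. y i \<noteq> 0} \<subseteq> I"
      using xy by (simp_all add: free_module_def)
    ultimately show "x + y \<in> free_module I"
      unfolding free_module_def mem_Collect_eq by (meson finite_subset order_trans)
  next
    fix q and x :: "'i \<Rightarrow> 'q" assume x: "x \<in> free_module I"
    have "{i. free_scale q x i \<noteq> 0} \<subseteq> {i. x i \<noteq> 0}" by (auto simp: free_scale_def)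
    moreover have "finite {i. x i \<noteq> 0}" "{i. x i \<noteq> 0} \<subseteq> I"
      using x by (simp_all add: free_module_def)
    ultimately show "free_scale q x \<in> free_module I"
      unfolding free_module_def mem_Collect_eq by (meson finite_subset order_trans)
  qed
qed

lemma projective_dual_basis:
  assumes "projective s P" "qsubmodule s P"
  shows "\<exists>\<sigma> (e :: 'm \<Rightarrow> 'm::ab_group_add). dual_basis s P \<sigma> e"
proof -
  from assms(1) obtain I :: "'m set" and \<sigma> \<pi> where
    \<sigma>: "linear_on s P free_scale (free_module I) \<sigma>" and
    \<pi>: "linear_on free_scale (free_module I) s P \<pi>" and
    \<pi>\<sigma>: "\<And>x. x \<in> P \<Longrightarrow> \<pi> (\<sigma> x) = x"
    unfolding projective_def by blast
  define \<delta> :: "'m \<Rightarrow> 'm \<Rightarrow> 'a" where "\<delta> i = (\<lambda>j. if j = i then 1 else 0)" for i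
  \<comment> \<open>Indices outside \<open>I\<close> get the value \<open>0\<close>, so that
    \<open>e\<close> takes values in \<open>P\<close> without restriction on the index.\<close>
  define e where "e i = (if i \<in> I then \<pi> (\<delta> i) else 0)" for i
  have \<delta>: "\<delta> i \<in> free_module I" if "i \<in> I" for i
    unfolding free_module_def \<delta>_def
    using that by (auto intro: finite_subset[of _ "{i}"])
  have "(\<Sum>i | \<sigma> x i \<noteq> 0. s (\<sigma> x i) (e i)) = x" if x: "x \<in> P" for x
  proof -
    have mem: "\<sigma> x \<in> free_module I" by (rule linear_on_mem[OF \<sigma> x])
    let ?S = "{i. \<sigma> x i \<noteq> 0}"
    have S: "finite ?S" "?S \<subseteq> I" using mem by (simp_all add: free_module_def)
    have sum: "(\<Sum>i\<in>T. free_scale (\<sigma> x i) (\<delta> i)) j = (\<Sum>i\<in>T. free_scale (\<sigma> x i) (\<delta> i) j)"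
      if "finite T" for T j
      using that by induction simp_all
    have exp: "(\<Sum>i\<in>?S. free_scale (\<sigma> x i) (\<delta> i)) = \<sigma> x"
    proof
      fix j
      have "(\<Sum>i\<in>?S. free_scale (\<sigma> x i) (\<delta> i) j) = (\<Sum>i\<in>?S. if j = i then \<sigma> x j else 0)"
        by (rule sum.cong) (auto simp: free_scale_def \<delta>_def)
      thus "(\<Sum>i\<in>?S. free_scale (\<sigma> x i) (\<delta> i)) j = \<sigma> x j"
        using S(1) by (simp add: sum)
    qed
    have "x = \<pi> (\<Sum>i\<in>?S. free_scale (\<sigma> x i) (\<delta> i))" by (simp add: exp \<pi>\<sigma>[OF x])
    also have "\<dots> = (\<Sum>i\<in>?S. \<pi> (free_scale (\<sigma> x i) (\<delta> i)))"
      by (rule linear_on_sum[OF \<pi> qsubmodule_free_module])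
        (use S \<delta> in \<open>auto intro: qsubmodule_scale[OF qsubmodule_free_module]\<close>)
    also have "\<dots> = (\<Sum>i\<in>?S. s (\<sigma> x i) (e i))"
      by (rule sum.cong) (use S(2) \<delta> in \<open>auto simp: e_def linear_on_scale[OF \<pi>]\<close>)
    finally show ?thesis by simp
  qed
  moreover have "e i \<in> P" for i
    by (simp add: e_def linear_on_mem[OF \<pi> \<delta>] qsubmodule_zero[OF assms(2)])
  moreover have "finite {i. \<sigma> x i \<noteq> 0}" if "x \<in> P" for x
    using linear_on_mem[OF \<sigma> that] by (simp add: free_module_def)
  ultimately have "dual_basis s P \<sigma> e"
    unfolding dual_basis_def
    by (simp add: linear_on_add[OF \<sigma>] linear_on_scale[OF \<sigma>] free_scale_def)
  thus ?thesis by blast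
qed

text \<open>Any values \<open>f\<close> may be prescribed: the result is linear because the
  coordinates are, although the generators need not be independent and \<open>f\<close> need not be
  attained at them.\<close>

definition linear_extension ::
  "('q::{comm_ring,comm_monoid_mult} \<Rightarrow> 'n::ab_group_add \<Rightarrow> 'n) \<Rightarrow> ('m \<Rightarrow> 'i \<Rightarrow> 'q) \<Rightarrow>
   ('i \<Rightarrow> 'n) \<Rightarrow> 'm \<Rightarrow> 'n" where
  "linear_extension t \<sigma> f x = (\<Sum>i | \<sigma> x i \<noteq> 0. t (\<sigma> x i) (f i))"

lemma linear_on_linear_extension:
  assumes \<sigma>: "dual_basis s P \<sigma> e" and Y: "qsubmodule t Y" and f: "\<And>i. f i \<in> Y"
  shows "linear_on s P t Y (linear_extension t \<sigma> f)"
proof -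
  interpret qmodule t using Y by (simp add: qsubmodule_def)
  have fin: "finite {i. \<sigma> x i \<noteq> 0}" if "x \<in> P" for x
    using \<sigma> that unfolding dual_basis_def by blast
  have ext: "linear_extension t \<sigma> f x = (\<Sum>i\<in>T. t (\<sigma> x i) (f i))"
    if "finite T" "{i. \<sigma> x i \<noteq> 0} \<subseteq> T" for x T
    unfolding linear_extension_def
    by (rule sum.mono_neutral_left) (use that in \<open>auto simp: scale_zero_left\<close>)
  show ?thesis unfolding linear_on_def
  proof (intro conjI ballI allI)
    fix x assume "x \<in> P"
    show "linear_extension t \<sigma> f x \<in> Y" unfolding linear_extension_def
      by (rule qsubmodule_sum[OF Y]) (rule qsubmodule_scale[OF Y f])
  next
    fix x y assume xy: "x \<in> P" "y \<in> P"
    let ?T = "{i. \<sigma> x i \<noteq> 0} \<union> {i. \<sigma> y i \<noteq> 0}"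
    have T: "finite ?T" using fin xy by simp
    have sum_eq: "\<sigma> (x + y) i = \<sigma> x i + \<sigma> y i" for i using \<sigma> xy unfolding dual_basis_def by blast
    show "linear_extension t \<sigma> f (x + y) = linear_extension t \<sigma> f x + linear_extension t \<sigma> f y"
    proof -
      have "{i. \<sigma> (x + y) i \<noteq> 0} \<subseteq> ?T" by (auto simp: sum_eq)
      from ext[OF T this] ext[OF T, of x] ext[OF T, of y] show ?thesis
        by (simp add: sum_eq scale_left_distrib sum.distrib)
    qed
  next
    fix q x assume x: "x \<in> P"
    have sc: "\<sigma> (s q x) i = q * \<sigma> x i" for i using \<sigma> x unfolding dual_basis_def by blast
    have "linear_extension t \<sigma> f (s q x) = (\<Sum>i | \<sigma> x i \<noteq> 0. t (\<sigma> (s q x) i) (f i))"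
      by (rule ext[OF fin[OF x]]) (auto simp: sc)
    also have "\<dots> = (\<Sum>i | \<sigma> x i \<noteq> 0. t q (t (\<sigma> x i) (f i)))" by (simp add: sc scale_scale)
    also have "\<dots> = t q (linear_extension t \<sigma> f x)"
    proof -
      have "linear_on t UNIV t UNIV (t q)"
        by (auto simp: linear_on_def scale_right_distrib scale_scale mult.commute)
      moreover have "qsubmodule t UNIV" using Y by (simp add: qsubmodule_def submodule_def)
      ultimately show ?thesis by (simp add: linear_extension_def linear_on_sum)
    qed
    finally show "linear_extension t \<sigma> f (s q x) = t q (linear_extension t \<sigma> f x)" .
  qed
qed

lemma linear_image_linear_extension:
  assumes "linear_on t Y r Z h" "qsubmodule t Y" "\<And>i. f i \<in> Y"
  shows "h (linear_extension t \<sigma> f x) = linear_extension r \<sigma> (\<lambda>i. h (f i)) x"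
  unfolding linear_extension_def
  by (subst linear_on_sum[OF assms(1,2)])
    (auto intro: qsubmodule_scale[OF assms(2,3)] simp: linear_on_scale[OF assms(1,3)])

lemma linear_extension_basis:
  assumes "dual_basis s P \<sigma> e" "linear_on s P t Y f" "qsubmodule s P" "x \<in> P"
  shows "linear_extension t \<sigma> (\<lambda>i. f (e i)) x = f x"
proof -
  have e: "e i \<in> P" for i using assms(1) unfolding dual_basis_def by blast
  have "f x = f (linear_extension s \<sigma> e x)"
    using assms(1,4) unfolding dual_basis_def linear_extension_def by metis
  also have "\<dots> = linear_extension t \<sigma> (\<lambda>i. f (e i)) x"
    by (rule linear_image_linear_extension[OF assms(2,3) e])
  finally show ?thesis by simp
qed

lemma cochain_Cons:
  assumes "cochain sA A sC C sN N d \<phi>" "a \<in> homog A"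
  shows "cochain sA A sC C sN N (fst a + 1 + d) (\<lambda>w. \<phi> (a # w))"
  unfolding cochain_def
proof (intro conjI ballI allI)
  fix y assume "y \<in> homog C"
  thus "word_multilinear sA A sN (\<lambda>i. N (i + fst y)) (fst a + 1 + d) (\<lambda>w. \<phi> (a # w) y)"
    by (rule word_multilinear_Cons[OF cochain_words[OF assms(1)] assms(2)])
next
  fix w j assume "w \<in> lists (homog A)"
  thus "linear_on sC (C j) sN (N (shdeg w + j + (fst a + 1 + d))) (\<lambda>y. \<phi> (a # w) (j, y))"
    using assms(2) by (intro cochain_linear[OF assms(1)]) auto
qed

text \<open>The substitute for projectivity of a tensor product of projectives. By induction on the
  arity, the first letter is restricted to generators, the remaining multilinear map is lifted, and
  the lifts are recombined by the coordinates of the first letter. Concentrating \<open>F\<close> in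
  arity \<open>n\<close> allows a single cochain to be lifted in this way.\<close>

lemma cochain_lift:
  fixes sA :: "'q::{comm_ring,comm_monoid_mult} \<Rightarrow> 'a::ab_group_add \<Rightarrow> 'a"
    and sG :: "'q \<Rightarrow> 'g::ab_group_add \<Rightarrow> 'g"
    and sN :: "'q \<Rightarrow> 'n::ab_group_add \<Rightarrow> 'n"
    and sZ :: "'q \<Rightarrow> 'z::ab_group_add \<Rightarrow> 'z"
  assumes A: "graded_module sA A" "\<And>i. projective sA (A i)"
    and G: "graded_module sG G" "\<And>i. projective sG (G i)"
    and N: "graded_module sN N"
    and D: "\<And>k. linear_on sN (N k) sZ (Z k) (D k)" "\<And>k z. z \<in> Z k \<Longrightarrow> \<exists>x\<in>N k. D k x = z"
    and F: "cochain sA A sG G sZ Z d F" "\<And>w y. length w \<noteq> n \<Longrightarrow> F w y = 0"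
  shows "\<exists>\<kappa>. cochain sA A sG G sN N d \<kappa> \<and> (\<forall>w y. length w \<noteq> n \<longrightarrow> \<kappa> w y = 0) \<and>
     (\<forall>w\<in>lists (homog A). \<forall>y\<in>homog G. D (shdeg w + fst y + d) (\<kappa> w y) = F w y)"
  using F
proof (induction n arbitrary: d F)
  case 0
  have "\<exists>\<sigma> (e :: 'g \<Rightarrow> 'g). dual_basis sG (G j) \<sigma> e" for j
    by (rule projective_dual_basis[OF G(2) graded_module_qsubmodule[OF G(1)]])
  then obtain \<sigma> and e :: "int \<Rightarrow> 'g \<Rightarrow> 'g" where \<sigma>: "\<And>j. dual_basis sG (G j) (\<sigma> j) (e j)" by metis
  have e: "e j b \<in> G j" for j b using \<sigma>[of j] unfolding dual_basis_def by blast
  note qN = graded_module_qsubmodule[OF N]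
  note F = "0.prems"(1)
  have F0: "linear_on sG (G j) sZ (Z (j + d)) (\<lambda>y. F [] (j, y))" for j
    by (rule cochain_linear[OF F]) auto
  \<comment> \<open>Preimages are chosen for generators only; the coordinates turn these arbitrary
    choices into a linear map.\<close>
  have "\<exists>x\<in>N (j + d). D (j + d) x = F [] (j, e j b)" for j b
    by (rule D(2)) (rule linear_on_mem[OF F0 e])
  then obtain X where X: "\<And>j b. X j b \<in> N (j + d)" "\<And>j b. D (j + d) (X j b) = F [] (j, e j b)"
    by metis
  define \<kappa> where "\<kappa> w y = (if w = [] then linear_extension sN (\<sigma> (fst y)) (X (fst y)) (snd y) else 0)"
    for w :: "(int \<times> 'a) list" and y
  have "cochain sA A sG G sN N d \<kappa>"
    unfolding cochain_def word_multilinear_def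
  proof (intro conjI ballI allI)
    fix w j assume "w \<in> lists (homog A)"
    show "linear_on sG (G j) sN (N (shdeg w + j + d)) (\<lambda>y. \<kappa> w (j, y))"
      by (cases "w = []")
        (simp_all add: \<kappa>_def linear_on_zero_map[OF qN] linear_on_linear_extension[OF \<sigma> qN X(1)])
  qed (simp add: \<kappa>_def linear_on_zero_map[OF qN])
  moreover have "D (shdeg w + fst y + d) (\<kappa> w y) = F w y"
    if "w \<in> lists (homog A)" "y \<in> homog G" for w y
  proof (cases w)
    case Nil
    have "D (fst y + d) (\<kappa> [] y) = linear_extension sZ (\<sigma> (fst y)) (\<lambda>b. F [] (fst y, e (fst y) b)) (snd y)"
      unfolding \<kappa>_def by (simp add: linear_image_linear_extension[OF D(1) qN X(1)] X(2))
    also have "\<dots> = F [] (fst y, snd y)"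
      by (rule linear_extension_basis[OF \<sigma> F0 graded_module_qsubmodule[OF G(1)] homogD[OF that(2)]])
    finally show ?thesis by (simp add: Nil)
  next
    case (Cons a v)
    hence "D (shdeg w + fst y + d) (\<kappa> w y) = 0"
      using linear_on_0[OF D(1) qN] by (simp add: \<kappa>_def)
    thus ?thesis using "0.prems"(2)[of w y] Cons by simp
  qed
  moreover have "\<kappa> w y = 0" if "length w \<noteq> 0" for w y
    using that by (simp add: \<kappa>_def)
  ultimately show ?case by blast
next
  case (Suc n)
  have "\<exists>\<sigma> (e :: 'a \<Rightarrow> 'a). dual_basis sA (A i) \<sigma> e" for i
    by (rule projective_dual_basis[OF A(2) graded_module_qsubmodule[OF A(1)]])
  then obtain \<sigma> and e :: "int \<Rightarrow> 'a \<Rightarrow> 'a" where \<sigma>: "\<And>i. dual_basis sA (A i) (\<sigma> i) (e i)" by metis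
  have e: "e i b \<in> A i" for i b using \<sigma>[of i] unfolding dual_basis_def by blast
  note qN = graded_module_qsubmodule[OF N]
  note F = Suc.prems(1)
  define lifts where "lifts i b \<kappa> \<longleftrightarrow> cochain sA A sG G sN N (i + 1 + d) \<kappa> \<and>
     (\<forall>w y. length w \<noteq> n \<longrightarrow> \<kappa> w y = 0) \<and>
     (\<forall>w\<in>lists (homog A). \<forall>y\<in>homog G.
        D (shdeg w + fst y + (i + 1 + d)) (\<kappa> w y) = F ((i, e i b) # w) y)" for i b \<kappa>
  have "\<exists>\<kappa>. lifts i b \<kappa>" for i b
    unfolding lifts_def
  proof (rule Suc.IH)
    show "cochain sA A sG G sZ Z (i + 1 + d) (\<lambda>w. F ((i, e i b) # w))"
      using cochain_Cons[OF F homogI[of "e i b" A i]] e by simp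
    show "F ((i, e i b) # w) y = 0" if "length w \<noteq> n" for w y
      by (rule Suc.prems(2)) (use that in simp)
  qed
  then obtain K where K0: "\<And>i b. lifts i b (K i b)" by metis
  have K: "cochain sA A sG G sN N (i + 1 + d) (K i b)"
    "length w \<noteq> n \<Longrightarrow> K i b w y = 0"
    "w \<in> lists (homog A) \<Longrightarrow> y \<in> homog G \<Longrightarrow>
        D (shdeg w + fst y + (i + 1 + d)) (K i b w y) = F ((i, e i b) # w) y" for i b w y
    using K0[of i b] unfolding lifts_def by blast+
  \<comment> \<open>Linear in the first letter through its coordinates, and in all other arguments
    because each \<open>K i b\<close> is.\<close>
  define \<kappa> where "\<kappa> w y = (case w of [] \<Rightarrow> 0 | a # v \<Rightarrow>
      linear_extension sN (\<sigma> (fst a)) (\<lambda>b. K (fst a) b v y) (snd a))" for w and y :: "int \<times> 'g"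
  have Kmem: "K i b v y \<in> N k" if "v \<in> lists (homog A)" "y \<in> homog G" "k = shdeg v + fst y + (i + 1 + d)"
    for i b v y k
    by (rule cochain_mem[OF K(1) that(1,2)]) (use that(3) in simp)
  have "cochain sA A sG G sN N d \<kappa>"
    unfolding cochain_def
  proof (intro conjI ballI allI)
    fix y assume y: "y \<in> homog G"
    show "word_multilinear sA A sN (\<lambda>i. N (i + fst y)) d (\<lambda>w. \<kappa> w y)"
      unfolding word_multilinear_def
    proof (intro conjI ballI allI)
      fix us ws i assume us: "us \<in> lists (homog A)" and ws: "ws \<in> lists (homog A)"
      show "linear_on sA (A i) sN (N (shdeg us + (i + 1) + shdeg ws + d + fst y))
          (\<lambda>a. \<kappa> (us @ (i, a) # ws) y)"
      proof (cases us)
        case Nil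
        have "linear_on sA (A i) sN (N (shdeg us + (i + 1) + shdeg ws + d + fst y))
            (linear_extension sN (\<sigma> i) (\<lambda>b. K i b ws y))"
          by (rule linear_on_linear_extension[OF \<sigma> qN Kmem]) (use Nil ws y in auto)
        thus ?thesis by (simp add: \<kappa>_def Nil)
      next
        case (Cons a us')
        have "linear_on sA (A i) sN (N (shdeg us + (i + 1) + shdeg ws + d + fst y))
            (\<lambda>x. \<Sum>b | \<sigma> (fst a) (snd a) b \<noteq> 0. sN (\<sigma> (fst a) (snd a) b) (K (fst a) b (us' @ (i, x) # ws) y))"
          by (intro linear_on_sum_map[OF qN] linear_on_scale_map[OF qN] cochain_slot[OF K(1)])
            (use Cons us ws y in auto)
        thus ?thesis by (simp add: \<kappa>_def Cons linear_extension_def)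
      qed
    qed
  next
    fix w j assume w: "w \<in> lists (homog A)"
    show "linear_on sG (G j) sN (N (shdeg w + j + d)) (\<lambda>y. \<kappa> w (j, y))"
    proof (cases w)
      case (Cons a v)
      have "linear_on sG (G j) sN (N (shdeg w + j + d))
            (\<lambda>y. \<Sum>b | \<sigma> (fst a) (snd a) b \<noteq> 0. sN (\<sigma> (fst a) (snd a) b) (K (fst a) b v (j, y)))"
        by (intro linear_on_sum_map[OF qN] linear_on_scale_map[OF qN] cochain_linear[OF K(1)])
          (use Cons w in auto)
      thus ?thesis by (simp add: \<kappa>_def Cons linear_extension_def)
    qed (simp add: \<kappa>_def linear_on_zero_map[OF qN])
  qed
  moreover have "\<kappa> w y = 0" if "length w \<noteq> Suc n" for w y
  proof -
    interpret qmodule sN using N by (simp add: graded_module_def)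
    show ?thesis using that
      by (cases w) (auto simp: \<kappa>_def linear_extension_def K(2) scale_zero_right)
  qed
  moreover have "D (shdeg w + fst y + d) (\<kappa> w y) = F w y"
    if w: "w \<in> lists (homog A)" and y: "y \<in> homog G" for w y
  proof (cases w)
    case Nil
    thus ?thesis using linear_on_0[OF D(1) qN] Suc.prems(2)[of w y] by (simp add: \<kappa>_def)
  next
    case (Cons a v)
    have v: "v \<in> lists (homog A)" and a: "a \<in> homog A" using Cons w by auto
    have sl: "linear_on sA (A (fst a)) sZ (Z (shdeg v + fst y + (fst a + 1 + d))) (\<lambda>x. F ([] @ (fst a, x) # v) y)"
      by (rule cochain_slot[OF F y _ v]) auto
    have "D (shdeg v + fst y + (fst a + 1 + d)) (\<kappa> w y) =
        linear_extension sZ (\<sigma> (fst a)) (\<lambda>b. F ([] @ (fst a, e (fst a) b) # v) y) (snd a)"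
      unfolding \<kappa>_def Cons list.case
      by (subst linear_image_linear_extension[OF D(1) qN Kmem[OF v y refl]]) (simp add: K(3)[OF v y])
    also have "\<dots> = F ([] @ (fst a, snd a) # v) y"
      by (rule linear_extension_basis[OF \<sigma> sl graded_module_qsubmodule[OF A(1)] homogD[OF a]])
    finally show ?thesis by (simp add: Cons algebra_simps)
  qed
  ultimately show ?case by blast
qed

section \<open>Normalised maps\<close>

text \<open>Instantiated with \<open>u = 0\<close> and \<open>r = 0\<close> when there is no unit to
  respect, and with the unit element and a retraction otherwise. In both cases \<open>r_u\<close>
  makes \<open>a \<mapsto> sA (r a) u\<close> a projection of \<open>A 0\<close> onto the multiples
  of \<open>u\<close>.\<close>

locale unit_splitting = ainf_algebra sA A \<mu>A
  for sA :: "'q::{comm_ring,comm_monoid_mult} \<Rightarrow> 'a::ab_group_add \<Rightarrow> 'a"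
    and A :: "int \<Rightarrow> 'a set"
    and \<mu>A :: "(int \<times> 'a) list \<Rightarrow> 'a" +
  fixes u :: 'a and r :: "'a \<Rightarrow> 'q"
  assumes u_mem: "u \<in> A 0"
    and r_linear: "linear_on sA (A 0) (*) UNIV r"
    and r_u: "sA (r u) u = u"
begin

definition normalised :: "(int \<Rightarrow> 'c set) \<Rightarrow> ((int \<times> 'a) list \<Rightarrow> int \<times> 'c \<Rightarrow> 'n::zero) \<Rightarrow> bool" where
  "normalised C \<phi> \<longleftrightarrow> (\<forall>us\<in>lists (homog A). \<forall>ws\<in>lists (homog A). \<forall>y\<in>homog C. \<phi> (us @ (0, u) # ws) y = 0)"

text \<open>The complementary projection, which kills \<open>u\<close>; the unit lives in degree
  \<open>0\<close>, so other degrees are left alone.\<close>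

definition reduce :: "int \<times> 'a \<Rightarrow> int \<times> 'a" where
  "reduce a = (fst a, if fst a = 0 then snd a - sA (r (snd a)) u else snd a)"

lemma fst_reduce [simp]: "fst (reduce a) = fst a"
  by (simp add: reduce_def)

lemma linear_reduce: "linear_on sA (A i) sA (A i) (\<lambda>a. snd (reduce (i, a)))"
proof -
  interpret qmodule sA using graded by (simp add: graded_module_def)
  have "linear_on (*) UNIV sA (A 0) (\<lambda>q. sA q u)"
    using qsubmodule_scale[OF qsubmodule_A u_mem]
    by (simp add: linear_on_def scale_left_distrib scale_scale)
  from linear_on_uminus[OF qsubmodule_A linear_on_comp[OF r_linear this]]
  have 1: "linear_on sA (A 0) sA (A 0) (\<lambda>a. - sA (r a) u)" .
  have 2: "linear_on sA (A i) sA (A i) (\<lambda>a. a)" for i by (simp add: linear_on_def)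
  show ?thesis
    using linear_on_plus[OF qsubmodule_A 2[of 0] 1] 2
    by (cases "i = 0") (simp_all add: reduce_def)
qed

lemma reduce_homog: "a \<in> homog A \<Longrightarrow> reduce a \<in> homog A"
  using linear_on_mem[OF linear_reduce[of "fst a"], of "snd a"] homogD[of a A]
  by (cases "reduce a") (auto simp: homog_def dest: arg_cong[of _ _ fst])

lemma reduce_words: "w \<in> lists (homog A) \<Longrightarrow> map reduce w \<in> lists (homog A)"
  by (auto simp: reduce_homog)

lemma shdeg_reduce [simp]: "shdeg (map reduce w) = shdeg w"
  by (induction w) simp_all

lemma reduce_u: "reduce (0, u) = (0, 0)"
  by (simp add: reduce_def r_u)

lemma cochain_zero:
  assumes "cochain sA A sC C sN N d \<phi>" "us \<in> lists (homog A)" "ws \<in> lists (homog A)" "y \<in> homog C"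
  shows "\<phi> (us @ (i, 0) # ws) y = 0"
  by (rule linear_on_0[OF cochain_slot[OF assms(1,4,2,3) refl] qsubmodule_A])

lemma cochain_reduce:
  assumes "cochain sA A sC C sN N d \<phi>"
  shows "cochain sA A sC C sN N d (\<lambda>w. \<phi> (map reduce w))"
  unfolding cochain_def word_multilinear_def
proof (intro conjI ballI allI)
  fix y us ws i assume *: "y \<in> homog C" "us \<in> lists (homog A)" "ws \<in> lists (homog A)"
  have "linear_on sA (A i) sN (N (shdeg us + (i + 1) + shdeg ws + d + fst y))
      (\<lambda>a. \<phi> (map reduce us @ (i, a) # map reduce ws) y)"
    by (rule cochain_slot[OF assms]) (use * in \<open>auto simp: reduce_homog\<close>)
  from linear_on_comp[OF linear_reduce this]
  show "linear_on sA (A i) sN (N (shdeg us + (i + 1) + shdeg ws + d + fst y))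
      (\<lambda>a. \<phi> (map reduce (us @ (i, a) # ws)) y)"
    by (simp add: reduce_def)
next
  fix w j assume w: "w \<in> lists (homog A)"
  show "linear_on sC (C j) sN (N (shdeg w + j + d)) (\<lambda>y. \<phi> (map reduce w) (j, y))"
    by (rule cochain_linear[OF assms reduce_words[OF w]]) simp
qed

lemma normalised_reduce:
  assumes "cochain sA A sC C sN N d \<phi>"
  shows "normalised C (\<lambda>w. \<phi> (map reduce w))"
  unfolding normalised_def
proof (intro ballI)
  fix us ws y assume *: "us \<in> lists (homog A)" "ws \<in> lists (homog A)" "y \<in> homog C"
  show "\<phi> (map reduce (us @ (0, u) # ws)) y = 0"
    using cochain_zero[OF assms reduce_words reduce_words, OF * , of 0] by (simp add: reduce_u)
qed

text \<open>\<open>reduce\<close> alters a letter by a multiple of \<open>u\<close>, which a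
  normalised cochain does not see. Letters are restored one by one, with an arbitrary prefix
  \<open>vs\<close> to keep the induction going.\<close>

lemma normalised_map_reduce:
  assumes \<phi>: "cochain sA A sC C sN N d \<phi>" and norm: "normalised C \<phi>"
    and w: "w \<in> lists (homog A)" and y: "y \<in> homog C"
  shows "\<phi> (map reduce w) y = \<phi> w y"
proof -
  have "\<phi> (vs @ map reduce w) y = \<phi> (vs @ w) y" if "vs \<in> lists (homog A)" for vs
    using w that
  proof (induction w arbitrary: vs rule: list.induct)
    case (Cons a w)
    have a: "a \<in> homog A" and w: "w \<in> lists (homog A)" using Cons.prems by auto
    obtain i x where ix: "a = (i, x)" by (cases a)
    have "\<phi> (vs @ reduce a # map reduce w) y = \<phi> (vs @ reduce a # w) y"
      using Cons.IH[of "vs @ [reduce a]"] w Cons.prems(2) reduce_homog[OF a] by simp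
    also have "\<dots> = \<phi> (vs @ a # w) y"
    proof (cases "i = 0")
      case True
      have x: "x \<in> A 0" using a ix True by (simp add: homog_iff)
      note sl = cochain_slot[OF \<phi> y Cons.prems(2) w refl, of 0]
      have "\<phi> (vs @ (0, x - sA (r x) u) # w) y = \<phi> (vs @ (0, x) # w) y - \<phi> (vs @ (0, sA (r x) u) # w) y"
        by (rule linear_on_diff[OF sl qsubmodule_A x qsubmodule_scale[OF qsubmodule_A u_mem]])
      also have "\<phi> (vs @ (0, sA (r x) u) # w) y = sN (r x) (\<phi> (vs @ (0, u) # w) y)"
        by (rule linear_on_scale[OF sl u_mem])
      also have "\<phi> (vs @ (0, u) # w) y = \<phi> (vs @ (0, 0) # w) y"
        using norm Cons.prems(2) w y cochain_zero[OF \<phi> Cons.prems(2) w y, of 0]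
        by (simp add: normalised_def)
      also have "sN (r x) \<dots> = \<phi> (vs @ (0, sA (r x) 0) # w) y"
        by (rule linear_on_scale[OF sl qsubmodule_zero[OF qsubmodule_A], symmetric])
      also have "sA (r x) 0 = 0"
      proof -
        interpret qmodule sA using graded by (simp add: graded_module_def)
        show ?thesis by (rule scale_zero_right)
      qed
      finally show ?thesis
        using ix True cochain_zero[OF \<phi> Cons.prems(2) w y, of 0] by (simp add: reduce_def)
    qed (simp add: ix reduce_def)
    finally show ?case by simp
  qed simp
  from this[of "[]"] show ?thesis by simp
qed

text \<open>Any lift precomposed with \<open>reduce\<close> in all letters is normalised, and it
  remains a lift because \<open>F\<close> is unaffected by \<open>reduce\<close>.\<close>

lemma normalised_lift:
  assumes A: "\<And>i. projective sA (A i)"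
    and G: "graded_module sG G" "\<And>i. projective sG (G i)"
    and N: "graded_module sN N"
    and D: "\<And>k. linear_on sN (N k) sZ (Z k) (D k)" "\<And>k z. z \<in> Z k \<Longrightarrow> \<exists>x\<in>N k. D k x = z"
    and F: "cochain sA A sG G sZ Z d F" "\<And>w y. length w \<noteq> n \<Longrightarrow> F w y = 0" "normalised G F"
  shows "\<exists>\<kappa>. cochain sA A sG G sN N d \<kappa> \<and> normalised G \<kappa> \<and>
     (\<forall>w\<in>lists (homog A). \<forall>y\<in>homog G. D (shdeg w + fst y + d) (\<kappa> w y) = F w y)"
proof -
  obtain \<kappa> where \<kappa>: "cochain sA A sG G sN N d \<kappa>"
    "\<And>w y. w \<in> lists (homog A) \<Longrightarrow> y \<in> homog G \<Longrightarrow> D (shdeg w + fst y + d) (\<kappa> w y) = F w y"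
    using cochain_lift[of sA A sG G sN N sZ Z D d F n, OF graded A G N D F(1,2)] by blast
  have "D (shdeg w + fst y + d) (\<kappa> (map reduce w) y) = F w y"
    if "w \<in> lists (homog A)" "y \<in> homog G" for w y
    using \<kappa>(2)[OF reduce_words[OF that(1)] that(2)] normalised_map_reduce[OF F(1,3) that] by simp
  thus ?thesis
    by (intro exI[of _ "\<lambda>w. \<kappa> (map reduce w)"])
      (simp add: cochain_reduce[OF \<kappa>(1)] normalised_reduce[OF \<kappa>(1)])
qed

end

section \<open>Suspending operations on modules\<close>

text \<open>The decalage sign. The module element counts as one further, unsuspended factor, hence
  \<open>bar_exp 1\<close>. As only signs change, the same map also undoes the suspension.\<close>

definition susp :: "((int \<times> 'a) list \<Rightarrow> int \<times> 'c \<Rightarrow> 'n::ab_group_add) \<Rightarrow> (int \<times> 'a) list \<Rightarrow> int \<times> 'c \<Rightarrow> 'n" where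
  "susp f w y = signed (bar_exp 1 w) (f w y)"

lemma susp_susp: "susp (susp f) = f"
  by (intro ext) (simp add: susp_def signed_def)

text \<open>The suspension absorbs the arity in the degree: with \<open>n = k - 1\<close>,
  operations of degree \<open>k - 2\<close> are cochains of degree -1, and morphism components of
  degree \<open>k - 1\<close> are cochains of degree \<open>0\<close>.\<close>

lemma cochain_iff_multilinear_module:
  "cochain sA A sC C sN N d f \<longleftrightarrow> (\<forall>n. multilinear_module sA A sC C sN N n (int n + d) f)"
proof -
  have 1: "deg us + i + deg ws + (int (length us + 1 + length ws) + d) + k =
      shdeg us + (i + 1) + shdeg ws + d + k" for us ws :: "(int \<times> 'b) list" and i k
    by (simp add: shdeg_def)
  have 2: "j + (deg w + (int (length w) + d)) = shdeg w + j + d" for w :: "(int \<times> 'b) list" and j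
    by (simp add: shdeg_def)
  show ?thesis
  proof (intro iffI allI)
    fix n assume f: "cochain sA A sC C sN N d f"
    show "multilinear_module sA A sC C sN N n (int n + d) f"
      unfolding multilinear_module_def multilinear_def graded_map_def
      by (auto intro!: cochain_slot[OF f] cochain_linear[OF f] simp: shdeg_def)
  next
    assume f: "\<forall>n. multilinear_module sA A sC C sN N n (int n + d) f"
    show "cochain sA A sC C sN N d f"
      unfolding cochain_def word_multilinear_def
    proof (intro conjI ballI allI)
      fix y us ws i assume *: "y \<in> homog C" "us \<in> lists (homog A)" "ws \<in> lists (homog A)"
      have "linear_on sA (A i) sN (N (deg us + i + deg ws + (int (length us + 1 + length ws) + d) + fst y))
          (\<lambda>a. f (us @ (i, a) # ws) y)"
        using f[rule_format, of "length us + 1 + length ws"] *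
        unfolding multilinear_module_def multilinear_def by blast
      thus "linear_on sA (A i) sN (N (shdeg us + (i + 1) + shdeg ws + d + fst y))
          (\<lambda>a. f (us @ (i, a) # ws) y)"
        by (simp only: 1)
    next
      fix w j assume w: "w \<in> lists (homog A)"
      have "linear_on sC (C j) sN (N (j + (deg w + (int (length w) + d)))) (\<lambda>y. f w (j, y))"
        using f[rule_format, of "length w"] w
        unfolding multilinear_module_def graded_map_def by blast
      thus "linear_on sC (C j) sN (N (shdeg w + j + d)) (\<lambda>y. f w (j, y))"
        by (simp only: 2)
    qed
  qed
qed

lemma cochain_signed:
  assumes "cochain sA A sC C sN N d f" "graded_module sN N"
    and "\<And>us ws i a b. s (us @ (i, a) # ws) = s (us @ (i, b) # ws)"
  shows "cochain sA A sC C sN N d (\<lambda>w y. signed (s w) (f w y))"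
  unfolding cochain_def word_multilinear_def
proof (intro conjI ballI allI)
  note qN = graded_module_qsubmodule[OF assms(2)]
  fix y us ws i assume *: "y \<in> homog C" "us \<in> lists (homog A)" "ws \<in> lists (homog A)"
  have eq: "s (us @ (i, a) # ws) = s (us @ (i, 0) # ws)" for a by (rule assms(3))
  have "linear_on sA (A i) sN (N (shdeg us + (i + 1) + shdeg ws + d + fst y))
      (\<lambda>a. signed (s (us @ (i, 0) # ws)) (f (us @ (i, a) # ws) y))"
    by (intro linear_on_signed_map[OF qN] cochain_slot[OF assms(1)]) (use * in auto)
  moreover have "(\<lambda>a. signed (s (us @ (i, a) # ws)) (f (us @ (i, a) # ws) y)) =
      (\<lambda>a. signed (s (us @ (i, 0) # ws)) (f (us @ (i, a) # ws) y))"
    by (rule ext, subst eq, rule refl)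
  ultimately show "linear_on sA (A i) sN (N (shdeg us + (i + 1) + shdeg ws + d + fst y))
      (\<lambda>a. signed (s (us @ (i, a) # ws)) (f (us @ (i, a) # ws) y))"
    by (simp only:)
next
  fix w j assume w: "w \<in> lists (homog A)"
  show "linear_on sC (C j) sN (N (shdeg w + j + d)) (\<lambda>y. signed (s w) (f w (j, y)))"
    by (intro linear_on_signed_map[OF graded_module_qsubmodule[OF assms(2)]] cochain_linear[OF assms(1)] w refl)
qed

lemma cochain_susp:
  assumes "cochain sA A sC C sN N d f" "graded_module sN N"
  shows "cochain sA A sC C sN N d (susp f)"
  unfolding susp_def[abs_def]
  by (rule cochain_signed[OF assms]) (simp add: bar_exp_append)

text \<open>Here \<open>e\<close> is the suspended degree of the inner map \<open>g\<close>, and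
  \<open>t\<close> switches the sign with exponent \<open>u\<close> on. The case
  \<open>t = 1\<close>, \<open>e = -1\<close> has a module operation inside, the case
  \<open>t = 0\<close>, \<open>e = 0\<close> a morphism.\<close>

lemma cut_sum_conv_relation:
  fixes as :: "(int \<times> 'a::ab_group_add) list"
  assumes y: "y \<in> homog C" and C: "graded_module sC C" and as: "as \<in> lists (homog A)"
    and f: "cochain sA A sN N sL L d (susp f)" and g: "cochain sA A sC C sN N e (susp g)"
    and N: "graded_module sN N" and L: "graded_module sL L" and k: "k = Suc (length as)"
  shows "(\<Sum>(u, v) | u + v = k \<and> v \<ge> 1.
         signed (t * int u + (int v - 1 + e) * deg (take u as))
           (f (take u as) (app_module (int v - 1 + e) g (drop u as) y))) =
     signed (bar_exp 1 as)
       (cut_sum as (\<lambda>x z. signed (t * int (length x) + e * deg x) 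
          (susp f x (shdeg z + fst y + e, susp g z y))))"
proof -
  have "(\<Sum>u\<le>length as. signed (t * int u + (int (k - u) - 1 + e) * deg (take u as))
           (f (take u as) (app_module (int (k - u) - 1 + e) g (drop u as) y))) =
     (\<Sum>u\<le>length as. signed (bar_exp 1 as) (signed (t * int (length (take u as)) + e * deg (take u as))
          (susp f (take u as) (shdeg (drop u as) + fst y + e, susp g (drop u as) y))))"
  proof (rule sum.cong[OF refl])
    fix u assume "u \<in> {..length as}"
    hence u: "u \<le> length as" by simp
    define x z where xz: "x = take u as" "z = drop u as"
    have as': "as = x @ z" by (simp add: xz)
    have x: "x \<in> lists (homog A)" and z: "z \<in> lists (homog A)" using as as' by auto
    have len: "length x = u" "int (k - u) = int (length z) + 1" using u by (simp_all add: xz k)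
    have g': "cochain sA A sC C sN N e g" and f': "cochain sA A sN N sL L d f"
      using cochain_susp[OF g N] cochain_susp[OF f L] by (simp_all add: susp_susp)
    let ?j = "shdeg z + fst y + e"
    have "f x (?j, signed (bar_exp 1 z) (g z y)) = signed (bar_exp 1 z) (f x (?j, g z y))"
      by (rule linear_on_signed[OF cochain_linear[OF f' x refl] graded_module_qsubmodule[OF N]])
        (rule cochain_mem[OF g' z y refl])
    moreover have "even ((t * int u + int (length z) * deg x + e * deg x) -
        (bar_exp 1 as + (t * int u + e * deg x + (bar_exp 1 x + bar_exp 1 z))))"
      by (simp add: as' bar_exp_append algebra_simps)
    moreover have "app_module (int (length z) + e) g z y = (?j, g z y)"
      by (simp add: app_module_def shdeg_def)
    ultimately show "signed (t * int u + (int (k - u) - 1 + e) * deg (take u as))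
           (f (take u as) (app_module (int (k - u) - 1 + e) g (drop u as) y)) =
       signed (bar_exp 1 as) (signed (t * int (length (take u as)) + e * deg (take u as))
          (susp f (take u as) (shdeg (drop u as) + fst y + e, susp g (drop u as) y)))"
      unfolding xz[symmetric] len susp_def
      by (auto intro!: signed_cong simp: algebra_simps)
  qed
  thus ?thesis by (simp add: k pair_sum_conv[unfolded One_nat_def] cut_sum_conv_sum)
qed

context ainf_algebra
begin

lemma module_bar_sum_conv_relation:
  assumes y: "y \<in> homog C" and as: "as \<in> lists (homog A)" and k: "k = Suc (length as)"
    and f: "cochain sA A sC C sN N d (susp f)" and N: "graded_module sN N"
  shows "(\<Sum>(u, v, w) | u + v + w = k \<and> v \<ge> 1 \<and> w \<ge> 1.
         signed (int (u + v * w) + (int v - 2) * deg (take u as))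
           (f (take u as @ app (int v - 2) \<mu>A (take v (drop u as)) # drop (u + v) as) y)) =
     signed (bar_exp 1 as) (bar_sum \<mu>A as (\<lambda>v. susp f v y))"
proof -
  have f': "cochain sA A sC C sN N d f"
    using cochain_susp[OF f N] by (simp add: susp_susp)
  have "(\<Sum>(u, v, w) | u + v + w = length as \<and> v \<ge> 1.
      signed (int (u + v * (w + 1)) + (int v - 2) * deg (take u as))
        (f (take u as @ app (int v - 2) \<mu>A (take v (drop u as)) # drop (u + v) as) y)) =
    signed (bar_exp 1 as) (bar_sum \<mu>A as (\<lambda>v. signed (bar_exp 1 v) (f v y)))"
  proof (rule bar_sum_conv_relation)
    fix x w z assume xwz: "as = x @ w @ z" "w \<noteq> []"
    have "snd (bar_op \<mu>A w) \<in> A (shdeg w - 2)"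
      using bar_op_homog[of w] homogD[of "bar_op \<mu>A w" A] as xwz by (simp add: fst_bar_op)
    hence "signed (- bar_exp 0 w) (snd (bar_op \<mu>A w)) \<in> A (shdeg w - 2)"
      by (rule qsubmodule_signed[OF qsubmodule_A])
    hence m: "\<mu>A w \<in> A (shdeg w - 2)" by (simp add: bar_op_def)
    show "f (x @ (shdeg w - 2, - \<mu>A w) # z) y = - f (x @ (shdeg w - 2, \<mu>A w) # z) y"
      by (rule linear_on_minus[OF cochain_slot[OF f' y _ _ refl] qsubmodule_A m]) (use xwz as in auto)
  qed
  thus ?thesis unfolding k triple_sum_shift by (simp only: Suc_eq_plus1 susp_def)
qed

text \<open>Both sums acquire the same sign, with exponent \<open>bar_exp 1 as\<close>, which is
  then dropped.\<close>

lemma module_relation_iff: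
  fixes c :: "(int \<times> 'a) list \<Rightarrow> int \<times> 'c::ab_group_add \<Rightarrow> 'c"
  assumes C: "graded_module sC C" and c: "cochain sA A sC C sC C (- 1) (susp c)"
    and as: "as \<in> lists (homog A)" and y: "y \<in> homog C" and k: "k = Suc (length as)"
  shows "(\<Sum>(u, v, w) | u + v + w = k \<and> v \<ge> 1 \<and> w \<ge> 1.
         signed (int (u + v * w) + (int v - 2) * deg (take u as))
           (c (take u as @ app (int v - 2) \<mu>A (take v (drop u as)) # drop (u + v) as) y)) +
      (\<Sum>(u, v) | u + v = k \<and> v \<ge> 1.
         signed (int u + (int v - 2) * deg (take u as))
           (c (take u as) (app_module (int v - 2) c (drop u as) y))) = 0 \<longleftrightarrow>
      cobar \<mu>A (susp c) (susp c) as y = 0"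
proof -
  have "(\<Sum>(u, v) | u + v = k \<and> v \<ge> 1.
         signed (int u + (int v - 2) * deg (take u as))
           (c (take u as) (app_module (int v - 2) c (drop u as) y))) =
     signed (bar_exp 1 as) (cut_sum as (\<lambda>x z. signed (shdeg x) (susp c x (act (susp c) z y))))"
  proof -
    have "signed (int (length x) - deg x) v = signed (shdeg x) v" for x :: "(int \<times> 'a) list" and v :: 'c
      by (rule signed_cong) (simp add: shdeg_def)
    thus ?thesis
      using cut_sum_conv_relation[OF y C as c c C C k, of 1] by (simp add: act_def)
  qed
  thus ?thesis
    by (simp only: module_bar_sum_conv_relation[OF y as k c C] cobar_def signed_plus[symmetric] signed_eq_0_iff)
qed

text \<open>No Koszul sign appears on the right-hand side, because a suspended morphism has degree
  \<open>0\<close>.\<close>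

lemma morphism_relation_iff:
  fixes p :: "(int \<times> 'a) list \<Rightarrow> int \<times> 'c::ab_group_add \<Rightarrow> 'n::ab_group_add"
  assumes C: "graded_module sC C" and N: "graded_module sN N"
    and c: "cochain sA A sC C sC C (- 1) (susp c)" and n: "cochain sA A sN N sN N (- 1) (susp n)"
    and p: "cochain sA A sC C sN N 0 (susp p)"
    and as: "as \<in> lists (homog A)" and y: "y \<in> homog C" and k: "k = Suc (length as)"
  shows "(\<Sum>(u, v, w) | u + v + w = k \<and> v \<ge> 1 \<and> w \<ge> 1.
         signed (int (u + v * w) + (int v - 2) * deg (take u as))
           (p (take u as @ app (int v - 2) \<mu>A (take v (drop u as)) # drop (u + v) as) y)) +
      (\<Sum>(u, v) | u + v = k \<and> v \<ge> 1.
         signed (int u + (int v - 2) * deg (take u as))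
           (p (take u as) (app_module (int v - 2) c (drop u as) y))) =
      (\<Sum>(u, v) | u + v = k \<and> v \<ge> 1.
         signed ((int v - 1) * deg (take u as))
           (n (take u as) (app_module (int v - 1) p (drop u as) y))) \<longleftrightarrow>
      cobar \<mu>A (susp c) (susp p) as y =
      cut_sum as (\<lambda>x z. susp n x (shdeg z + fst y, susp p z y))"
proof -
  have 1: "(\<Sum>(u, v) | u + v = k \<and> v \<ge> 1.
         signed (int u + (int v - 2) * deg (take u as))
           (p (take u as) (app_module (int v - 2) c (drop u as) y))) =
     signed (bar_exp 1 as) (cut_sum as (\<lambda>x z. signed (shdeg x) (susp p x (act (susp c) z y))))"
  proof -
    have "signed (int (length x) - deg x) v = signed (shdeg x) v" for x :: "(int \<times> 'a) list" and v :: 'n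
      by (rule signed_cong) (simp add: shdeg_def)
    thus ?thesis
      using cut_sum_conv_relation[OF y C as p c C N k, of 1] by (simp add: act_def)
  qed
  have 2: "(\<Sum>(u, v) | u + v = k \<and> v \<ge> 1.
         signed ((int v - 1) * deg (take u as))
           (n (take u as) (app_module (int v - 1) p (drop u as) y))) =
     signed (bar_exp 1 as) (cut_sum as (\<lambda>x z. susp n x (shdeg z + fst y, susp p z y)))"
    using cut_sum_conv_relation[OF y C as n p N N k, of 0] by simp
  have 3: "signed e a = signed e b \<longleftrightarrow> a = b" for e and a b :: 'n
    by (simp add: signed_def)
  show ?thesis
    unfolding 1 2 module_bar_sum_conv_relation[OF y as k p N] signed_plus[symmetric] 3
    by (simp add: cobar_def)
qed

end

section \<open>Strict units and normalised curvature\<close>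

context unit_splitting
begin

definition strict_unit :: bool where
  "strict_unit \<longleftrightarrow>
     (\<forall>a\<in>homog A. \<mu>A [a, (0, u)] = snd a \<and> \<mu>A [(0, u), a] = snd a) \<and>
     (\<forall>us\<in>lists (homog A). \<forall>ws\<in>lists (homog A). length us + length ws \<noteq> 1 \<longrightarrow> \<mu>A (us @ (0, u) # ws) = 0)"

definition strict_unit_action ::
  "(int \<Rightarrow> 'c::ab_group_add set) \<Rightarrow> ((int \<times> 'a) list \<Rightarrow> int \<times> 'c \<Rightarrow> 'c) \<Rightarrow> bool" where
  "strict_unit_action C c \<longleftrightarrow>
     (\<forall>y\<in>homog C. c [(0, u)] y = snd y) \<and>
     (\<forall>us\<in>lists (homog A). \<forall>ws\<in>lists (homog A). \<forall>y\<in>homog C. us @ ws \<noteq> [] \<longrightarrow> c (us @ (0, u) # ws) y = 0)"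

text \<open>
  Multiplying a unit into its left and into its right neighbour gives opposite signs; at the ends
  of the word, the action of the unit on the module takes the place of a neighbour.
\<close>

lemma normalised_cobar:
  assumes A: "strict_unit" and c: "cochain sA A sC C sC C (- 1) c" and C: "graded_module sC C"
    and unit: "strict_unit_action C c"
  shows "normalised C (cobar \<mu>A c c)"
  unfolding normalised_def
proof (intro ballI)
  fix us ws y assume us: "us \<in> lists (homog A)" and ws: "ws \<in> lists (homog A)" and y: "y \<in> homog C"
  let ?U = "(0 :: int, u)"
  have U: "?U \<in> homog A" using u_mem by (simp add: homog_iff)
  have c1: "c [?U] y = snd y" if "y \<in> homog C" for y
    using unit that by (simp add: strict_unit_action_def)
  have c0: "c (us @ ?U # ws) y = 0"
    if "us \<in> lists (homog A)" "ws \<in> lists (homog A)" "y \<in> homog C" "us @ ws \<noteq> []" for us ws y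
    using unit that unfolding strict_unit_action_def by blast
  have cz: "c x (k, 0) = 0" if "x \<in> lists (homog A)" for x k
    by (rule linear_on_0[OF cochain_linear[OF c that refl] graded_module_qsubmodule[OF C]])
  have bl: "bar_op \<mu>A [?U, a] = a" if "a \<in> homog A" for a
    using A that by (intro prod_eqI) (simp_all add: strict_unit_def bar_op_def)
  \<comment> \<open>Only multiplication by the unit from the right picks up a decalage sign, since
    the unit has degree \<open>0\<close>. It is responsible for the opposite signs of the two
    neighbours.\<close>
  have br: "bar_op \<mu>A [a, ?U] = (fst a, signed (fst a) (snd a))" if "a \<in> homog A" for a
    using A that by (intro prod_eqI) (simp_all add: strict_unit_def bar_op_def)
  have b0: "snd (bar_op \<mu>A (z @ ?U # p)) = 0"
    if "z \<in> lists (homog A)" "p \<in> lists (homog A)" "length z + length p \<noteq> 1" for z p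
    using A that by (simp add: strict_unit_def bar_op_def)
  define H where "H x z p q = signed (shdeg x) (c (x @ bar_op \<mu>A (z @ ?U # p) # q) y)" for x z p q
  \<comment> \<open>A contraction around the unit survives only if it contains exactly one
    neighbour.\<close>
  have H0: "H x z p q = 0"
    if "us = x @ z" "ws = p @ q" "length z + length p \<noteq> 1" for x z p q
  proof -
    have "c (x @ (fst (bar_op \<mu>A (z @ ?U # p)), 0) # q) y = 0"
      by (rule cochain_zero[OF c _ _ y]) (use us ws that in auto)
    moreover have "bar_op \<mu>A (z @ ?U # p) = (fst (bar_op \<mu>A (z @ ?U # p)), 0)"
      using b0[of z p] us ws that by (intro prod_eqI) auto
    ultimately show ?thesis by (simp add: H_def)
  qed
  let ?s = "signed (shdeg us) (c (us @ ws) y)"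
  have T1: "bar_sum \<mu>A us (\<lambda>x. c (x @ ?U # ws) y) = 0"
    by (rule bar_sum_zero[OF us c0]) (use ws y in \<open>auto simp: bar_step_def\<close>)
  have T3: "bar_sum \<mu>A ws (\<lambda>z. c (us @ ?U # z) y) = 0"
    by (rule bar_sum_zero[OF ws c0]) (use us y in \<open>auto simp: bar_step_def\<close>)
  have R: "cut_sum ws (H us []) = (if ws = [] then 0 else ?s)"
  proof (cases ws)
    case Nil thus ?thesis using H0[of us "[]" "[]" "[]"] by simp
  next
    case (Cons a ws')
    have "cut_sum ws' (\<lambda>p q. H us [] (a # p) q) = H us [] [a] ws'"
      by (rule cut_sum_first, rule H0) (use Cons in auto)
    moreover have "H us [] [] (a # ws') = 0" by (rule H0) (use Cons in auto)
    ultimately show ?thesis using Cons bl[of a] ws by (simp add: H_def)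
  qed
  have F: "cut_sum ws (H x z) = H x z [] ws" if "us = x @ z" "z \<noteq> []" for x z
    by (rule cut_sum_first, rule H0) (use that in \<open>auto simp: Suc_le_eq neq_Nil_conv\<close>)
  have T2: "cut_sum us (\<lambda>x z. cut_sum ws (H x z)) =
      (if us = [] then 0 else - ?s) + (if ws = [] then 0 else ?s)"
  proof (cases us rule: rev_cases)
    case Nil thus ?thesis using R by simp
  next
    case (snoc us' l)
    have "cut_sum us (\<lambda>x z. cut_sum ws (H x z)) =
        cut_sum us' (\<lambda>x z. cut_sum ws (H x (z @ [l]))) + cut_sum ws (H us [])"
      by (simp add: snoc cut_sum_append_Cons)
    also have "cut_sum us' (\<lambda>x z. cut_sum ws (H x (z @ [l]))) = cut_sum us' (\<lambda>x z. H x (z @ [l]) [] ws)"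
      by (rule cut_sum_cong, rule F) (use snoc in auto)
    also have "\<dots> = H us' [l] [] ws"
      by (subst cut_sum_last) (auto intro!: H0 simp: snoc)
    also have "\<dots> = - ?s"
    proof -
      have l: "l \<in> homog A" and us': "us' \<in> lists (homog A)" using us snoc by auto
      have "c (us' @ (fst l, signed (fst l) (snd l)) # ws) y = signed (fst l) (c (us' @ (fst l, snd l) # ws) y)"
        by (rule linear_on_signed[OF cochain_slot[OF c y us' ws refl] qsubmodule_A homogD[OF l]])
      hence "H us' [l] [] ws = signed (shdeg us' + fst l) (c (us @ ws) y)"
        by (simp add: H_def br[OF l] snoc)
      also have "\<dots> = - ?s" by (rule signed_opposite) (simp add: snoc)
      finally show ?thesis .
    qed
    finally show ?thesis unfolding R using snoc by simp
  qed
  \<comment> \<open>If nothing follows the unit, it can act on \<open>y\<close> directly; if nothing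
    precedes it (\<open>T5\<close>), it can act on the result of \<open>ws\<close>. These terms
    replace the missing neighbour in \<open>T2\<close>.\<close>
  have T4: "cut_sum us (\<lambda>x z. signed (shdeg x) (c x (act c (z @ ?U # ws) y))) = (if ws = [] then ?s else 0)"
  proof (cases "ws = []")
    case True
    have "cut_sum us (\<lambda>x z. signed (shdeg x) (c x (act c (z @ ?U # ws) y))) =
        signed (shdeg us) (c us (act c ([] @ ?U # ws) y))"
      by (rule cut_sum_last) (use us ws y c0 cz in \<open>auto simp: act_def\<close>)
    also have "act c ([] @ ?U # ws) y = y" using c1[OF y] True by (simp add: act_def)
    finally show ?thesis using True by simp
  next
    case False
    have "cut_sum us (\<lambda>x z. signed (shdeg x) (c x (act c (z @ ?U # ws) y))) = 0"
      by (rule cut_sum_zero) (use us ws y c0 cz False in \<open>auto simp: act_def\<close>)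
    thus ?thesis using False by simp
  qed
  have T5: "cut_sum ws (\<lambda>x z. signed (shdeg (us @ ?U # x)) (c (us @ ?U # x) (act c z y))) =
      (if us = [] then - ?s else 0)"
  proof (cases "us = []")
    case True
    have "cut_sum ws (\<lambda>x z. signed (shdeg (us @ ?U # x)) (c (us @ ?U # x) (act c z y))) =
        signed (shdeg (us @ ?U # [])) (c (us @ ?U # []) (act c ws y))"
      by (rule cut_sum_first) (use us ws c0 act_homog[OF c _ y] in auto)
    also have "\<dots> = - c ws y" using True c1[OF act_homog[OF c ws y]] by (simp add: act_def signed_def)
    finally show ?thesis using True by simp
  next
    case False
    have "cut_sum ws (\<lambda>x z. signed (shdeg (us @ ?U # x)) (c (us @ ?U # x) (act c z y))) = 0"
      by (rule cut_sum_zero) (use us ws c0 act_homog[OF c _ y] False in auto)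
    thus ?thesis using False by simp
  qed
  show "cobar \<mu>A c c (us @ ?U # ws) y = 0"
    unfolding cobar_def bar_sum_append_Cons cut_sum_append_Cons[of us ?U ws] T1 T3 T4 T5 H_def[symmetric] T2
    by simp
qed

end

section \<open>The cone\<close>

lemma cochain_image:
  assumes "cochain sA A sC C sN N d \<phi>" "\<And>k. linear_on sN (N k) sL (L (k + e)) h" "d' = d + e"
  shows "cochain sA A sC C sL L d' (\<lambda>w y. h (\<phi> w y))"
  unfolding cochain_def word_multilinear_def
proof (intro conjI ballI allI)
  fix y us ws i assume "y \<in> homog C" "us \<in> lists (homog A)" "ws \<in> lists (homog A)"
  from linear_on_comp[OF cochain_slot[OF assms(1) this refl] assms(2), of i]
  show "linear_on sA (A i) sL (L (shdeg us + (i + 1) + shdeg ws + d' + fst y)) (\<lambda>a. h (\<phi> (us @ (i, a) # ws) y))"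
    by (simp add: assms(3) algebra_simps)
next
  fix w j assume "w \<in> lists (homog A)"
  from linear_on_comp[OF cochain_linear[OF assms(1) this refl] assms(2), of j]
  show "linear_on sC (C j) sL (L (shdeg w + j + d')) (\<lambda>y. h (\<phi> w (j, y)))"
    by (simp add: assms(3) algebra_simps)
qed

lemma cochain_mono:
  "cochain sA A sC C sN N d \<phi> \<Longrightarrow> (\<And>k. N k \<subseteq> L k) \<Longrightarrow> cochain sA A sC C sN L d \<phi>"
  unfolding cochain_def word_multilinear_def by (blast intro: linear_on_mono)

lemma cochain_zero_map: "graded_module sN N \<Longrightarrow> cochain sA A sC C sN N d (\<lambda>w y. 0)"
  unfolding cochain_def word_multilinear_def
  by (auto intro: linear_on_zero_map graded_module_qsubmodule)

text \<open>Applied to the inclusion of \<open>M\<close> into the cone and to the two projections,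
  in order to split equations in the cone into components.\<close>

lemma (in ainf_algebra) cobar_linear_image:
  assumes h: "linear_on sN (N k) sY Y h" and N: "graded_module sN N"
    and c: "cochain sA A sC C sC C (- 1) c" and \<phi>: "cochain sA A sC C sN N d \<phi>"
    and w: "w \<in> lists (homog A)" and y: "y \<in> homog C" and k: "k = shdeg w + fst y + d - 1"
  shows "h (cobar \<mu>A c \<phi> w y) = bar_sum \<mu>A w (\<lambda>v. h (\<phi> v y)) +
     cut_sum w (\<lambda>x z. signed (shdeg x) (h (\<phi> x (act c z y))))"
proof -
  note qN = graded_module_qsubmodule[OF N]
  have m1: "\<phi> v y \<in> N k" if "bar_step A w v" for v
    by (rule cochain_mem[OF \<phi> _ y]) (use that in \<open>auto simp: k bar_step_def\<close>)
  have m2: "\<phi> x (act c z y) \<in> N k" if "w = x @ z" for x z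
    by (rule cochain_mem[OF \<phi> _ act_homog[OF c _ y]]) (use w that in \<open>auto simp: k act_def\<close>)
  have "h (cobar \<mu>A c \<phi> w y) = h (bar_sum \<mu>A w (\<lambda>v. \<phi> v y)) +
      h (cut_sum w (\<lambda>x z. signed (shdeg x) (\<phi> x (act c z y))))"
    unfolding cobar_def
    by (rule linear_on_add[OF h])
      (intro bar_sum_mem[OF qN w] cut_sum_mem[OF qN] qsubmodule_signed[OF qN] m1 m2; assumption)+
  also have "h (bar_sum \<mu>A w (\<lambda>v. \<phi> v y)) = bar_sum \<mu>A w (\<lambda>v. h (\<phi> v y))"
    by (rule bar_sum_linear_image[OF h qN w m1])
  also have "h (cut_sum w (\<lambda>x z. signed (shdeg x) (\<phi> x (act c z y)))) =
      cut_sum w (\<lambda>x z. h (signed (shdeg x) (\<phi> x (act c z y))))"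
    by (rule cut_sum_linear_image[OF h qN]) (intro qsubmodule_signed[OF qN] m2)
  also have "\<dots> = cut_sum w (\<lambda>x z. signed (shdeg x) (h (\<phi> x (act c z y))))"
    by (rule cut_sum_cong) (rule linear_on_signed[OF h qN m2])
  finally show ?thesis .
qed

text \<open>The alternative \<open>u = 0\<close> stands for the case without unit: every cochain is
  then normalised by linearity, so that the two cases share one construction.\<close>

locale resolution =
  unit_splitting sA A \<mu>A u r + M: ainf_module sA A \<mu>A sM M \<mu>M
  for sA :: "'q::{comm_ring,comm_monoid_mult} \<Rightarrow> 'a::ab_group_add \<Rightarrow> 'a"
    and A :: "int \<Rightarrow> 'a set"
    and \<mu>A :: "(int \<times> 'a) list \<Rightarrow> 'a"
    and u :: 'a and r :: "'a \<Rightarrow> 'q"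
    and sM :: "'q \<Rightarrow> 'm::ab_group_add \<Rightarrow> 'm"
    and M :: "int \<Rightarrow> 'm set"
    and \<mu>M :: "(int \<times> 'a) list \<Rightarrow> int \<times> 'm \<Rightarrow> 'm" +
  fixes sG :: "'q \<Rightarrow> 'g::ab_group_add \<Rightarrow> 'g"
    and G :: "int \<Rightarrow> 'g set"
    and dG :: "int \<times> 'g \<Rightarrow> 'g"
    and \<epsilon>1 :: "int \<times> 'g \<Rightarrow> 'm"
    and a0 g0 :: int
  assumes A_projective: "projective sA (A i)"
    and A_bounded: "i < a0 \<Longrightarrow> A i = {0}"
    and G_complex: "chain_complex sG G dG"
    and G_projective: "projective sG (G i)"
    and G_bounded: "i < g0 \<Longrightarrow> G i = {0}"
    and quasi_iso: "quasi_isomorphism sG G dG sM M (\<mu>M []) \<epsilon>1"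
    and unit: "u = 0 \<or> strict_unit \<and> strict_unit_action M \<mu>M \<and> r u = 1"
begin

definition sC :: "'q \<Rightarrow> 'm \<times> 'g \<Rightarrow> 'm \<times> 'g" where
  "sC q x = (sM q (fst x), sG q (snd x))"

definition C :: "int \<Rightarrow> ('m \<times> 'g) set" where
  "C i = M i \<times> G (i - 1)"

text \<open>
  Values of the operations of positive arity on \<open>G\<close> are taken in this part of the cone. Its first
  component carries the higher components of the morphism, which have to vanish when \<open>\<epsilon>1\<close> is
  surjective.
\<close>

definition C' :: "int \<Rightarrow> ('m \<times> 'g) set" where
  "C' i = (if degreewise_surjective G M \<epsilon>1 then {0} else M i) \<times> G (i - 1)"

abbreviation "cM \<equiv> susp \<mu>M"

text \<open>The action on the summand \<open>M\<close> is the given one; all unknowns are in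
  \<open>\<nu>\<close>. Up to sign, its component in \<open>G\<close> is the new module structure
  and its component in \<open>M\<close> is the morphism. The degree of \<open>\<nu>\<close> is
  \<open>0\<close> when arguments from \<open>G\<close> carry their own degree and not the one in
  the cone.\<close>

definition cone_op :: "((int \<times> 'a) list \<Rightarrow> int \<times> 'g \<Rightarrow> 'm \<times> 'g) \<Rightarrow>
    (int \<times> 'a) list \<Rightarrow> int \<times> ('m \<times> 'g) \<Rightarrow> 'm \<times> 'g" where
  "cone_op \<nu> w y = (cM w (fst y, fst (snd y)), 0) + \<nu> w (fst y - 1, snd (snd y))"

definition curvature :: "((int \<times> 'a) list \<Rightarrow> int \<times> 'g \<Rightarrow> 'm \<times> 'g) \<Rightarrow>
    (int \<times> 'a) list \<Rightarrow> int \<times> 'g \<Rightarrow> 'm \<times> 'g" where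
  "curvature \<nu> w y = cobar \<mu>A (cone_op \<nu>) (cone_op \<nu>) w (fst y + 1, (0, snd y))"

lemma graded_G: "graded_module sG G"
  using G_complex by (simp add: chain_complex_def)

lemma qsubmodule_M: "qsubmodule sM (M i)" and qsubmodule_G: "qsubmodule sG (G i)"
  by (rule graded_module_qsubmodule, rule M.graded graded_G)+

lemma graded_C: "graded_module sC C"
proof -
  interpret m: qmodule sM using M.graded by (simp add: graded_module_def)
  interpret g: qmodule sG using graded_G by (simp add: graded_module_def)
  have "qmodule sC"
    by standard (auto simp: sC_def m.scale_right_distrib g.scale_right_distrib m.scale_left_distrib
        g.scale_left_distrib m.scale_scale g.scale_scale m.scale_one g.scale_one)
  moreover have "submodule sC (C i)" for i
    using qsubmodule_M[of i] qsubmodule_G[of "i - 1"]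
    by (auto simp: qsubmodule_def submodule_def C_def sC_def zero_prod_def plus_prod_def)
  ultimately show ?thesis by (simp add: graded_module_def)
qed

lemma graded_C': "graded_module sC C'"
proof -
  interpret m: qmodule sM using M.graded by (simp add: graded_module_def)
  have "submodule sC (C' i)" for i
    using qsubmodule_M[of i] qsubmodule_G[of "i - 1"]
    by (auto simp: qsubmodule_def submodule_def C'_def sC_def zero_prod_def plus_prod_def m.scale_zero_right)
  thus ?thesis using graded_C by (simp add: graded_module_def)
qed

lemma qsubmodule_C: "qsubmodule sC (C i)"
  by (rule graded_module_qsubmodule[OF graded_C])

lemma C'_subset: "C' i \<subseteq> C i"
  using qsubmodule_zero[OF qsubmodule_M] by (auto simp: C'_def C_def)

lemma linear_fst: "linear_on sC (C i) sM (M i) fst"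
  by (auto simp: linear_on_def C_def sC_def)

lemma linear_snd: "j = i - 1 \<Longrightarrow> linear_on sC (C i) sG (G j) snd"
  by (auto simp: linear_on_def C_def sC_def)

lemma linear_inl: "linear_on sM (M i) sC (C i) (\<lambda>m. (m, 0))"
proof -
  interpret g: qmodule sG using graded_G by (simp add: graded_module_def)
  show ?thesis using qsubmodule_zero[OF qsubmodule_G]
    by (auto simp: linear_on_def C_def sC_def g.scale_zero_right)
qed

lemma linear_inr: "i = j + 1 \<Longrightarrow> linear_on sG (G j) sC (C i) (\<lambda>g. (0, g))"
proof -
  assume "i = j + 1"
  interpret m: qmodule sM using M.graded by (simp add: graded_module_def)
  show ?thesis using qsubmodule_zero[OF qsubmodule_M] \<open>i = j + 1\<close>
    by (auto simp: linear_on_def C_def sC_def m.scale_zero_right)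
qed

lemma cochain_cM: "cochain sA A sM M sM M (- 1) cM"
proof (rule cochain_susp[OF _ M.graded], unfold cochain_iff_multilinear_module, rule allI)
  fix n show "multilinear_module sA A sM M sM M n (int n + - 1) \<mu>M"
    using M.multilinear[of "Suc n"] by (simp add: algebra_simps)
qed

lemma cM_square: "w \<in> lists (homog A) \<Longrightarrow> y \<in> homog M \<Longrightarrow> cobar \<mu>A cM cM w y = 0"
  by (rule iffD1[OF module_relation_iff[OF M.graded cochain_cM _ _ refl] M.relation]) auto

lemma cM_zero: "w \<in> lists (homog A) \<Longrightarrow> cM w (i, 0) = 0"
  by (rule linear_on_0[OF cochain_linear[OF cochain_cM _ refl] qsubmodule_M])

lemma \<nu>_zero: "cochain sA A sG G sC C 0 \<nu> \<Longrightarrow> w \<in> lists (homog A) \<Longrightarrow> \<nu> w (i, 0) = 0"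
  by (rule linear_on_0[OF cochain_linear[OF _ _ refl] qsubmodule_G])

lemma homog_C_iff: "y \<in> homog C \<longleftrightarrow> fst (snd y) \<in> M (fst y) \<and> snd (snd y) \<in> G (fst y - 1)"
  by (cases y) (auto simp: homog_def C_def)

lemma homog_C_D:
  assumes "y \<in> homog C"
  shows "(fst y, fst (snd y)) \<in> homog M" "(fst y - 1, snd (snd y)) \<in> homog G"
  using assms by (auto simp: homog_C_iff homog_iff)

lemma inr_homog: "y \<in> homog G \<Longrightarrow> (fst y + 1, (0, snd y)) \<in> homog C"
  by (simp add: homog_C_iff homogD qsubmodule_zero[OF qsubmodule_M])

lemma cochain_cone_op:
  assumes \<nu>: "cochain sA A sG G sC C 0 \<nu>"
  shows "cochain sA A sC C sC C (- 1) (cone_op \<nu>)"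
proof -
  have iM: "cochain sA A sM M sC C (- 1) (\<lambda>w y. (cM w y, 0))"
    by (rule cochain_image[OF cochain_cM, of _ _ 0]) (simp_all add: linear_inl)
  show ?thesis
    unfolding cochain_def word_multilinear_def
  proof (intro conjI ballI allI)
    fix y us ws i assume y: "y \<in> homog C" and w: "us \<in> lists (homog A)" "ws \<in> lists (homog A)"
    show "linear_on sA (A i) sC (C (shdeg us + (i + 1) + shdeg ws + - 1 + fst y))
        (\<lambda>a. cone_op \<nu> (us @ (i, a) # ws) y)"
      unfolding cone_op_def
      by (intro linear_on_plus[OF qsubmodule_C]
          cochain_slot[OF iM homog_C_D(1)[OF y] w] cochain_slot[OF \<nu> homog_C_D(2)[OF y] w]) simp_all
  next
    fix w j assume w: "w \<in> lists (homog A)"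
    let ?k = "shdeg w + j + - 1"
    have 1: "linear_on sC (C j) sC (C ?k) (\<lambda>y. (cM w (j, fst y), 0))"
      by (rule linear_on_comp[OF linear_fst cochain_linear[OF iM w refl]])
    have 2: "linear_on sC (C j) sC (C ?k) (\<lambda>y. \<nu> w (j - 1, snd y))"
      by (rule linear_on_comp[OF linear_snd cochain_linear[OF \<nu> w]]) simp_all
    show "linear_on sC (C j) sC (C ?k) (\<lambda>y. cone_op \<nu> w (j, y))"
      unfolding cone_op_def using linear_on_plus[OF qsubmodule_C 1 2] by simp
  qed
qed

text \<open>\<open>M\<close> is closed under the operations of the cone, and its own relation holds.
  Hence the curvature needs to be studied on arguments from \<open>G\<close> only.\<close>

lemma cobar_cone_inl:
  assumes \<nu>: "cochain sA A sG G sC C 0 \<nu>" and w: "w \<in> lists (homog A)" and m: "m \<in> M i"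
  shows "cobar \<mu>A (cone_op \<nu>) (cone_op \<nu>) w (i, (m, 0)) = 0"
proof -
  have c: "cone_op \<nu> v (j, (m', 0)) = (cM v (j, m'), 0)" if "v \<in> lists (homog A)" for v j m'
    by (simp add: cone_op_def \<nu>_zero[OF \<nu> that])
  have m': "(i, m) \<in> homog M" by (simp add: homog_iff m)
  have "cobar \<mu>A (cone_op \<nu>) (cone_op \<nu>) w (i, (m, 0)) =
      bar_sum \<mu>A w (\<lambda>v. (cM v (i, m), 0)) +
      cut_sum w (\<lambda>x z. signed (shdeg x) (cM x (act cM z (i, m)), 0))"
    unfolding cobar_def
    by (intro arg_cong2[of _ _ _ _ "(+)"] bar_sum_cong[OF w] cut_sum_cong)
      (use w in \<open>auto simp: c act_def bar_step_def\<close>)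
  also have "\<dots> = (cobar \<mu>A cM cM w (i, m), 0)"
    by (rule cobar_linear_image[OF linear_inl M.graded cochain_cM cochain_cM w m' refl, symmetric])
  finally show ?thesis by (simp add: cM_square[OF w m'] zero_prod_def)
qed

lemma cobar_cone_eq_curvature:
  assumes \<nu>: "cochain sA A sG G sC C 0 \<nu>" and w: "w \<in> lists (homog A)" and y: "y \<in> homog C"
  shows "cobar \<mu>A (cone_op \<nu>) (cone_op \<nu>) w y = curvature \<nu> w (fst y - 1, snd (snd y))"
proof -
  let ?R = "cobar \<mu>A (cone_op \<nu>) (cone_op \<nu>) w"
  obtain i m g where y': "y = (i, (m, g))" by (metis prod.exhaust)
  have mg: "m \<in> M i" "g \<in> G (i - 1)" using y y' by (auto simp: homog_C_iff)
  have "linear_on sC (C i) sC (C (shdeg w + i + (- 1 - 1))) (\<lambda>x. ?R (i, x))"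
    by (rule cochain_linear[OF cochain_cobar[OF cochain_cone_op[OF \<nu>] cochain_cone_op[OF \<nu>] graded_C] w refl])
  from linear_on_add[OF this, of "(m, 0)" "(0, g)"] mg
  have "?R (i, (m, g)) = ?R (i, (m, 0)) + ?R (i, (0, g))"
    by (simp add: C_def qsubmodule_zero[OF qsubmodule_M] qsubmodule_zero[OF qsubmodule_G])
  thus ?thesis by (simp add: y' cobar_cone_inl[OF \<nu> w mg(1)] curvature_def)
qed

lemma cochain_curvature:
  assumes \<nu>: "cochain sA A sG G sC C 0 \<nu>"
  shows "cochain sA A sG G sC C (- 1) (curvature \<nu>)"
proof -
  note R = cochain_cobar[OF cochain_cone_op[OF \<nu>] cochain_cone_op[OF \<nu>] graded_C]
  show ?thesis
    unfolding cochain_def word_multilinear_def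
  proof (intro conjI ballI allI)
    fix y us ws i assume y: "y \<in> homog G" and w: "us \<in> lists (homog A)" "ws \<in> lists (homog A)"
    show "linear_on sA (A i) sC (C (shdeg us + (i + 1) + shdeg ws + - 1 + fst y))
        (\<lambda>a. curvature \<nu> (us @ (i, a) # ws) y)"
      unfolding curvature_def by (rule cochain_slot[OF R inr_homog[OF y] w]) simp
  next
    fix w j assume w: "w \<in> lists (homog A)"
    show "linear_on sG (G j) sC (C (shdeg w + j + - 1)) (\<lambda>y. curvature \<nu> w (j, y))"
      unfolding curvature_def fst_conv snd_conv
      by (rule linear_on_comp[OF linear_inr cochain_linear[OF R w]]) simp_all
  qed
qed

lemma cone_op_inr:
  "w \<in> lists (homog A) \<Longrightarrow> cone_op \<nu> w (fst y + 1, (0, snd y)) = \<nu> w y"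
  by (simp add: cone_op_def cM_zero flip: zero_prod_def)

lemma act_cone_op_inr:
  "w \<in> lists (homog A) \<Longrightarrow> act (cone_op \<nu>) w (fst y + 1, (0, snd y)) = (shdeg w + fst y, \<nu> w y)"
  by (simp add: act_def cone_op_inr)

text \<open>
  The exponents \<open>shdeg w + 1\<close> and \<open>shdeg w\<close> undo the Koszul signs caused by the shift of \<open>G\<close> in the
  cone.
\<close>

lemma curvature_zero_components:
  fixes \<nu>
  defines "cG \<equiv> \<lambda>w y. signed (shdeg w + 1) (snd (\<nu> w y))"
    and "p \<equiv> \<lambda>w y. signed (shdeg w) (fst (\<nu> w y))"
  assumes \<nu>: "cochain sA A sG G sC C 0 \<nu>" and w: "w \<in> lists (homog A)" and y: "y \<in> homog G"
    and flat: "curvature \<nu> w y = 0"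
  shows "cobar \<mu>A cG cG w y = 0"
    and "cobar \<mu>A cG p w y = cut_sum w (\<lambda>x z. cM x (shdeg z + fst y, p z y))"
proof -
  let ?c = "cone_op \<nu>" and ?y = "(fst y + 1, (0, snd y)) :: int \<times> 'm \<times> 'g"
  note c = cochain_cone_op[OF \<nu>]
  note y' = inr_homog[OF y]
  have \<nu>G: "\<nu> v y \<in> C (shdeg v + fst y)" if "v \<in> lists (homog A)" for v
    by (rule cochain_mem[OF \<nu> that y]) simp
  have G: "snd (\<nu> z y) \<in> G (shdeg z + fst y - 1)" and M: "fst (\<nu> z y) \<in> M (shdeg z + fst y)"
    if "z \<in> lists (homog A)" for z
    using \<nu>G[OF that] by (auto simp: C_def)
  have outer: "?c x (act ?c z ?y) =
      (cM x (shdeg z + fst y, fst (\<nu> z y)), 0) + \<nu> x (shdeg z + fst y - 1, snd (\<nu> z y))"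
    if "z \<in> lists (homog A)" for x z
    by (simp add: act_cone_op_inr[OF that] cone_op_def)
  \<comment> \<open>The composite in the cone inserts the unsigned component of
    \<open>\<nu>\<close>, whereas \<open>act cG\<close> inserts the signed one; linearity moves the
    difference outside.\<close>
  have inner: "\<nu> x (shdeg z + fst y - 1, snd (\<nu> z y)) = signed (shdeg z + 1) (\<nu> x (act cG z y))"
    if "x \<in> lists (homog A)" "z \<in> lists (homog A)" for x z
  proof -
    have "snd (\<nu> z y) = signed (shdeg z + 1) (cG z y)"
      by (simp add: cG_def signed_def)
    moreover have "cG z y \<in> G (shdeg z + fst y - 1)"
      using qsubmodule_signed[OF qsubmodule_G G[OF that(2)]] by (simp add: cG_def)
    ultimately show ?thesis
      by (simp add: act_def linear_on_signed[OF cochain_linear[OF \<nu> that(1) refl] qsubmodule_G])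
  qed
  have inner': "cM x (shdeg z + fst y, fst (\<nu> z y)) = signed (shdeg z) (cM x (shdeg z + fst y, p z y))"
    if "x \<in> lists (homog A)" "z \<in> lists (homog A)" for x z
  proof -
    have "fst (\<nu> z y) = signed (shdeg z) (p z y)"
      by (simp add: p_def signed_def)
    moreover have "p z y \<in> M (shdeg z + fst y)"
      using qsubmodule_signed[OF qsubmodule_M M[OF that(2)]] by (simp add: p_def)
    ultimately show ?thesis
      by (simp add: linear_on_signed[OF cochain_linear[OF cochain_cM that(1) refl] qsubmodule_M])
  qed
  \<comment> \<open>The component in \<open>G\<close>: up to an overall sign, \<open>cG\<close>
    composed with itself.\<close>
  have "0 = snd (cobar \<mu>A ?c ?c w ?y)" using flat by (simp add: curvature_def)
  also have "\<dots> = bar_sum \<mu>A w (\<lambda>v. snd (?c v ?y)) +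
      cut_sum w (\<lambda>x z. signed (shdeg x) (snd (?c x (act ?c z ?y))))"
    by (rule cobar_linear_image[OF linear_snd graded_C c c w y' refl]) simp
  also have "bar_sum \<mu>A w (\<lambda>v. snd (?c v ?y)) = bar_sum \<mu>A w (\<lambda>v. signed (shdeg w) (cG v y))"
  proof (rule bar_sum_cong[OF w])
    fix v assume "bar_step A w v"
    hence v: "v \<in> lists (homog A)" "shdeg v = shdeg w - 1" by (auto simp: bar_step_def)
    show "snd (?c v ?y) = signed (shdeg w) (cG v y)"
      unfolding cone_op_inr[OF v(1)] cG_def v(2) by (simp add: signed_def)
  qed
  also have "cut_sum w (\<lambda>x z. signed (shdeg x) (snd (?c x (act ?c z ?y)))) =
      cut_sum w (\<lambda>x z. signed (shdeg w) (signed (shdeg x) (cG x (act cG z y))))"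
  proof (rule cut_sum_cong)
    fix x z assume xz: "w = x @ z"
    have x: "x \<in> lists (homog A)" and z: "z \<in> lists (homog A)" using w xz by auto
    have "snd (?c x (act ?c z ?y)) = signed (shdeg z + 1) (snd (\<nu> x (act cG z y)))"
      by (simp add: outer[OF z] inner[OF x z])
    also have "snd (\<nu> x (act cG z y)) = signed (shdeg x + 1) (cG x (act cG z y))"
      by (simp add: cG_def signed_def)
    finally show "signed (shdeg x) (snd (?c x (act ?c z ?y))) =
        signed (shdeg w) (signed (shdeg x) (cG x (act cG z y)))"
      by (auto intro!: signed_cong simp: xz)
  qed
  finally show "cobar \<mu>A cG cG w y = 0"
    by (simp only: bar_sum_signed cut_sum_signed signed_plus[symmetric] cobar_def[symmetric])
      (metis signed_eq_0_iff)
  \<comment> \<open>The component in \<open>M\<close>: up to an overall sign, the difference of the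
    two sides of the morphism relation.\<close>
  have "0 = fst (cobar \<mu>A ?c ?c w ?y)" using flat by (simp add: curvature_def)
  also have "\<dots> = bar_sum \<mu>A w (\<lambda>v. fst (?c v ?y)) +
      cut_sum w (\<lambda>x z. signed (shdeg x) (fst (?c x (act ?c z ?y))))"
    by (rule cobar_linear_image[OF linear_fst graded_C c c w y' refl])
  also have "bar_sum \<mu>A w (\<lambda>v. fst (?c v ?y)) = bar_sum \<mu>A w (\<lambda>v. signed (shdeg w + 1) (p v y))"
  proof (rule bar_sum_cong[OF w])
    fix v assume "bar_step A w v"
    hence v: "v \<in> lists (homog A)" "shdeg v = shdeg w - 1" by (auto simp: bar_step_def)
    show "fst (?c v ?y) = signed (shdeg w + 1) (p v y)"
      unfolding cone_op_inr[OF v(1)] p_def v(2) by (simp add: signed_def)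
  qed
  also have "cut_sum w (\<lambda>x z. signed (shdeg x) (fst (?c x (act ?c z ?y)))) =
      cut_sum w (\<lambda>x z. signed (shdeg w) (cM x (shdeg z + fst y, p z y)) +
        signed (shdeg w + 1) (signed (shdeg x) (p x (act cG z y))))"
  proof (rule cut_sum_cong)
    fix x z assume xz: "w = x @ z"
    have x: "x \<in> lists (homog A)" and z: "z \<in> lists (homog A)" using w xz by auto
    have "fst (?c x (act ?c z ?y)) = signed (shdeg z) (cM x (shdeg z + fst y, p z y)) +
        signed (shdeg z + 1) (fst (\<nu> x (act cG z y)))"
      by (simp add: outer[OF z] inner[OF x z] inner'[OF x z])
    also have "fst (\<nu> x (act cG z y)) = signed (shdeg x) (p x (act cG z y))"
      by (simp add: p_def signed_def)
    finally show "signed (shdeg x) (fst (?c x (act ?c z ?y))) =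
        signed (shdeg w) (cM x (shdeg z + fst y, p z y)) +
        signed (shdeg w + 1) (signed (shdeg x) (p x (act cG z y)))"
      by (auto intro!: arg_cong2[of _ _ _ _ "(+)"] signed_cong simp: xz)
  qed
  finally have "0 = bar_sum \<mu>A w (\<lambda>v. signed (shdeg w + 1) (p v y)) +
      cut_sum w (\<lambda>x z. signed (shdeg w) (cM x (shdeg z + fst y, p z y)) +
        signed (shdeg w + 1) (signed (shdeg x) (p x (act cG z y))))" .
  moreover have neg: "signed (shdeg w + 1) x = - signed (shdeg w) x" for x :: 'm
    by (rule signed_opposite) simp
  moreover have "bar_sum \<mu>A w (\<lambda>v. signed (shdeg w + 1) (p v y)) +
      cut_sum w (\<lambda>x z. signed (shdeg w) (cM x (shdeg z + fst y, p z y)) +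
        signed (shdeg w + 1) (signed (shdeg x) (p x (act cG z y)))) =
      signed (shdeg w) (cut_sum w (\<lambda>x z. cM x (shdeg z + fst y, p z y)) - cobar \<mu>A cG p w y)"
    by (simp only: bar_sum_signed cut_sum_signed cut_sum_add cobar_def, simp only: neg,
        simp only: diff_conv_add_uminus signed_plus signed_minus minus_add_distrib ac_simps)
  ultimately show "cobar \<mu>A cG p w y = cut_sum w (\<lambda>x z. cM x (shdeg z + fst y, p z y))"
    using signed_eq_0_iff[of "shdeg w" "cut_sum w (\<lambda>x z. cM x (shdeg z + fst y, p z y)) - cobar \<mu>A cG p w y"]
    by simp
qed

section \<open>Constructing the operations level by level\<close>

definition base :: "int \<times> 'g \<Rightarrow> 'm \<times> 'g" where
  "base y = (\<epsilon>1 y, - dG y)"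

definition dC :: "int \<Rightarrow> 'm \<times> 'g \<Rightarrow> 'm \<times> 'g" where
  "dC k x = (\<mu>M [] (k, fst x) + \<epsilon>1 (k - 1, snd x), - dG (k - 1, snd x))"

definition Z :: "int \<Rightarrow> ('m \<times> 'g) set" where
  "Z k = {x \<in> C k. dC k x = 0}"

lemma linear_dG: "k = j - 1 \<Longrightarrow> linear_on sG (G j) sG (G k) (\<lambda>g. dG (j, g))"
  using G_complex by (simp add: chain_complex_def graded_map_def)

lemma dG_dG: "g \<in> G j \<Longrightarrow> dG (j - 1, dG (j, g)) = 0"
  using G_complex by (simp add: chain_complex_def)

lemma linear_\<epsilon>1: "linear_on sG (G j) sM (M j) (\<lambda>g. \<epsilon>1 (j, g))"
  using quasi_iso by (simp add: quasi_isomorphism_def chain_map_def graded_map_def)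

lemma \<epsilon>1_chain: "g \<in> G j \<Longrightarrow> \<mu>M [] (j, \<epsilon>1 (j, g)) = \<epsilon>1 (j - 1, dG (j, g))"
  using quasi_iso by (simp add: quasi_isomorphism_def chain_map_def)

lemma linear_\<mu>M1: "k = j - 1 \<Longrightarrow> linear_on sM (M j) sM (M k) (\<lambda>m. \<mu>M [] (j, m))"
  using cochain_linear[OF cochain_cM, of "[]" k j] by (simp add: susp_def)

lemma \<mu>M1_\<mu>M1: "m \<in> M j \<Longrightarrow> \<mu>M [] (j - 1, \<mu>M [] (j, m)) = 0"
  using cM_square[of "[]" "(j, m)"] by (simp add: cobar_def act_def susp_def homog_iff)

lemma linear_base: "linear_on sG (G j) sC (C j) (\<lambda>g. base (j, g))"
proof -
  have 1: "linear_on sG (G j) sC (C j) (\<lambda>g. (\<epsilon>1 (j, g), 0))"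
    by (rule linear_on_comp[OF linear_\<epsilon>1 linear_inl])
  have 2: "linear_on sG (G j) sC (C j) (\<lambda>g. (0, - dG (j, g)))"
    by (rule linear_on_comp[OF linear_on_uminus[OF qsubmodule_G linear_dG[OF refl]] linear_inr]) simp
  from linear_on_plus[OF qsubmodule_C 1 2] show ?thesis by (simp add: base_def)
qed

lemma linear_dC: "l = k - 1 \<Longrightarrow> linear_on sC (C k) sC (C l) (dC k)"
proof -
  assume l: "l = k - 1"
  have 1: "linear_on sC (C k) sC (C l) (\<lambda>x. (\<mu>M [] (k, fst x), 0))"
    by (rule linear_on_comp[OF linear_on_comp[OF linear_fst linear_\<mu>M1[OF l]] linear_inl])
  have 2: "linear_on sC (C k) sC (C l) (\<lambda>x. base (l, snd x))"
    by (rule linear_on_comp[OF linear_snd[OF l] linear_base])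
  from linear_on_plus[OF qsubmodule_C 1 2] show ?thesis
    by (simp add: base_def dC_def[abs_def] l)
qed

lemma dC_base:
  assumes "g \<in> G j" shows "dC j (base (j, g)) = 0"
proof -
  have dg: "dG (j, g) \<in> G (j - 1)" by (rule linear_on_mem[OF linear_dG[OF refl] assms])
  show ?thesis
    using dG_dG[OF assms] \<epsilon>1_chain[OF assms]
    by (simp add: dC_def base_def zero_prod_def linear_on_minus[OF linear_\<epsilon>1 qsubmodule_G dg]
        linear_on_minus[OF linear_dG[OF refl] qsubmodule_G dg])
qed

text \<open>Injectivity on homology in terms of elements: the class of \<open>g\<close> and the
  class of \<open>0\<close> have the same image, hence coincide.\<close>

lemma homology_injective:
  assumes "g \<in> G j" "dG (j, g) = 0" "m \<in> M (j + 1)" "\<epsilon>1 (j, g) = \<mu>M [] (j + 1, m)"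
  shows "\<exists>h\<in>G (j + 1). dG (j + 1, h) = g"
proof -
  let ?H = "homology_map M (\<mu>M []) \<epsilon>1 j"
  have inj: "inj_on ?H (homology G dG j)"
    using quasi_iso by (simp add: quasi_isomorphism_def bij_betw_def)
  have lM: "linear_on sM (M (j + 1)) sM (M j) (\<lambda>m. \<mu>M [] (j + 1, m))" by (rule linear_\<mu>M1) simp
  have lG: "linear_on sG (G (j + 1)) sG (G j) (\<lambda>g. dG (j + 1, g))" by (rule linear_dG) simp
  \<comment> \<open>The class of a boundary is the set of all boundaries.\<close>
  have bM: "homology_class M (\<mu>M []) j (\<mu>M [] (j + 1, m)) = boundaries M (\<mu>M []) j" if "m \<in> M (j + 1)" for m
  proof -
    have "\<exists>y\<in>M (j + 1). \<mu>M [] (j + 1, x) = \<mu>M [] (j + 1, m) + \<mu>M [] (j + 1, y)" if "x \<in> M (j + 1)" for x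
      using qsubmodule_diff[OF qsubmodule_M that \<open>m \<in> _\<close>] linear_on_diff[OF lM qsubmodule_M that \<open>m \<in> _\<close>]
      by (intro bexI[of _ "x - m"]) auto
    moreover have "\<exists>y\<in>M (j + 1). \<mu>M [] (j + 1, y) = \<mu>M [] (j + 1, m) + \<mu>M [] (j + 1, x)" if "x \<in> M (j + 1)" for x
      using qsubmodule_add[OF qsubmodule_M \<open>m \<in> _\<close> that] linear_on_add[OF lM \<open>m \<in> _\<close> that] by auto
    ultimately show ?thesis
      unfolding homology_class_def boundaries_def image_image by (auto simp: image_iff) metis+
  qed
  have H: "?H (homology_class G dG j z) = boundaries M (\<mu>M []) j"
    if z: "z \<in> G j" "\<exists>m\<in>M (j + 1). \<epsilon>1 (j, z) = \<mu>M [] (j + 1, m)" for z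
  proof -
    have "homology_class M (\<mu>M []) j (\<epsilon>1 (j, z + dG (j + 1, h))) = boundaries M (\<mu>M []) j"
      if h: "h \<in> G (j + 1)" for h
    proof -
      obtain m where m: "m \<in> M (j + 1)" "\<epsilon>1 (j, z) = \<mu>M [] (j + 1, m)" using z(2) by blast
      have e: "\<epsilon>1 (j + 1, h) \<in> M (j + 1)" by (rule linear_on_mem[OF linear_\<epsilon>1 h])
      have "\<epsilon>1 (j, z + dG (j + 1, h)) = \<mu>M [] (j + 1, m) + \<mu>M [] (j + 1, \<epsilon>1 (j + 1, h))"
        using linear_on_add[OF linear_\<epsilon>1 z(1) linear_on_mem[OF lG h]] m(2) \<epsilon>1_chain[OF h] by simp
      also have "\<dots> = \<mu>M [] (j + 1, m + \<epsilon>1 (j + 1, h))"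
        by (rule linear_on_add[OF lM m(1) e, symmetric])
      finally show ?thesis using bM[OF qsubmodule_add[OF qsubmodule_M m(1) e]] by simp
    qed
    moreover have "homology_class G dG j z \<noteq> {}"
      using qsubmodule_zero[OF qsubmodule_G] by (auto simp: homology_class_def boundaries_def)
    ultimately show ?thesis
      unfolding homology_map_def by (auto simp: homology_class_def[of G] boundaries_def[of G])
  qed
  have z0: "linear_on sG (G j) sM (M j) (\<lambda>g. \<epsilon>1 (j, g))" by (rule linear_\<epsilon>1)
  have "?H (homology_class G dG j g) = ?H (homology_class G dG j 0)"
    using H[OF assms(1)] assms(3,4) H[of 0] qsubmodule_zero[OF qsubmodule_G] qsubmodule_zero[OF qsubmodule_M]
      linear_on_0[OF lM qsubmodule_M] linear_on_0[OF z0 qsubmodule_G]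
    by metis
  moreover have "homology_class G dG j x \<in> homology G dG j" if "x \<in> G j" "dG (j, x) = 0" for x
    using that by (simp add: homology_def cycles_def)
  ultimately have "homology_class G dG j g = homology_class G dG j 0"
    using inj assms(1,2) qsubmodule_zero[OF qsubmodule_G] linear_on_0[OF linear_dG[OF refl] qsubmodule_G]
    by (metis inj_onD)
  moreover have "g \<in> homology_class G dG j g"
    using qsubmodule_zero[OF qsubmodule_G] linear_on_0[OF lG qsubmodule_G]
    by (auto simp: homology_class_def boundaries_def image_iff intro!: bexI[of _ 0])
  ultimately show ?thesis by (auto simp: homology_class_def boundaries_def)
qed

text \<open>Surjectivity on homology in terms of elements. The induced map is a union over
  representatives, so the representative found is \<open>z\<close> plus a boundary, and this sum is
  the witness.\<close>

lemma homology_surjective: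
  assumes m: "m \<in> M j" "\<mu>M [] (j, m) = 0"
  shows "\<exists>z\<in>G j. \<exists>n\<in>M (j + 1). dG (j, z) = 0 \<and> m = \<epsilon>1 (j, z) + \<mu>M [] (j + 1, n)"
proof -
  let ?H = "homology_map M (\<mu>M []) \<epsilon>1 j"
  have lM: "linear_on sM (M (j + 1)) sM (M j) (\<lambda>m. \<mu>M [] (j + 1, m))" by (rule linear_\<mu>M1) simp
  have lG: "linear_on sG (G (j + 1)) sG (G j) (\<lambda>g. dG (j + 1, g))" by (rule linear_dG) simp
  have "?H ` homology G dG j = homology M (\<mu>M []) j"
    using quasi_iso by (simp add: quasi_isomorphism_def bij_betw_def)
  hence "homology_class M (\<mu>M []) j m \<in> ?H ` homology G dG j"
    using m by (simp add: homology_def cycles_def)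
  then obtain z where z: "z \<in> G j" "dG (j, z) = 0"
    "homology_class M (\<mu>M []) j m = ?H (homology_class G dG j z)"
    unfolding homology_def cycles_def by blast
  have "m \<in> homology_class M (\<mu>M []) j m"
    using qsubmodule_zero[OF qsubmodule_M] linear_on_0[OF lM qsubmodule_M]
    by (auto simp: homology_class_def boundaries_def image_iff intro!: bexI[of _ 0])
  then obtain h n where h: "h \<in> G (j + 1)" and n: "n \<in> M (j + 1)"
    and eq: "m = \<epsilon>1 (j, z + dG (j + 1, h)) + \<mu>M [] (j + 1, n)"
    unfolding z(3) homology_map_def by (auto simp: homology_class_def boundaries_def)
  have d: "dG (j + 1, h) \<in> G j" by (rule linear_on_mem[OF lG h])
  have "dG (j, z + dG (j + 1, h)) = 0"
    using linear_on_add[OF linear_dG[OF refl] z(1) d] z(2) dG_dG[OF h] by simp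
  with eq n qsubmodule_add[OF qsubmodule_G z(1) d] show ?thesis by blast
qed

text \<open>
  If \<open>\<epsilon>1\<close> is surjective, a primitive \<open>(m, h)\<close> is turned into one with vanishing first component
  by subtracting the boundary of a lift of \<open>m\<close>.
\<close>

lemma cone_exact:
  assumes z: "z \<in> Z k" shows "\<exists>x\<in>C' (k + 1). dC (k + 1) x = z"
proof -
  obtain m g where mg: "z = (m, g)" by (cases z)
  have m: "m \<in> M k" and g: "g \<in> G (k - 1)" and d: "\<mu>M [] (k, m) + \<epsilon>1 (k - 1, g) = 0" "dG (k - 1, g) = 0"
    using z by (auto simp: Z_def C_def dC_def mg zero_prod_def)
  have lM: "linear_on sM (M (k + 1)) sM (M k) (\<lambda>m. \<mu>M [] (k + 1, m))" by (rule linear_\<mu>M1) simp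
  have lG: "linear_on sG (G (k + 1)) sG (G k) (\<lambda>g. dG (k + 1, g))" by (rule linear_dG) simp
  have lMk: "linear_on sM (M k) sM (M (k - 1)) (\<lambda>m. \<mu>M [] (k, m))" by (rule linear_\<mu>M1) simp
  \<comment> \<open>Since \<open>z\<close> is a cycle, the image of \<open>g\<close> is the boundary
    of \<open>- m\<close>, so \<open>g\<close> bounds some \<open>h\<close>.\<close>
  have "\<epsilon>1 (k - 1, g) = \<mu>M [] (k - 1 + 1, - m)"
    using minus_unique[OF d(1)] linear_on_minus[OF lMk qsubmodule_M m] by simp
  from homology_injective[OF g d(2) _ this] qsubmodule_minus[OF qsubmodule_M m]
  obtain h where h: "h \<in> G k" "dG (k, h) = g" by auto
  have eh: "\<epsilon>1 (k, h) \<in> M k" by (rule linear_on_mem[OF linear_\<epsilon>1 h(1)])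
  \<comment> \<open>Adding the image of \<open>h\<close> turns \<open>m\<close> into a cycle, which
    therefore comes from a cycle \<open>y\<close> of \<open>G\<close> up to a boundary. The
    primitive of \<open>z\<close> will be \<open>(n, y - h)\<close>.\<close>
  have "\<mu>M [] (k, m + \<epsilon>1 (k, h)) = 0"
    using linear_on_add[OF lMk m eh] \<epsilon>1_chain[OF h(1)] d(1) h(2) by simp
  from homology_surjective[OF qsubmodule_add[OF qsubmodule_M m eh] this]
  obtain y n where y: "y \<in> G k" "dG (k, y) = 0" and n: "n \<in> M (k + 1)"
    and eq: "m + \<epsilon>1 (k, h) = \<epsilon>1 (k, y) + \<mu>M [] (k + 1, n)" by blast
  have yh: "y - h \<in> G k" by (rule qsubmodule_diff[OF qsubmodule_G y(1) h(1)])
  have "\<mu>M [] (k + 1, n) = m + \<epsilon>1 (k, h) - \<epsilon>1 (k, y)"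
    using eq by (simp add: algebra_simps)
  hence "dC (k + 1) (n, y - h) = z"
    by (simp add: dC_def mg linear_on_diff[OF linear_\<epsilon>1 qsubmodule_G y(1) h(1)]
        linear_on_diff[OF linear_dG[OF refl] qsubmodule_G y(1) h(1)] y(2) h(2))
  show ?thesis
  proof (cases "degreewise_surjective G M \<epsilon>1")
    case False
    with \<open>dC (k + 1) (n, y - h) = z\<close> n yh show ?thesis by (intro bexI) (auto simp: C'_def)
  next
    case True
    hence "n \<in> (\<lambda>x. \<epsilon>1 (k + 1, x)) ` G (k + 1)" using n by (simp add: degreewise_surjective_def)
    then obtain l where l: "l \<in> G (k + 1)" "\<epsilon>1 (k + 1, l) = n" by blast
    have dl: "dG (k + 1, l) \<in> G k" by (rule linear_on_mem[OF lG l(1)])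
    have "dC (k + 1) (0, y - h + dG (k + 1, l)) = dC (k + 1) (n, y - h)"
      using linear_on_add[OF linear_\<epsilon>1 yh dl] linear_on_add[OF linear_dG[OF refl] yh dl]
        \<epsilon>1_chain[OF l(1)] dG_dG[OF l(1)] l(2) linear_on_0[OF lM qsubmodule_M]
      by (simp add: dC_def algebra_simps)
    with \<open>dC (k + 1) (n, y - h) = z\<close> qsubmodule_add[OF qsubmodule_G yh dl] True show ?thesis
      by (intro bexI[of _ "(0, y - h + dG (k + 1, l))"]) (auto simp: C'_def)
  qed
qed

text \<open>The arguments at which values of \<open>\<nu>\<close>, other than the one at
  \<open>w\<close> and \<open>y\<close>, enter the curvature at \<open>w\<close> and
  \<open>y\<close>. In equal arity a differential has been applied to one argument, hence the drop
  by one.\<close>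

definition earlier :: "(int \<times> 'a) list \<Rightarrow> int \<times> 'g \<Rightarrow> (int \<times> 'a) list \<Rightarrow> int \<times> 'g \<Rightarrow> bool" where
  "earlier v x w y \<longleftrightarrow> v \<in> lists (homog A) \<and> x \<in> homog G \<and>
     (length v < length w \<or> length v = length w \<and> deg v + fst x = deg w + fst y - 1)"

lemma earlier_bar_step: "bar_step A w v \<Longrightarrow> y \<in> homog G \<Longrightarrow> earlier v y w y"
  by (auto simp: bar_step_def earlier_def shdeg_def)

lemma cone_op_Nil: "\<nu> [] = base \<Longrightarrow> cone_op \<nu> [] (k, x) = dC k x"
  by (simp add: cone_op_def dC_def base_def susp_def)

lemma snd_\<nu>_homog:
  assumes "cochain sA A sG G sC C 0 \<nu>" "z \<in> lists (homog A)" "y \<in> homog G"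
  shows "(shdeg z + fst y - 1, snd (\<nu> z y)) \<in> homog G"
  using cochain_mem[OF assms refl] by (auto simp: C_def homog_iff)

text \<open>The cut with empty left piece contributes \<open>dC\<close> of the value at
  \<open>w\<close> and \<open>y\<close>; all other terms use earlier values. So the curvature is
  affine in the unknown value, with linear part \<open>dC\<close>.\<close>

lemma curvature_local:
  assumes \<nu>: "cochain sA A sG G sC C 0 \<nu>" "\<nu> [] = base"
    and \<nu>': "cochain sA A sG G sC C 0 \<nu>'" "\<nu>' [] = base"
    and w: "w \<in> lists (homog A)" "w \<noteq> []" and y: "y \<in> homog G"
    and agree: "\<And>v x. earlier v x w y \<Longrightarrow> \<nu> v x = \<nu>' v x"
  shows "curvature \<nu> w y - dC (shdeg w + fst y) (\<nu> w y) =
     curvature \<nu>' w y - dC (shdeg w + fst y) (\<nu>' w y)"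
proof -
  obtain a w' where aw: "w = a # w'" using w(2) by (cases w) auto
  let ?y = "(fst y + 1, (0, snd y)) :: int \<times> 'm \<times> 'g"
  define rest where "rest \<nu> = bar_sum \<mu>A w (\<lambda>v. \<nu> v y) +
      cut_sum w' (\<lambda>x z. signed (shdeg (a # x)) (cone_op \<nu> (a # x) (shdeg z + fst y, \<nu> z y)))" for \<nu>
  have exp: "curvature \<nu> w y - dC (shdeg w + fst y) (\<nu> w y) = rest \<nu>"
    if "\<nu> [] = base" for \<nu>
  proof -
    have "bar_sum \<mu>A w (\<lambda>v. cone_op \<nu> v ?y) = bar_sum \<mu>A w (\<lambda>v. \<nu> v y)"
      by (rule bar_sum_cong[OF w(1)]) (simp add: bar_step_def cone_op_inr)
    moreover have "cut_sum w' (\<lambda>x z. signed (shdeg (a # x)) (cone_op \<nu> (a # x) (act (cone_op \<nu>) z ?y))) =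
        cut_sum w' (\<lambda>x z. signed (shdeg (a # x)) (cone_op \<nu> (a # x) (shdeg z + fst y, \<nu> z y)))"
      by (rule cut_sum_cong) (use w aw in \<open>simp add: act_cone_op_inr\<close>)
    moreover have "cone_op \<nu> [] (act (cone_op \<nu>) w ?y) = dC (shdeg w + fst y) (\<nu> w y)"
      by (simp add: act_cone_op_inr[OF w(1)] cone_op_Nil[of \<nu>, OF that])
    ultimately show ?thesis by (simp add: curvature_def cobar_def aw rest_def)
  qed
  have "rest \<nu> = rest \<nu>'"
    unfolding rest_def
  proof (intro arg_cong2[of _ _ _ _ "(+)"] bar_sum_cong[OF w(1)] cut_sum_cong)
    fix v assume "bar_step A w v"
    thus "\<nu> v y = \<nu>' v y" by (intro agree earlier_bar_step y)
  next
    fix x z assume xz: "w' = x @ z"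
    have x: "a # x \<in> lists (homog A)" and z: "z \<in> lists (homog A)" using w aw xz by auto
    have 1: "\<nu> z y = \<nu>' z y" by (rule agree) (use z y aw xz in \<open>simp add: earlier_def\<close>)
    \<comment> \<open>The outer word is shorter than \<open>w\<close> unless \<open>z\<close> is
      empty; then the inner operation is \<open>base\<close>, and the element of \<open>G\<close>
      has dropped by one degree.\<close>
    have "\<nu> (a # x) (shdeg z + fst y - 1, snd (\<nu> z y)) = \<nu>' (a # x) (shdeg z + fst y - 1, snd (\<nu> z y))"
      by (rule agree)
        (use x snd_\<nu>_homog[OF \<nu>(1) z y] aw xz in \<open>cases z; auto simp: earlier_def\<close>)
    thus "signed (shdeg (a # x)) (cone_op \<nu> (a # x) (shdeg z + fst y, \<nu> z y)) =
        signed (shdeg (a # x)) (cone_op \<nu>' (a # x) (shdeg z + fst y, \<nu>' z y))"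
      by (simp add: cone_op_def 1)
  qed
  thus ?thesis using exp[of \<nu>, OF \<nu>(2)] exp[of \<nu>', OF \<nu>'(2)] by simp
qed

text \<open>In the Bianchi identity one side contains the curvature at earlier arguments only. On
  the other side it appears at the right pieces of the cuts of \<open>w\<close>, and all proper ones
  are shorter; what is left is \<open>dC\<close> of the curvature.\<close>

lemma curvature_cycle:
  assumes \<nu>: "cochain sA A sG G sC C 0 \<nu>" "\<nu> [] = base"
    and w: "w \<in> lists (homog A)" and y: "y \<in> homog G"
    and flat: "\<And>v x. earlier v x w y \<Longrightarrow> curvature \<nu> v x = 0"
  shows "curvature \<nu> w y \<in> Z (shdeg w + fst y - 1)"
proof -
  let ?c = "cone_op \<nu>" and ?y = "(fst y + 1, (0, snd y)) :: int \<times> 'm \<times> 'g"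
  note c = cochain_cone_op[OF \<nu>(1)] and y' = inr_homog[OF y]
  have "cobar \<mu>A ?c (cobar \<mu>A ?c ?c) w ?y = 0"
  proof -
    have "bar_sum \<mu>A w (\<lambda>v. cobar \<mu>A ?c ?c v ?y) = 0"
      by (rule bar_sum_zero[OF w]) (use flat earlier_bar_step y in \<open>auto simp: curvature_def\<close>)
    moreover have "cut_sum w (\<lambda>x z. signed (shdeg x) (cobar \<mu>A ?c ?c x (act ?c z ?y))) = 0"
    proof (rule cut_sum_zero)
      fix x z assume xz: "w = x @ z"
      have x: "x \<in> lists (homog A)" and z: "z \<in> lists (homog A)" using w xz by auto
      have "cobar \<mu>A ?c ?c x (act ?c z ?y) = curvature \<nu> x (shdeg z + fst y - 1, snd (\<nu> z y))"
        using cobar_cone_eq_curvature[OF \<nu>(1) x act_homog[OF c z y']]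
        by (simp add: act_cone_op_inr[OF z])
      also have "\<dots> = 0"
        by (rule flat) (use x snd_\<nu>_homog[OF \<nu>(1) z y] xz in \<open>cases z; auto simp: earlier_def\<close>)
      finally show "signed (shdeg x) (cobar \<mu>A ?c ?c x (act ?c z ?y)) = 0" by simp
    qed
    ultimately show ?thesis by (simp add: cobar_def[of _ _ "cobar \<mu>A ?c ?c"])
  qed
  also have "cobar \<mu>A ?c (cobar \<mu>A ?c ?c) w ?y =
      cut_sum w (\<lambda>x z. ?c x (shdeg z + fst ?y - 2, cobar \<mu>A ?c ?c z ?y))"
    by (rule cobar_square[OF c c graded_C w y'])
  also have "\<dots> = ?c [] (shdeg w + fst ?y - 2, cobar \<mu>A ?c ?c w ?y)"
  proof (rule cut_sum_first)
    fix x z assume xz: "w = x @ z" "x \<noteq> []"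
    have x: "x \<in> lists (homog A)" and z: "z \<in> lists (homog A)" using w xz by auto
    have "cobar \<mu>A ?c ?c z ?y = 0"
      using flat[of z y] z y xz by (simp add: earlier_def curvature_def)
    thus "?c x (shdeg z + fst ?y - 2, cobar \<mu>A ?c ?c z ?y) = 0"
      using linear_on_0[OF cochain_linear[OF c x refl] qsubmodule_C] by simp
  qed
  also have "\<dots> = dC (shdeg w + fst y - 1) (curvature \<nu> w y)"
    by (simp add: cone_op_Nil[of \<nu>, OF \<nu>(2)] curvature_def)
  finally show ?thesis
    using cochain_mem[OF cochain_curvature[OF \<nu>(1)] w y refl] by (simp add: Z_def)
qed

text \<open>The total degree lies below the sum of the lower bounds of all arguments, so some
  argument lives in a zero module.\<close>

definition low :: "(int \<times> 'a) list \<Rightarrow> int \<times> 'g \<Rightarrow> bool" where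
  "low w y \<longleftrightarrow> deg w + fst y < int (length w) * a0 + g0"

lemma low_zero:
  assumes \<phi>: "cochain sA A sG G sN N d \<phi>" and w: "w \<in> lists (homog A)" and y: "y \<in> homog G"
    and low: "low w y"
  shows "\<phi> w y = 0"
proof (cases "fst y < g0")
  case True
  hence "y = (fst y, 0)" using homogD[OF y] G_bounded by (metis prod.collapse singletonD)
  thus ?thesis using linear_on_0[OF cochain_linear[OF \<phi> w refl] qsubmodule_G] by metis
next
  case False
  have "int (length v) * a0 \<le> deg v" if "\<forall>a\<in>set v. a0 \<le> fst a" for v :: "(int \<times> 'a) list"
    using that by (induction v) (auto simp: algebra_simps)
  hence "\<exists>a\<in>set w. fst a < a0" using False low by (force simp: low_def)
  then obtain us a ws where aw: "w = us @ a # ws" "fst a < a0" by (metis split_list)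
  hence "a = (fst a, 0)" using w homogD[of a A] A_bounded by (metis (no_types) append_in_lists_conv
        Cons_in_lists_iff prod.collapse singletonD)
  thus ?thesis using cochain_zero[OF \<phi> _ _ y, of us ws "fst a"] w aw(1) by auto
qed

text \<open>Arity first, then total degree. The second measure is \<open>0\<close> below the bound
  of \<open>low\<close> and positive from there on; this cut-off makes the order well-founded
  although total degrees range over all integers.\<close>

definition level_less :: "((nat \<times> int) \<times> (nat \<times> int)) set" where
  "level_less = inv_image (less_than <*lex*> less_than)
     (\<lambda>(n, m). (n, nat (m - (int n * a0 + g0) + 1)))"

definition level :: "(int \<times> 'a) list \<Rightarrow> int \<times> 'g \<Rightarrow> nat \<times> int" where
  "level w y = (length w, deg w + fst y)"

lemma wf_level_less: "wf level_less"
  unfolding level_less_def by (intro wf_inv_image wf_lex_prod wf_less_than)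

lemma trans_level_less: "trans level_less"
  unfolding level_less_def by (intro trans_inv_image trans_lex_prod trans_less_than)

text \<open>The order identifies all levels below the bound, hence the exception; there
  \<open>low_zero\<close> takes over.\<close>

lemma earlier_level: "earlier v x w y \<Longrightarrow> (level v x, level w y) \<in> level_less \<or> low v x"
  by (auto simp: earlier_def level_less_def level_def low_def)

text \<open>
  Prescribed part of the binary operation on \<open>G\<close>: it makes the unit act as the identity.
\<close>

definition unit_op :: "(int \<times> 'a) list \<Rightarrow> int \<times> 'g \<Rightarrow> 'm \<times> 'g" where
  "unit_op w y = (case w of [a] \<Rightarrow> if fst a = 0 then (0, sG (r (snd a)) (snd y)) else 0 | _ \<Rightarrow> 0)"

text \<open>At each level only the cochain chosen for that level is evaluated. The level depends on
  lengths and degrees, not on the elements, so the combination is multilinear again.\<close>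

definition assemble :: "(nat \<times> int \<Rightarrow> (int \<times> 'a) list \<Rightarrow> int \<times> 'g \<Rightarrow> 'm \<times> 'g) \<Rightarrow>
    (int \<times> 'a) list \<Rightarrow> int \<times> 'g \<Rightarrow> 'm \<times> 'g" where
  "assemble f w y = (if w = [] then base y else unit_op w y + f (level w y) w y)"

abbreviation higher :: "((int \<times> 'a) list \<Rightarrow> int \<times> 'g \<Rightarrow> 'm \<times> 'g) \<Rightarrow> bool" where
  "higher \<equiv> cochain sA A sG G sC C' 0"

lemma cochain_unit_op: "higher unit_op"
  unfolding cochain_def word_multilinear_def
proof (intro conjI ballI allI)
  interpret g: qmodule sG using graded_G by (simp add: graded_module_def)
  interpret m: qmodule sM using M.graded by (simp add: graded_module_def)
  note qC' = graded_module_qsubmodule[OF graded_C']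
  fix y us ws i assume y: "y \<in> homog G" and w: "us \<in> lists (homog A)" "ws \<in> lists (homog A)"
  show "linear_on sA (A i) sC (C' (shdeg us + (i + 1) + shdeg ws + 0 + fst y)) (\<lambda>a. unit_op (us @ (i, a) # ws) y)"
  proof (cases "us = [] \<and> ws = [] \<and> i = 0")
    case True
    have "linear_on (*) UNIV sC (C' (1 + fst y)) (\<lambda>q. (0, sG q (snd y)))"
      using homogD[OF y] qsubmodule_zero[OF qsubmodule_M] qsubmodule_scale[OF qsubmodule_G]
      by (auto simp: linear_on_def C'_def sC_def m.scale_zero_right g.scale_left_distrib g.scale_scale)
    from linear_on_comp[OF r_linear this] True show ?thesis by (simp add: unit_op_def)
  next
    case False
    hence "unit_op (us @ (i, a) # ws) y = 0" for a
      by (cases us; cases "tl us"; cases ws) (auto simp: unit_op_def split: list.split)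
    thus ?thesis by (simp add: linear_on_zero_map[OF qC'])
  qed
next
  interpret g: qmodule sG using graded_G by (simp add: graded_module_def)
  interpret m: qmodule sM using M.graded by (simp add: graded_module_def)
  note qC' = graded_module_qsubmodule[OF graded_C']
  fix w j assume "w \<in> lists (homog A)"
  show "linear_on sG (G j) sC (C' (shdeg w + j + 0)) (\<lambda>y. unit_op w (j, y))"
  proof (cases "\<exists>a. w = [(0, a)]")
    case True
    then obtain a where w: "w = [(0, a)]" by blast
    show ?thesis
      using qsubmodule_zero[OF qsubmodule_M] qsubmodule_scale[OF qsubmodule_G]
      by (auto simp: w unit_op_def linear_on_def C'_def sC_def m.scale_zero_right
          g.scale_right_distrib g.scale_scale mult.commute)
  next
    case False
    hence "unit_op w (j, y) = 0" for y by (auto simp: unit_op_def split: list.split)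
    thus ?thesis by (simp add: linear_on_zero_map[OF qC'])
  qed
qed

section \<open>Cochains assembled from levels and their curvature\<close>

lemma assemble_Nil: "assemble f [] = base"
  by (rule ext) (simp add: assemble_def)

lemma cochain_assemble:
  assumes f: "\<And>z. higher (f z)" shows "cochain sA A sG G sC C 0 (assemble f)"
proof -
  have fC: "cochain sA A sG G sC C 0 (f z)" for z by (rule cochain_mono[OF f C'_subset])
  have uC: "cochain sA A sG G sC C 0 unit_op" by (rule cochain_mono[OF cochain_unit_op C'_subset])
  show ?thesis
    unfolding cochain_def word_multilinear_def
  proof (intro conjI ballI allI)
    fix y us ws i assume y: "y \<in> homog G" and w: "us \<in> lists (homog A)" "ws \<in> lists (homog A)"
    have l: "level (us @ (i, a) # ws) y = level (us @ (i, 0) # ws) y" for a by (simp add: level_def)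
    have "linear_on sA (A i) sC (C (shdeg us + (i + 1) + shdeg ws + 0 + fst y))
        (\<lambda>a. unit_op (us @ (i, a) # ws) y + f (level (us @ (i, 0) # ws) y) (us @ (i, a) # ws) y)"
      by (intro linear_on_plus[OF qsubmodule_C] cochain_slot[OF uC y w] cochain_slot[OF fC y w]) simp_all
    moreover have "assemble f (us @ (i, a) # ws) y =
        unit_op (us @ (i, a) # ws) y + f (level (us @ (i, 0) # ws) y) (us @ (i, a) # ws) y" for a
      using l[of a] by (simp add: assemble_def)
    ultimately show "linear_on sA (A i) sC (C (shdeg us + (i + 1) + shdeg ws + 0 + fst y))
        (\<lambda>a. assemble f (us @ (i, a) # ws) y)" by simp
  next
    fix w j assume w: "w \<in> lists (homog A)"
    show "linear_on sG (G j) sC (C (shdeg w + j + 0)) (\<lambda>y. assemble f w (j, y))"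
    proof (cases "w = []")
      case True thus ?thesis by (simp add: assemble_def linear_base)
    next
      case False
      have "linear_on sG (G j) sC (C (shdeg w + j + 0))
          (\<lambda>y. unit_op w (j, y) + f (length w, deg w + j) w (j, y))"
        by (intro linear_on_plus[OF qsubmodule_C] cochain_linear[OF uC w] cochain_linear[OF fC w]) simp_all
      thus ?thesis using False by (simp add: assemble_def level_def)
    qed
  qed
qed

lemma assemble_agree:
  assumes f: "\<And>z. higher (f z)" and g: "\<And>z. higher (g z)"
    and agree: "\<And>z. (z, level w y) \<in> level_less \<Longrightarrow> f z = g z"
    and "earlier v x w y"
  shows "assemble f v x = assemble g v x"
proof (cases "low v x")
  case True
  have v: "v \<in> lists (homog A)" "x \<in> homog G" using assms(4) by (simp_all add: earlier_def)
  show ?thesis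
    by (simp add: assemble_def low_zero[OF f v True] low_zero[OF g v True])
next
  case False
  with earlier_level[OF assms(4)] agree show ?thesis by (simp add: assemble_def)
qed

lemma curvature_assemble_cong:
  assumes f: "\<And>z. higher (f z)" and g: "\<And>z. higher (g z)"
    and agree: "\<And>z. (z, level w y) \<in> level_less \<Longrightarrow> f z = g z" "f (level w y) = g (level w y)"
    and w: "w \<in> lists (homog A)" "w \<noteq> []" and y: "y \<in> homog G"
  shows "curvature (assemble f) w y = curvature (assemble g) w y"
proof -
  have "assemble f w y = assemble g w y" by (simp add: assemble_def agree(2))
  thus ?thesis
    using curvature_local[OF cochain_assemble[of f, OF f] assemble_Nil
        cochain_assemble[of g, OF g] assemble_Nil w y assemble_agree[OF f g agree(1)]]
    by simp
qed

lemma curvature_assemble_Nil: "y \<in> homog G \<Longrightarrow> curvature (assemble f) [] y = 0"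
  using dC_base[OF homogD[of y G]]
  by (simp add: curvature_def cobar_def act_cone_op_inr cone_op_Nil[of "assemble f", OF assemble_Nil] assemble_Nil)

text \<open>With normalised corrections, \<open>unit_op\<close> makes the unit act as the identity
  on the cone, so \<open>normalised_cobar\<close> applies. For \<open>u = 0\<close> the claim is
  linearity.\<close>

lemma normalised_curvature_assemble:
  assumes f: "\<And>z. higher (f z)" "\<And>z. normalised G (f z)"
  shows "normalised G (curvature (assemble f))"
proof (cases "u = 0")
  case True
  have "curvature (assemble f) (us @ (0, u) # ws) y = 0"
    if "us \<in> lists (homog A)" "ws \<in> lists (homog A)" "y \<in> homog G" for us ws y
    using cochain_zero[OF cochain_curvature[OF cochain_assemble[of f, OF f(1)]] that, of 0] True by simp
  thus ?thesis unfolding normalised_def by blast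
next
  case False
  with unit have unit: "strict_unit" "strict_unit_action M \<mu>M" "r u = 1" by auto
  interpret g: qmodule sG using graded_G by (simp add: graded_module_def)
  have f0: "f z (us @ (0, u) # ws) y = 0"
    if "us \<in> lists (homog A)" "ws \<in> lists (homog A)" "y \<in> homog G" for z us ws y
    using f(2)[of z] that by (simp add: normalised_def)
  have "strict_unit_action C (cone_op (assemble f))"
    unfolding strict_unit_action_def
  proof (intro conjI ballI impI)
    fix y assume y: "y \<in> homog C"
    show "cone_op (assemble f) [(0, u)] y = snd y"
      using unit(2) homog_C_D[OF y] f0[of "[]" "[]"]
      by (simp add: cone_op_def assemble_def unit_op_def strict_unit_action_def susp_def unit(3)
          g.scale_one prod_eq_iff)
  next
    fix us ws y assume *: "us \<in> lists (homog A)" "ws \<in> lists (homog A)" "y \<in> homog C" "us @ ws \<noteq> []"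
    have "unit_op (us @ (0, u) # ws) x = 0" for x
      using *(4) by (cases us; cases "tl us"; cases ws) (auto simp: unit_op_def split: list.split)
    moreover have "cM (us @ (0, u) # ws) (fst y, fst (snd y)) = 0"
      using unit(2) homog_C_D(1)[OF *(3)] * unfolding strict_unit_action_def susp_def by simp
    ultimately show "cone_op (assemble f) (us @ (0, u) # ws) y = 0"
      using f0[OF *(1,2) homog_C_D(2)[OF *(3)]]
      by (simp add: cone_op_def assemble_def zero_prod_def)
  qed
  from normalised_cobar[OF unit(1) cochain_cone_op[OF cochain_assemble[of f, OF f(1)]] graded_C this]
  show ?thesis
    unfolding normalised_def curvature_def using inr_homog by blast
qed

text \<open>Forgets all choices that are not below \<open>x\<close>. The condition imposed on
  \<open>\<kappa>\<close> then depends on earlier choices only, as well-founded choice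
  requires.\<close>

definition truncate where
  "truncate f x \<kappa> = (\<lambda>z. if (z, x) \<in> level_less then f z else if z = x then \<kappa> else (\<lambda>_ _. 0))"
  for f :: "nat \<times> int \<Rightarrow> (int \<times> 'a) list \<Rightarrow> int \<times> 'g \<Rightarrow> 'm \<times> 'g"

definition flat_at where
  "flat_at f x \<kappa> \<longleftrightarrow> higher \<kappa> \<and> normalised G \<kappa> \<and>
     (\<forall>w\<in>lists (homog A). \<forall>y\<in>homog G. w \<noteq> [] \<longrightarrow> level w y = x \<longrightarrow>
        curvature (assemble (truncate f x \<kappa>)) w y = 0)"

lemma higher_truncate:
  "(\<And>z. (z, x) \<in> level_less \<Longrightarrow> higher (f z)) \<Longrightarrow> higher \<kappa> \<Longrightarrow> higher (truncate f x \<kappa> z)"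
  by (simp add: truncate_def cochain_zero_map[OF graded_C'])

text \<open>Curvature at level \<open>x\<close> involves only choices at and below \<open>x\<close>,
  so flatness achieved with truncated choices persists whatever is chosen later.\<close>

lemma flat_transfer:
  assumes f: "\<And>z. (z, x) \<in> level_less \<Longrightarrow> flat_at f z (f z)" "flat_at f x (f x)"
    and g: "\<And>z. higher (g z)" "\<And>z. (z, x) \<in> level_less \<Longrightarrow> f z = g z" "f x = g x"
    and w: "w \<in> lists (homog A)" "w \<noteq> []" and y: "y \<in> homog G" and x: "level w y = x"
  shows "curvature (assemble g) w y = 0"
proof -
  have "curvature (assemble (truncate f x (f x))) w y = curvature (assemble g) w y"
  proof (rule curvature_assemble_cong[OF _ g(1) _ _ w y])
    show "higher (truncate f x (f x) z)" for z
      by (rule higher_truncate) (use f in \<open>auto simp: flat_at_def\<close>)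
  qed (use g x in \<open>auto simp: truncate_def wf_not_refl[OF wf_level_less]\<close>)
  moreover have "curvature (assemble (truncate f x (f x))) w y = 0"
    using f(2) w y x by (simp add: flat_at_def)
  ultimately show ?thesis by simp
qed

text \<open>Starting from the correction \<open>0\<close> at level \<open>x\<close>, a correction
  \<open>\<kappa>\<close> changes the curvature there by \<open>dC\<close> of its values. So
  \<open>\<kappa>\<close> has to lift minus the curvature along \<open>dC\<close>, which
  \<open>cone_exact\<close> and \<open>normalised_lift\<close> provide.\<close>

lemma flat_extension:
  assumes f: "\<And>z. (z, x) \<in> level_less \<Longrightarrow> flat_at f z (f z)"
  shows "\<exists>\<kappa>. flat_at f x \<kappa>"
proof -
  define f0 where "f0 = truncate f x (\<lambda>_ _. 0)"
  define \<nu> where "\<nu> = assemble f0"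
  \<comment> \<open>Cutting off to one level puts \<open>F\<close> in a single arity, and into
    cycles everywhere, since only at this level is the curvature known to be a cycle.\<close>
  define F where "F w y = (if w \<noteq> [] \<and> level w y = x then - curvature \<nu> w y else 0)" for w y
  have z0: "higher (\<lambda>_ _. 0)" by (rule cochain_zero_map[OF graded_C'])
  have f0: "higher (f0 z)" for z
    unfolding f0_def by (rule higher_truncate) (use f z0 in \<open>auto simp: flat_at_def\<close>)
  have f0_norm: "normalised G (f0 z)" for z
    using f[of z] by (auto simp: f0_def truncate_def flat_at_def normalised_def)
  have \<nu>: "cochain sA A sG G sC C 0 \<nu>" "\<nu> [] = base"
    unfolding \<nu>_def by (rule cochain_assemble[OF f0], rule assemble_Nil)
  \<comment> \<open>Three reasons: too low a degree, arity \<open>0\<close> where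
    \<open>base\<close> is a chain map up to sign, or an earlier level where flatness was
    arranged.\<close>
  have flat: "curvature \<nu> v y' = 0"
    if ea: "earlier v y' w y" and lw: "level w y = x" for v y' w y
  proof -
    have v: "v \<in> lists (homog A)" "y' \<in> homog G" using ea by (simp_all add: earlier_def)
    consider "low v y'" | "v = []" | "v \<noteq> []" "(level v y', x) \<in> level_less"
      using earlier_level[OF ea] lw by blast
    thus ?thesis
    proof cases
      case 1
      thus ?thesis by (intro low_zero[OF cochain_curvature[OF \<nu>(1)] v])
    next
      case 2
      thus ?thesis using v curvature_assemble_Nil by (simp add: \<nu>_def)
    next
      case 3
      have tr: "(z, x) \<in> level_less" if "(z, level v y') \<in> level_less" for z
        using transD[OF trans_level_less that 3(2)] .
      show ?thesis
        unfolding \<nu>_def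
        by (rule flat_transfer[of "level v y'" f f0, OF _ _ f0 _ _ v(1) 3(1) v(2) refl])
          (use f tr 3(2) in \<open>auto simp: f0_def truncate_def\<close>)
    qed
  qed
  have cyc: "curvature \<nu> w y \<in> Z (shdeg w + fst y - 1)"
    if "w \<in> lists (homog A)" "y \<in> homog G" "level w y = x" for w y
    by (rule curvature_cycle[OF \<nu> that(1,2) flat]) (use that in auto)
  have lZ: "linear_on t X sC (Z k) g" if "linear_on t X sC (C k) g" "\<And>x. x \<in> X \<Longrightarrow> g x \<in> Z k"
    for t X k and g :: "'b::ab_group_add \<Rightarrow> 'm \<times> 'g"
    using that by (simp add: linear_on_def)
  have qZ: "qsubmodule sC (Z k)" for k
  proof -
    interpret qmodule sC using graded_C by (simp add: graded_module_def)
    show ?thesis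
      using qsubmodule_C[of k] linear_dC[of "k - 1" k] linear_on_0[OF linear_dC[OF refl] qsubmodule_C, of k]
      by (auto simp: Z_def qsubmodule_def submodule_def linear_on_def scale_zero_right)
  qed
  have F: "cochain sA A sG G sC Z (- 1) F"
    unfolding cochain_def word_multilinear_def
  proof (intro conjI ballI allI)
    fix y us ws i assume y: "y \<in> homog G" and w: "us \<in> lists (homog A)" "ws \<in> lists (homog A)"
    let ?k = "shdeg us + (i + 1) + shdeg ws + - 1 + fst y"
    show "linear_on sA (A i) sC (Z ?k) (\<lambda>a. F (us @ (i, a) # ws) y)"
    proof (cases "level (us @ (i, 0) # ws) y = x")
      case True
      hence x: "level (us @ (i, a) # ws) y = x" for a by (simp add: level_def)
      have "linear_on sA (A i) sC (Z ?k) (\<lambda>a. curvature \<nu> (us @ (i, a) # ws) y)"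
      proof (rule lZ)
        show "linear_on sA (A i) sC (C ?k) (\<lambda>a. curvature \<nu> (us @ (i, a) # ws) y)"
          by (rule cochain_slot[OF cochain_curvature[OF \<nu>(1)] y w]) simp
        fix a assume "a \<in> A i"
        thus "curvature \<nu> (us @ (i, a) # ws) y \<in> Z ?k"
          using cyc[OF _ y x, of a] w by (simp add: homog_iff algebra_simps)
      qed
      thus ?thesis by (simp add: F_def x linear_on_uminus[OF qZ])
    next
      case False
      hence "level (us @ (i, a) # ws) y \<noteq> x" for a by (simp add: level_def)
      thus ?thesis by (simp add: F_def linear_on_zero_map[OF qZ])
    qed
  next
    fix w j assume w: "w \<in> lists (homog A)"
    let ?k = "shdeg w + j + - 1"
    show "linear_on sG (G j) sC (Z ?k) (\<lambda>y. F w (j, y))"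
    proof (cases "w \<noteq> [] \<and> (length w, deg w + j) = x")
      case True
      have "linear_on sG (G j) sC (Z ?k) (\<lambda>y. curvature \<nu> w (j, y))"
      proof (rule lZ)
        show "linear_on sG (G j) sC (C ?k) (\<lambda>y. curvature \<nu> w (j, y))"
          by (rule cochain_linear[OF cochain_curvature[OF \<nu>(1)] w refl])
        fix y assume "y \<in> G j"
        thus "curvature \<nu> w (j, y) \<in> Z ?k"
          using cyc[OF w, of "(j, y)"] True by (simp add: homog_iff level_def)
      qed
      thus ?thesis using True by (simp add: F_def level_def linear_on_uminus[OF qZ])
    next
      case False
      hence "F w (j, y) = 0" for y by (auto simp: F_def level_def)
      thus ?thesis by (simp add: linear_on_zero_map[OF qZ])
    qed
  qed
  have F0: "F w y = 0" if "length w \<noteq> fst x" for w y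
    using that by (auto simp: F_def level_def)
  have F_norm: "normalised G F"
    using normalised_curvature_assemble[of f0, OF f0 f0_norm]
    by (simp add: normalised_def F_def \<nu>_def)
  \<comment> \<open>\<open>dC\<close> lowers degrees by one. Regrading its source makes it preserve
    degrees, so the lift has degree -1 here and degree \<open>0\<close> in
    \<open>C'\<close>.\<close>
  have N: "graded_module sC (\<lambda>k. C' (k + 1))"
    using graded_C' by (simp add: graded_module_def)
  have D1: "linear_on sC (C' (k + 1)) sC (Z k) (dC (k + 1))" for k
  proof -
    have "linear_on sC (C (k + 1)) sC (C k) (dC (k + 1))" by (rule linear_dC) simp
    moreover have "dC k (dC (k + 1) v) = 0" if "v \<in> C (k + 1)" for v
    proof -
      have m: "fst v \<in> M (k + 1)" and g: "snd v \<in> G k" using that by (auto simp: C_def)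
      have l: "linear_on sC (C k) sC (C (k - 1)) (dC k)" by (rule linear_dC) simp
      have "\<mu>M [] (k + 1, fst v) \<in> M k" by (rule linear_on_mem[OF linear_\<mu>M1 m]) simp
      hence 1: "(\<mu>M [] (k + 1, fst v), 0) \<in> C k" using qsubmodule_zero[OF qsubmodule_G] by (simp add: C_def)
      have 2: "base (k, snd v) \<in> C k" by (rule linear_on_mem[OF linear_base g])
      have "dC (k + 1) v = (\<mu>M [] (k + 1, fst v), 0) + base (k, snd v)"
        by (simp add: dC_def base_def)
      hence "dC k (dC (k + 1) v) = dC k (\<mu>M [] (k + 1, fst v), 0)"
        using linear_on_add[OF l 1 2] dC_base[OF g] by simp
      also have "\<dots> = 0"
        using \<mu>M1_\<mu>M1[OF m] linear_on_0[OF linear_\<epsilon>1 qsubmodule_G] linear_on_0[OF linear_dG[OF refl] qsubmodule_G]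
        by (simp add: dC_def zero_prod_def)
      finally show ?thesis .
    qed
    ultimately show ?thesis
      using C'_subset[of "k + 1"] unfolding linear_on_def Z_def by blast
  qed
  obtain \<kappa> where \<kappa>: "cochain sA A sG G sC (\<lambda>k. C' (k + 1)) (- 1) \<kappa>" "normalised G \<kappa>"
    "\<And>w y. w \<in> lists (homog A) \<Longrightarrow> y \<in> homog G \<Longrightarrow> dC (shdeg w + fst y + - 1 + 1) (\<kappa> w y) = F w y"
    using normalised_lift[of sG G sC "\<lambda>k. C' (k + 1)" sC Z "\<lambda>k. dC (k + 1)" "- 1" F "fst x",
        OF A_projective graded_G G_projective N D1 cone_exact F F0 F_norm] by blast
  have \<kappa>h: "higher \<kappa>"
    using \<kappa>(1) by (simp add: cochain_def word_multilinear_def algebra_simps)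
  have "curvature (assemble (truncate f x \<kappa>)) w y = 0"
    if w: "w \<in> lists (homog A)" "w \<noteq> []" and y: "y \<in> homog G" and x: "level w y = x" for w y
  proof -
    let ?f = "truncate f x \<kappa>" and ?k = "shdeg w + fst y"
    have h: "higher (?f z)" for z
      by (rule higher_truncate[OF _ \<kappa>h]) (use f in \<open>auto simp: flat_at_def\<close>)
    have agree: "?f z = f0 z" if "(z, level w y) \<in> level_less" for z
      using that x by (simp add: truncate_def f0_def)
    \<comment> \<open>Both cochains agree at earlier arguments, so their curvatures differ by
      \<open>dC\<close> of the added value.\<close>
    have loc: "curvature (assemble ?f) w y - dC ?k (assemble ?f w y) = curvature \<nu> w y - dC ?k (\<nu> w y)"
      unfolding \<nu>_def
      by (rule curvature_local[OF cochain_assemble[of ?f, OF h] assemble_Nil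
            cochain_assemble[of f0, OF f0] assemble_Nil w y assemble_agree[of ?f f0, OF h f0 agree]])
    have nx: "(x, x) \<notin> level_less" by (rule wf_not_refl[OF wf_level_less])
    have eq: "assemble ?f w y = \<nu> w y + \<kappa> w y"
      using w(2) nx by (simp add: \<nu>_def assemble_def x f0_def truncate_def)
    have "\<nu> w y \<in> C ?k" by (rule cochain_mem[OF \<nu>(1) w(1) y]) simp
    moreover have "\<kappa> w y \<in> C ?k"
      using cochain_mem[OF \<kappa>h w(1) y refl] C'_subset by auto
    ultimately have "dC ?k (assemble ?f w y) = dC ?k (\<nu> w y) + dC ?k (\<kappa> w y)"
      unfolding eq by (rule linear_on_add[OF linear_dC[OF refl]])
    with loc \<kappa>(3)[OF w(1) y] w(2) x show ?thesis by (simp add: F_def)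
  qed
  thus ?thesis using \<kappa>(2) \<kappa>h unfolding flat_at_def by blast
qed

lemma flat_structure_exists:
  "\<exists>f. (\<forall>z. higher (f z) \<and> normalised G (f z)) \<and>
     (\<forall>w\<in>lists (homog A). \<forall>y\<in>homog G. curvature (assemble f) w y = 0)"
proof -
  have "\<exists>f. \<forall>x. flat_at f x (f x)"
  proof (rule dependent_wf_choice[OF wf_level_less])
    fix f g :: "nat \<times> int \<Rightarrow> (int \<times> 'a) list \<Rightarrow> int \<times> 'g \<Rightarrow> 'm \<times> 'g" and x \<kappa>
    assume "\<And>z. (z, x) \<in> level_less \<Longrightarrow> f z = g z"
    hence "truncate f x \<kappa> = truncate g x \<kappa>" by (auto simp: truncate_def)
    thus "flat_at f x \<kappa> = flat_at g x \<kappa>" by (simp add: flat_at_def)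
  qed (rule flat_extension)
  then obtain f where f: "\<And>x. flat_at f x (f x)" by blast
  have h: "higher (f z)" "normalised G (f z)" for z using f[of z] by (simp_all add: flat_at_def)
  have "curvature (assemble f) w y = 0" if "w \<in> lists (homog A)" "y \<in> homog G" for w y
    using flat_transfer[of _ f f, OF f f h(1) refl refl _ _ _ refl] that curvature_assemble_Nil
    by (cases "w = []") auto
  with h show ?thesis by blast
qed

section \<open>The transferred structure\<close>

text \<open>The two components of a flat \<open>\<nu>\<close>, freed from the signs of the shift and
  desuspended, are the morphism and the module structure. The other claims are read off from the
  shape of \<open>assemble\<close>.\<close>

lemma structure_exists:
  "\<exists>\<mu>G \<epsilon>.
      ainf_module sA A \<mu>A sG G \<mu>G \<and> \<mu>G [] = dG \<and>
      ainf_quasi_isomorphism sA A \<mu>A sG G \<mu>G sM M \<mu>M \<epsilon> \<and> \<epsilon> [] = \<epsilon>1 \<and>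
      (degreewise_surjective G M \<epsilon>1 \<longrightarrow> strict_ainf_morphism sA A \<mu>A sG G \<mu>G sM M \<mu>M \<epsilon>) \<and>
      (r u = 1 \<longrightarrow> strict_unit_action G \<mu>G \<and> normalised G \<epsilon>)"
proof -
  obtain f where f: "\<And>z. higher (f z)" "\<And>z. normalised G (f z)"
    and flat: "\<And>w y. w \<in> lists (homog A) \<Longrightarrow> y \<in> homog G \<Longrightarrow> curvature (assemble f) w y = 0"
    using flat_structure_exists by blast
  define \<nu> where "\<nu> = assemble f"
  define cG where "cG w y = signed (shdeg w + 1) (snd (\<nu> w y))" for w y
  define p where "p w y = signed (shdeg w) (fst (\<nu> w y))" for w y
  define \<mu>G where "\<mu>G = susp cG"
  define \<epsilon> where "\<epsilon> = susp p"
  have \<nu>: "cochain sA A sG G sC C 0 \<nu>" unfolding \<nu>_def by (rule cochain_assemble[OF f(1)])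
  have cG: "cochain sA A sG G sG G (- 1) (susp \<mu>G)"
    unfolding \<mu>G_def susp_susp cG_def[abs_def]
    by (rule cochain_signed[OF cochain_image[OF \<nu> linear_snd] graded_G]) simp_all
  have p: "cochain sA A sG G sM M 0 (susp \<epsilon>)"
    unfolding \<epsilon>_def susp_susp p_def[abs_def]
    by (rule cochain_signed[OF cochain_image[OF \<nu>, of _ _ 0] M.graded]) (simp_all add: linear_fst)
  have Nil: "\<mu>G [] = dG" "\<epsilon> [] = \<epsilon>1"
    by (rule ext, simp add: \<mu>G_def \<epsilon>_def cG_def p_def susp_def \<nu>_def assemble_def base_def signed_def)+
  have module: "ainf_module sA A \<mu>A sG G \<mu>G"
  proof
    show "graded_module sG G" by (rule graded_G)
  next
    fix k :: nat assume k: "k \<ge> 1"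
    have "multilinear_module sA A sG G sG G (k - 1) (int (k - 1) + - 1) \<mu>G"
      using cochain_susp[OF cG graded_G] unfolding susp_susp cochain_iff_multilinear_module by blast
    thus "multilinear_module sA A sG G sG G (k - 1) (int k - 2) \<mu>G"
      using k by (simp add: of_nat_diff)
  next
    fix k :: nat and as and y :: "int \<times> 'g"
    assume *: "k \<ge> 1" "as \<in> lists (homog A)" "length as = k - 1" "y \<in> homog G"
    have k: "k = Suc (length as)" using * by simp
    show "(\<Sum>(u, v, w) | u + v + w = k \<and> v \<ge> 1 \<and> w \<ge> 1.
         signed (int (u + v * w) + (int v - 2) * deg (take u as))
           (\<mu>G (take u as @ app (int v - 2) \<mu>A (take v (drop u as)) # drop (u + v) as) y)) +
      (\<Sum>(u, v) | u + v = k \<and> v \<ge> 1.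
         signed (int u + (int v - 2) * deg (take u as))
           (\<mu>G (take u as) (app_module (int v - 2) \<mu>G (drop u as) y))) = 0"
      unfolding module_relation_iff[OF graded_G cG *(2,4) k]
      unfolding \<mu>G_def susp_susp cG_def[abs_def]
      by (rule curvature_zero_components(1)[OF \<nu> *(2,4)]) (simp add: \<nu>_def flat *)
  qed
  interpret G: ainf_module sA A \<mu>A sG G \<mu>G by (rule module)
  have morphism: "ainf_morphism sA A \<mu>A sG G \<mu>G sM M \<mu>M \<epsilon>"
  proof
    fix k :: nat assume k: "k \<ge> 1"
    have "multilinear_module sA A sG G sM M (k - 1) (int (k - 1) + 0) \<epsilon>"
      using cochain_susp[OF p M.graded] unfolding susp_susp cochain_iff_multilinear_module by blast
    thus "multilinear_module sA A sG G sM M (k - 1) (int k - 1) \<epsilon>"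
      using k by (simp add: of_nat_diff)
  next
    fix k :: nat and as and y :: "int \<times> 'g"
    assume *: "k \<ge> 1" "as \<in> lists (homog A)" "length as = k - 1" "y \<in> homog G"
    have k: "k = Suc (length as)" using * by simp
    show "(\<Sum>(u, v, w) | u + v + w = k \<and> v \<ge> 1 \<and> w \<ge> 1.
         signed (int (u + v * w) + (int v - 2) * deg (take u as))
           (\<epsilon> (take u as @ app (int v - 2) \<mu>A (take v (drop u as)) # drop (u + v) as) y)) +
      (\<Sum>(u, v) | u + v = k \<and> v \<ge> 1.
         signed (int u + (int v - 2) * deg (take u as))
           (\<epsilon> (take u as) (app_module (int v - 2) \<mu>G (drop u as) y))) =
      (\<Sum>(u, v) | u + v = k \<and> v \<ge> 1.
         signed ((int v - 1) * deg (take u as))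
           (\<mu>M (take u as) (app_module (int v - 1) \<epsilon> (drop u as) y)))"
      unfolding morphism_relation_iff[OF graded_G M.graded cG cochain_cM p *(2,4) k]
      unfolding \<mu>G_def \<epsilon>_def susp_susp cG_def[abs_def] p_def[abs_def]
      by (rule curvature_zero_components(2)[OF \<nu> *(2,4)]) (simp add: \<nu>_def flat *)
  qed
  interpret \<epsilon>: ainf_morphism sA A \<mu>A sG G \<mu>G sM M \<mu>M \<epsilon> by (rule morphism)
  have "ainf_quasi_isomorphism sA A \<mu>A sG G \<mu>G sM M \<mu>M \<epsilon>"
    by standard (simp add: Nil quasi_iso)
  moreover have "strict_ainf_morphism sA A \<mu>A sG G \<mu>G sM M \<mu>M \<epsilon>" if "degreewise_surjective G M \<epsilon>1"
  proof
    fix as and y :: "int \<times> 'g"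
    assume *: "as \<in> lists (homog A)" "as \<noteq> []" "y \<in> homog G"
    \<comment> \<open>In positive arity both summands take values in \<open>C'\<close>, whose first
      component is zero in the surjective case.\<close>
    have "unit_op as y + f (level as y) as y \<in> C' (shdeg as + fst y)"
      by (intro qsubmodule_add[OF graded_module_qsubmodule[OF graded_C']]
          cochain_mem[OF cochain_unit_op *(1,3)] cochain_mem[OF f(1) *(1,3)]) simp_all
    hence "fst (unit_op as y + f (level as y) as y) = 0"
      using that unfolding C'_def mem_Times_iff by simp
    thus "\<epsilon> as y = 0"
      using *(2) by (simp only: \<epsilon>_def susp_def p_def \<nu>_def assemble_def if_False signed_0)
  qed
  moreover have "strict_unit_action G \<mu>G \<and> normalised G \<epsilon>" if ru: "r u = 1"
  proof -
    interpret g: qmodule sG using graded_G by (simp add: graded_module_def)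
    have f0: "f z (us @ (0, u) # ws) y = 0"
      if "us \<in> lists (homog A)" "ws \<in> lists (homog A)" "y \<in> homog G" for z us ws y
      using f(2)[of z] that by (simp add: normalised_def)
    \<comment> \<open>On the unit only the prescribed part is left: identity into \<open>G\<close>,
      zero into \<open>M\<close>.\<close>
    have 1: "\<nu> [(0, u)] y = (0, snd y)" if "y \<in> homog G" for y
      using f0[of "[]" "[]" y] that by (simp add: \<nu>_def assemble_def unit_op_def ru g.scale_one)
    have 2: "\<nu> (us @ (0, u) # ws) y = 0"
      if "us \<in> lists (homog A)" "ws \<in> lists (homog A)" "y \<in> homog G" "us @ ws \<noteq> []" for us ws y
    proof -
      have "unit_op (us @ (0, u) # ws) y = 0"
        using that(4) by (cases us; cases "tl us"; cases ws) (auto simp: unit_op_def split: list.split)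
      thus ?thesis using f0[OF that(1-3)] by (simp add: \<nu>_def assemble_def)
    qed
    have "strict_unit_action G \<mu>G"
      unfolding strict_unit_action_def
      by (auto simp: \<mu>G_def susp_def cG_def 1 2 signed_def)
    moreover have "\<epsilon> (us @ (0, u) # ws) y = 0"
      if "us \<in> lists (homog A)" "ws \<in> lists (homog A)" "y \<in> homog G" for us ws y
      using 1[OF that(3)] 2[OF that] by (cases "us @ ws = []") (auto simp: \<epsilon>_def susp_def p_def)
    ultimately show ?thesis unfolding normalised_def by blast
  qed
  ultimately show ?thesis using module Nil by blast
qed

end

text \<open>Evaluate the product of the two units in both ways. Thus a structure built for one unit
  satisfies a claim quantified over all units.\<close>

lemma strict_unit_unique:
  assumes "strictly_unital_algebra sA A \<mu>A \<eta>" "strictly_unital_algebra sA A \<mu>A \<eta>'"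
  shows "\<eta> = \<eta>'"
proof
  fix q
  interpret a: strictly_unital_algebra sA A \<mu>A \<eta> by fact
  interpret b: strictly_unital_algebra sA A \<mu>A \<eta>' by fact
  interpret qmodule sA using a.graded by (simp add: graded_module_def)
  have "\<eta> x \<in> A 0" "\<eta>' x \<in> A 0" for x
    using a.unit_linear b.unit_linear by (simp_all add: linear_on_def)
  hence "(0, \<eta> x) \<in> homog A" "(0, \<eta>' x) \<in> homog A" for x by (simp_all add: homog_iff)
  hence "sA q (\<eta>' 1) = sA 1 (\<eta> q)"
    using a.unit_left[of "(0, \<eta>' 1)" q] b.unit_right[of "(0, \<eta> q)" 1] by simp
  moreover have "sA q (\<eta>' 1) = \<eta>' q"
    using linear_on_scale[OF b.unit_linear, of 1 q] by simp
  ultimately show "\<eta> q = \<eta>' q" by (simp add: scale_one)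
qed

theorem proposition7p12:
  fixes sA :: "'q::{comm_ring,comm_monoid_mult} \<Rightarrow> 'a::ab_group_add \<Rightarrow> 'a"
    and A :: "int \<Rightarrow> 'a set"
    and \<mu>A :: "(int \<times> 'a) list \<Rightarrow> 'a"
    and sM :: "'q \<Rightarrow> 'm::ab_group_add \<Rightarrow> 'm"
    and M :: "int \<Rightarrow> 'm set"
    and \<mu>M :: "(int \<times> 'a) list \<Rightarrow> int \<times> 'm \<Rightarrow> 'm"
    and sG :: "'q \<Rightarrow> 'g::ab_group_add \<Rightarrow> 'g"
    and G :: "int \<Rightarrow> 'g set"
    and dG :: "int \<times> 'g \<Rightarrow> 'g"
    and \<epsilon>1 :: "int \<times> 'g \<Rightarrow> 'm"
  assumes "ainf_algebra sA A \<mu>A"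
    and "bounded_below A" and "\<forall>i. projective sA (A i)"
    and "ainf_module sA A \<mu>A sM M \<mu>M"
    and "chain_complex sG G dG"
    and "bounded_below G" and "\<forall>i. projective sG (G i)"
    and "quasi_isomorphism sG G dG sM M (\<mu>M []) \<epsilon>1"
  shows "\<exists>\<mu>G \<epsilon>.
      ainf_module sA A \<mu>A sG G \<mu>G \<and>
      (\<forall>y\<in>homog G. \<mu>G [] y = dG y) \<and>
      ainf_quasi_isomorphism sA A \<mu>A sG G \<mu>G sM M \<mu>M \<epsilon> \<and>
      (\<forall>y\<in>homog G. \<epsilon> [] y = \<epsilon>1 y) \<and>
      (degreewise_surjective G M \<epsilon>1 \<longrightarrow>
         strict_ainf_morphism sA A \<mu>A sG G \<mu>G sM M \<mu>M \<epsilon>) \<and>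
      (\<forall>\<eta>. split_unital_algebra sA A \<mu>A \<eta> \<and> strictly_unital_module sA A \<mu>A \<eta> sM M \<mu>M \<longrightarrow>
         strictly_unital_module sA A \<mu>A \<eta> sG G \<mu>G \<and>
         strictly_unital_morphism sA A \<mu>A \<eta> sG G \<mu>G sM M \<mu>M \<epsilon>)"
proof -
  interpret ainf_algebra sA A \<mu>A by fact
  interpret qmodule sA using graded by (simp add: graded_module_def)
  obtain a0 where a0: "\<And>i. i < a0 \<Longrightarrow> A i = {0}" using assms(2) by (auto simp: bounded_below_def)
  obtain g0 where g0: "\<And>i. i < g0 \<Longrightarrow> G i = {0}" using assms(6) by (auto simp: bounded_below_def)
  have axioms: "resolution sA A \<mu>A u r sM M \<mu>M sG G dG \<epsilon>1 a0 g0"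
    if "unit_splitting sA A \<mu>A u r"
      "u = 0 \<or> unit_splitting.strict_unit A \<mu>A u \<and> unit_splitting.strict_unit_action A u M \<mu>M \<and> r u = 1"
    for u r
    unfolding resolution_def resolution_axioms_def using assms a0 g0 that by blast
  \<comment> \<open>One pair of structure and morphism has to serve every \<open>\<eta>\<close>.
    Either no \<open>\<eta>\<close> qualifies, or there is exactly one.\<close>
  show ?thesis
  proof (cases "\<exists>\<eta>. split_unital_algebra sA A \<mu>A \<eta> \<and> strictly_unital_module sA A \<mu>A \<eta> sM M \<mu>M")
    case False
    \<comment> \<open>The trivial splitting, with which normalisation is no condition.\<close>
    have "unit_splitting sA A \<mu>A 0 (\<lambda>_. 0)"
      by standard (auto simp: linear_on_def scale_zero_right qsubmodule_zero[OF qsubmodule_A])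
    then interpret resolution sA A \<mu>A 0 "\<lambda>_. 0" sM M \<mu>M sG G dG \<epsilon>1 a0 g0
      by (rule axioms) simp
    from structure_exists obtain \<mu>G \<epsilon> where "ainf_module sA A \<mu>A sG G \<mu>G" "\<mu>G [] = dG"
      "ainf_quasi_isomorphism sA A \<mu>A sG G \<mu>G sM M \<mu>M \<epsilon>" "\<epsilon> [] = \<epsilon>1"
      "degreewise_surjective G M \<epsilon>1 \<longrightarrow> strict_ainf_morphism sA A \<mu>A sG G \<mu>G sM M \<mu>M \<epsilon>"
      by blast
    thus ?thesis using False by (intro exI[of _ \<mu>G] exI[of _ \<epsilon>]) (simp, blast)
  next
    case True
    then obtain \<eta> where split: "split_unital_algebra sA A \<mu>A \<eta>"
      and unital: "strictly_unital_module sA A \<mu>A \<eta> sM M \<mu>M" by blast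
    interpret split_unital_algebra sA A \<mu>A \<eta> by (rule split)
    interpret unital: strictly_unital_module sA A \<mu>A \<eta> sM M \<mu>M by (rule unital)
    obtain r where r: "linear_on sA (A 0) (*) UNIV r" "\<And>q. r (\<eta> q) = q" using unit_split by blast
    \<comment> \<open>The construction knows only the element \<open>\<eta> 1\<close>; the unit
      conditions for all \<open>q\<close> follow by linearity, see \<open>scaled\<close>.\<close>
    have \<eta>: "\<eta> q = sA q (\<eta> 1)" for q using linear_on_scale[OF unit_linear, of 1 q] by simp
    have \<eta>_mem: "\<eta> q \<in> A 0" for q using linear_on_mem[OF unit_linear] by simp
    have us: "unit_splitting sA A \<mu>A (\<eta> 1) r"
      by standard (simp_all add: \<eta>_mem r scale_one)
    interpret U: unit_splitting sA A \<mu>A "\<eta> 1" r by (rule us)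
    interpret resolution sA A \<mu>A "\<eta> 1" r sM M \<mu>M sG G dG \<epsilon>1 a0 g0
    proof (rule axioms[OF us], intro disjI2 conjI)
      show "U.strict_unit"
        using unit_left unit_right unit_vanish by (auto simp: U.strict_unit_def scale_one)
      interpret m: qmodule sM using unital.graded by (simp add: graded_module_def)
      show "U.strict_unit_action M \<mu>M"
        unfolding U.strict_unit_action_def
      proof (intro conjI ballI impI)
        fix us ws y assume "us \<in> lists (homog A)" "ws \<in> lists (homog A)" "y \<in> homog M" "us @ ws \<noteq> []"
        thus "\<mu>M (us @ (0, \<eta> 1) # ws) y = 0"
          by (intro unital.unit_vanish) (auto simp: Suc_le_eq)
      qed (simp add: unital.unit_act m.scale_one)
      show "r (\<eta> 1) = 1" by (rule r)
    qed
    from structure_exists r(2) obtain \<mu>G \<epsilon> where module: "ainf_module sA A \<mu>A sG G \<mu>G" "\<mu>G [] = dG"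
      and morphism: "ainf_quasi_isomorphism sA A \<mu>A sG G \<mu>G sM M \<mu>M \<epsilon>" "\<epsilon> [] = \<epsilon>1"
      and strict: "degreewise_surjective G M \<epsilon>1 \<longrightarrow> strict_ainf_morphism sA A \<mu>A sG G \<mu>G sM M \<mu>M \<epsilon>"
      and unit: "U.strict_unit_action G \<mu>G" "U.normalised G \<epsilon>"
      by blast
    interpret G: ainf_module sA A \<mu>A sG G \<mu>G by (rule module)
    interpret E: ainf_quasi_isomorphism sA A \<mu>A sG G \<mu>G sM M \<mu>M \<epsilon> by (rule morphism)
    have \<mu>G: "cochain sA A sG G sG G (- 1) \<mu>G"
      unfolding cochain_iff_multilinear_module
    proof
      fix n show "multilinear_module sA A sG G sG G n (int n + - 1) \<mu>G"
        using G.multilinear[of "Suc n"] by (simp add: algebra_simps)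
    qed
    have \<epsilon>: "cochain sA A sG G sM M 0 \<epsilon>"
      unfolding cochain_iff_multilinear_module
    proof
      fix n show "multilinear_module sA A sG G sM M n (int n + 0) \<epsilon>"
        using E.multilinear[of "Suc n"] by (simp add: algebra_simps)
    qed
    have scaled: "\<phi> (us @ (0, \<eta> q) # ws) y = sN q (\<phi> (us @ (0, \<eta> 1) # ws) y)"
      if "cochain sA A sG G sN N d \<phi>" "us \<in> lists (homog A)" "ws \<in> lists (homog A)" "y \<in> homog G"
      for \<phi> sN N d us ws y q
      by (subst \<eta>) (rule linear_on_scale[OF cochain_slot[OF that(1,4,2,3) refl] \<eta>_mem])
    interpret g: qmodule sG using G.graded by (simp add: graded_module_def)
    interpret m: qmodule sM using unital.graded by (simp add: graded_module_def)
    have 1: "strictly_unital_module sA A \<mu>A \<eta> sG G \<mu>G"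
    proof
      fix y q assume "y \<in> homog G"
      thus "\<mu>G [(0, \<eta> q)] y = sG q (snd y)"
        using scaled[OF \<mu>G, of "[]" "[]" y q] unit(1) by (simp add: U.strict_unit_action_def)
    next
      fix us ws y q
      assume *: "us \<in> lists (homog A)" "ws \<in> lists (homog A)" "y \<in> homog G" "length us + length ws \<ge> 1"
      have "us @ ws \<noteq> []" using *(4) by auto
      hence "\<mu>G (us @ (0, \<eta> 1) # ws) y = 0"
        using unit(1) * unfolding U.strict_unit_action_def by blast
      thus "\<mu>G (us @ (0, \<eta> q) # ws) y = 0"
        by (simp only: scaled[OF \<mu>G *(1-3), of q] g.scale_zero_right)
    qed
    interpret G1: strictly_unital_module sA A \<mu>A \<eta> sG G \<mu>G by (rule 1)
    have 2: "strictly_unital_morphism sA A \<mu>A \<eta> sG G \<mu>G sM M \<mu>M \<epsilon>"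
    proof
      fix us ws y q
      assume *: "us \<in> lists (homog A)" "ws \<in> lists (homog A)" "y \<in> homog G"
      hence "\<epsilon> (us @ (0, \<eta> 1) # ws) y = 0"
        using unit(2) unfolding U.normalised_def by blast
      thus "\<epsilon> (us @ (0, \<eta> q) # ws) y = 0"
        by (simp only: scaled[OF \<epsilon> *, of q] m.scale_zero_right)
    qed
    have "\<eta>' = \<eta>" if "split_unital_algebra sA A \<mu>A \<eta>'" for \<eta>'
      using strict_unit_unique[of sA A \<mu>A \<eta>' \<eta>] that split by (simp add: split_unital_algebra_def)
    thus ?thesis
      using module morphism strict 1 2 by (intro exI[of _ \<mu>G] exI[of _ \<epsilon>]) auto
  qed
qed

end
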